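(* Let $c,d\in\mathbb{N}$ be coprime, $n=c+d$, $\mathfrak{g}=\mathfrak{sl}_n(\mathbb{C})$, $E$ a nodal Weierstraß cubic, $\mathcal{A}_{(n,d)}=\ker(\mathrm{tr}:\mathcal{E}nd_E(\mathcal{P})\to\mathcal{O}_E)$ for a simple vector bundle $\mathcal{P}$ of rank $n$ and degree $d$ on $E$. Let $r=\rho^\xi$ be the function on $\{(x,y)\in\mathbb{C}^\ast\times\mathbb{C}^\ast\mid x\neq y\}$ with values in $\mathfrak{g}\otimes\mathfrak{g}$ obtained from the geometric $r$-matrix $\rho$ attached to $(E,\mathcal{A}_{(n,d)})$ by means of the trivialization $\xi$ described in the context. Then $$r(x,y)=\frac12\Bigl(\frac{y+x}{y-x}\gamma+\sum_{\alpha\in\Phi_+}e_\alpha\wedge e_{-\alpha}\Bigr)+\sum_{\alpha\in\Phi_+}\Bigl(\Bigl(\sum_{k=1}^{p(\alpha)-1}e_{\tau^k(\alpha)}\wedge e_{-\alpha}\Bigr)+x\,e_{\tau^{p(\alpha)}(\alpha)}\otimes e_{-\alpha}-y\,e_{-\alpha}\otimes e_{\tau^{p(\alpha)}(\alpha)}\Bigr)+\sum_{i=1}^{n-1}q_i^\ast\otimes f_i.$$ In other words, $r(x,y)$ is the quasi-trigonometric solution attached to the Lagrangian order $\mathfrak{W}_{(c,d)}$.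
   Context: Geometric $r$-matrix. Let $\nu:\mathbb{P}^1\to E$ be the normalization, with coordinates such that the preimage of the node is $\{(1:0),(0:1)\}$; identify $x\in\mathbb{C}^\ast$ with the smooth point $\nu(1:x)$; $\breve E\cong\mathbb{C}^\ast$ is the smooth part and $\omega=\frac{dz}{z}$. The sheaf $\mathcal{A}=\mathcal{A}_{(n,d)}$ is independent of the choice of $\mathcal{P}$ (simple means $\mathrm{End}_E(\mathcal{P})=\mathbb{C}$), and $H^0(\mathcal{A})=H^1(\mathcal{A})=0$. For $x\ne y\in\breve E$, let $\mathrm{res}_x^\omega:\Gamma(E,\mathcal{A}(x))\to\mathcal{A}|_x$ be the residue isomorphism and $\mathrm{ev}_y:\Gamma(E,\mathcal{A}(x))\to\mathcal{A}|_y$ the evaluation; $\rho(x,y)\in\mathcal{A}|_x\otimes\mathcal{A}|_y$ is the tensor corresponding to $\mathrm{ev}_y\circ(\mathrm{res}_x^\omega)^{-1}$ via the trace form on $\mathcal{A}|_x$. The trivialization $\xi$. The choice of homogeneous coordinates $(z_0:z_1)$ on $\mathbb{P}^1$ and of the trivializations $g\mapsto(g/z_0^k,g/z_1^k)$ of $\mathcal{O}_{\mathbb{P}^1}(k)$ at the points $(1:0)$ and $(0:1)$ yields (known) a trivialization $\xi:\Gamma(\breve E,\mathcal{A})\to\mathfrak{g}\otimes\Gamma(\breve E,\mathcal{O}_E)$ and, for each $x\in\mathbb C^*$, an embedding $\bar\xi:\Gamma(E,\mathcal{A}(x))\to\mathfrak{g}[z]$ with image $$\mathsf{Sol}=\left\{F(z)=\begin{pmatrix}A_0+zA_1&B\\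 C_0+zC_1+z^2C_2&D_0+zD_1\end{pmatrix}\in\mathfrak{g}[z]\;\middle|\;F_0=-xF_\infty^\sharp\right\},\quad F_0=\begin{pmatrix}A_0&B\\ C_0&D_0\end{pmatrix},\ F_\infty=\begin{pmatrix}A_1&B\\ C_2&D_1\end{pmatrix},$$ (blocks: upper left $c\times c$, lower right $d\times d$; $\begin{pmatrix}A&B\\ C&D\end{pmatrix}^\sharp=\begin{pmatrix}D&C\\ B&A\end{pmatrix}$) such that, under $\bar\xi$ and the fibrewise isomorphisms $\xi_x,\xi_y$ to $\mathfrak{g}$, the maps $\mathrm{res}_x^\omega$ and $\mathrm{ev}_y$ become $\overline{\mathrm{res}}_x(F)=\frac1xF(x)$ and $\overline{\mathrm{ev}}_y(F)=\frac1{y-x}F(y)$ on $\mathsf{Sol}$. Thus $r(x,y)=\rho^\xi(x,y)=\sum_\beta g_\beta^\ast\otimes\overline{\mathrm{ev}}_y\bigl(\overline{\mathrm{res}}_x^{-1}(g_\beta)\bigr)$ for a basis $(g_\beta)$ of $\mathfrak{g}$ with trace-dual basis $(g_\beta^\ast)$. Notation in the formula. $\bar\Phi=\{(i,j)\mid1\le i,j\le n\}\cong(\mathbb{Z}/n\mathbb{Z})^2$, $\Phi_+=\{(i,j)\mid i<j\}$, $-(i,j)=(j,i)$, $e_{(i,j)}=e_{ij}$; $\tau(i,j)=(i+c,j+c)$ (mod $n$), and also $\tau:\mathfrak{gl}_n(\mathbb C)\to\mathfrak{gl}_n(\mathbb C)$, $e_{ij}\mapsto e_{i+c,j+c}$;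 $p(\alpha)=\min\{k\ge1\mid\tau^k(\alpha)\notin\Phi_+\}$. With $u=e_{11}$, $q_i=\tau^i(u)-\tau^{i-1}(u)$, $f_i=\frac12(\tau^i(u)+\tau^{i-1}(u))-\frac1nI$ for $1\le i\le n-1$, and $(q_i^\ast)$ is the basis of the diagonal Cartan subalgebra dual to $(q_i)$ for the trace form. $\gamma$ is the Casimir element of the trace form, $a\wedge b=a\otimes b-b\otimes a$. The order and its solution. $\mathfrak{D}=\mathfrak{g}((z^{-1}))\times\mathfrak{g}$ with form $\langle(F_1,f_1),(F_2,f_2)\rangle=\mathrm{res}_0(\mathrm{Tr}(F_1F_2)\frac{dz}{z})-\mathrm{tr}(f_1f_2)$ ($\mathrm{res}_0(g\frac{dz}z)$ is the $z^0$-coefficient of $g$); $\jmath:\mathfrak{g}[z]\to\mathfrak{D}$, $F\mapsto(F(z),F(0))$, $\mathfrak{P}=\mathrm{im}(\jmath)$. With $\mathfrak{b}_{(c,d)}=\{\begin{pmatrix}A&0\\ C&D\end{pmatrix}\}\subset\mathfrak g$ and $\mathfrak{n}_{(c,d)}=\{\begin{pmatrix}0&0\\ C&0\end{pmatrix}\}$, $$\mathfrak{W}_{(c,d)}=\bigl(z^{-2}\mathfrak{g}[[z^{-1}]]+z^{-1}\mathfrak{b}_{(c,d)}+\mathfrak{n}_{(c,d)}\bigr)\times\{0\}+\left\{\left(\begin{pmatrix}A&z^{-1}B\\ zC&D\end{pmatrix},\begin{pmatrix}D&C\\ B&A\end{pmatrix}\right)\;\middle|\;\begin{pmatrix}A&B\\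 C&D\end{pmatrix}\in\mathfrak{g}\right\},$$ which is a Lagrangian subalgebra with $\mathfrak{D}=\mathfrak{P}\dotplus\mathfrak{W}_{(c,d)}$. The quasi-trigonometric solution attached to it is $\sum_{k\ge0,\beta}x^kg_\beta\otimes\pi(w_{(k,\beta)})|_{z=y}$, where $w_{(k,\beta)}\in\mathfrak{W}_{(c,d)}$ are the elements with $\langle\jmath(z^kg_\beta),w_{(k',\beta')}\rangle=\delta_{kk'}\delta_{\beta\beta'}$ and $\pi:\mathfrak{D}\to\mathfrak{g}((z^{-1}))$ is the projection ($\frac1{y-x}$ expanded in powers of $xy^{-1}$). *)

theory Defs
  imports
    "HOL-Complex_Analysis.Laurent_Convergence"
    "HOL-Computational_Algebra.Polynomial_Factorial"
    "HOL-Library.Function_Algebras"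
    "Jordan_Normal_Form.Determinant"
begin

hide_const (open) Finite_Cartesian_Product.mat Determinants.det Determinants.trace
  Finite_Cartesian_Product.row Finite_Cartesian_Product.vec

section \<open>Matrices and the Lie algebra of traceless matrices\<close>

text \<open>
  Matrix indices run over \<open>0, \<dots>, n - 1\<close> instead of \<open>1, \<dots>, n\<close>. The order of the indices and
  the shift by \<open>c\<close> modulo \<open>n\<close> are compatible with this change.
\<close>

definition tr :: "'a::comm_ring_1 mat \<Rightarrow> 'a" where
  "tr A = (\<Sum>i<dim_row A. A $$ (i, i))"

definition sl :: "nat \<Rightarrow> 'a::comm_ring_1 mat set" where
  "sl n = {A \<in> carrier_mat n n. tr A = 0}"

definition sl_basis :: "nat \<Rightarrow> complex mat set \<Rightarrow> bool" where
  "sl_basis n B \<longleftrightarrow> finite B \<and> B \<subseteq> sl n \<and>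
     (\<forall>a\<in>sl n. \<exists>!s. (\<forall>b. b \<notin> B \<longrightarrow> s b = 0) \<and> a = mat n n (\<lambda>p. \<Sum>b\<in>B. s b * b $$ p))"

definition dual_vector :: "nat \<Rightarrow> complex mat set \<Rightarrow> complex mat \<Rightarrow> complex mat" where
  "dual_vector n B b =
     (THE a. a \<in> sl n \<and> (\<forall>b'\<in>B. tr (a * b') = (if b' = b then 1 else 0)))"

text \<open>For \<open>M\<close> with diagonal blocks of sizes \<open>c\<close> and \<open>d\<close>; the result has diagonal blocks of
  sizes \<open>d\<close> and \<open>c\<close>.\<close>

definition sharp :: "nat \<Rightarrow> 'a mat \<Rightarrow> 'a mat" where
  "sharp c M = (case split_block M c c of (A, B, C, D) \<Rightarrow> four_block_mat D C B A)"

section \<open>Tensors\<close>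

text \<open>An element of \<open>Mat\<^sub>n \<otimes> Mat\<^sub>n\<close> is given by its coordinates: the value at \<open>(i, j)\<close>, \<open>(k, l)\<close> is the
  coefficient of \<open>e\<^sub>i\<^sub>j \<otimes> e\<^sub>k\<^sub>l\<close>. Sums of tensors are pointwise sums of functions.\<close>

type_synonym tensor = "nat \<times> nat \<Rightarrow> nat \<times> nat \<Rightarrow> complex"

definition tensor :: "complex mat \<Rightarrow> complex mat \<Rightarrow> tensor" (infixl "\<otimes>\<^sub>t" 70) where
  "a \<otimes>\<^sub>t b = (\<lambda>(i, j) (k, l).
     if i < dim_row a \<and> j < dim_col a \<and> k < dim_row b \<and> l < dim_col b
     then a $$ (i, j) * b $$ (k, l) else 0)"

definition wedge :: "complex mat \<Rightarrow> complex mat \<Rightarrow> tensor" (infixl "\<and>\<^sub>t" 70) where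
  "a \<and>\<^sub>t b = a \<otimes>\<^sub>t b - b \<otimes>\<^sub>t a"

definition scale :: "complex \<Rightarrow> tensor \<Rightarrow> tensor" (infixr "\<cdot>\<^sub>t" 75) where
  "s \<cdot>\<^sub>t T = (\<lambda>p q. s * T p q)"

definition casimir :: "nat \<Rightarrow> complex mat set \<Rightarrow> tensor" where
  "casimir n B = (\<Sum>b\<in>B. dual_vector n B b \<otimes>\<^sub>t b)"

section \<open>Combinatorial data of the formula\<close>

definition pos_roots :: "nat \<Rightarrow> (nat \<times> nat) set" where
  "pos_roots n = {(i, j). i < j \<and> j < n}"

definition neg_root :: "nat \<times> nat \<Rightarrow> nat \<times> nat" where
  "neg_root \<alpha> = (snd \<alpha>, fst \<alpha>)"

definition e_mat :: "nat \<Rightarrow> nat \<times> nat \<Rightarrow> complex mat" where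
  "e_mat n \<alpha> = mat n n (\<lambda>p. if p = \<alpha> then 1 else 0)"

definition tau :: "nat \<Rightarrow> nat \<Rightarrow> nat \<times> nat \<Rightarrow> nat \<times> nat" where
  "tau n c \<alpha> = ((fst \<alpha> + c) mod n, (snd \<alpha> + c) mod n)"

text \<open>The linear map sending \<open>e\<^sub>i\<^sub>j\<close> to \<open>e\<close> with both indices increased by \<open>c\<close> modulo \<open>n\<close>
  (for \<open>c \<le> n\<close>).\<close>

definition tau_mat :: "nat \<Rightarrow> nat \<Rightarrow> complex mat \<Rightarrow> complex mat" where
  "tau_mat n c A = mat n n (\<lambda>(i, j). A $$ ((i + (n - c)) mod n, (j + (n - c)) mod n))"

definition p_fun :: "nat \<Rightarrow> nat \<Rightarrow> nat \<times> nat \<Rightarrow> nat" where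
  "p_fun n c \<alpha> = (LEAST k. 1 \<le> k \<and> (tau n c ^^ k) \<alpha> \<notin> pos_roots n)"

definition q_mat :: "nat \<Rightarrow> nat \<Rightarrow> nat \<Rightarrow> complex mat" where
  "q_mat n c i = (tau_mat n c ^^ i) (e_mat n (0, 0)) - (tau_mat n c ^^ (i - 1)) (e_mat n (0, 0))"

definition f_mat :: "nat \<Rightarrow> nat \<Rightarrow> nat \<Rightarrow> complex mat" where
  "f_mat n c i =
     (1 / 2) \<cdot>\<^sub>m ((tau_mat n c ^^ i) (e_mat n (0, 0)) + (tau_mat n c ^^ (i - 1)) (e_mat n (0, 0)))
     - (1 / of_nat n) \<cdot>\<^sub>m 1\<^sub>m n"

definition q_dual :: "nat \<Rightarrow> nat \<Rightarrow> nat \<Rightarrow> complex mat" where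
  "q_dual n c i = (THE h. h \<in> sl n \<and> diagonal_mat h \<and>
     (\<forall>j\<in>{1..n - 1}. tr (h * q_mat n c j) = (if j = i then 1 else 0)))"

section \<open>The nodal cubic\<close>

text \<open>
  The nodal cubic \<open>E\<close> is described through its normalization by the projective line, i.e. as the
  projective line with \<open>z = 0\<close> and \<open>z = \<infinity>\<close> glued to a node, where \<open>z = z\<^sub>1/z\<^sub>0\<close>. Its function field
  is \<open>\<complex>(z)\<close>, and its local rings are subrings of \<open>\<complex>(z)\<close>.
\<close>

type_synonym ratfun = "complex poly fract"

definition zfun :: ratfun where
  "zfun = to_fract [:0, 1:]"

definition const :: "complex \<Rightarrow> ratfun" where
  "const a = to_fract [:a:]"

definition regular_at :: "complex \<Rightarrow> ratfun \<Rightarrow> bool" where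
  "regular_at x f \<longleftrightarrow> (\<exists>a b. f = Fract a b \<and> poly b x \<noteq> 0)"

definition value_at :: "complex \<Rightarrow> ratfun \<Rightarrow> complex" where
  "value_at x f = (THE v. \<exists>a b. f = Fract a b \<and> poly b x \<noteq> 0 \<and> v = poly a x / poly b x)"

definition regular_inf :: "ratfun \<Rightarrow> bool" where
  "regular_inf f \<longleftrightarrow> (\<exists>a b. f = Fract a b \<and> b \<noteq> 0 \<and> degree a \<le> degree b)"

definition value_inf :: "ratfun \<Rightarrow> complex" where
  "value_inf f = (THE v. \<exists>a b. f = Fract a b \<and> b \<noteq> 0 \<and> degree a \<le> degree b \<and>
     v = coeff a (degree b) / lead_coeff b)"

definition ord_at :: "complex \<Rightarrow> ratfun \<Rightarrow> int" where
  "ord_at x f = (THE k. \<exists>a b. a \<noteq> 0 \<and> b \<noteq> 0 \<and> f = Fract a b \<and> k = int (order x a) - int (order x b))"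

definition ord_inf :: "ratfun \<Rightarrow> int" where
  "ord_inf f = (THE k. \<exists>a b. a \<noteq> 0 \<and> b \<noteq> 0 \<and> f = Fract a b \<and> k = int (degree b) - int (degree a))"

datatype epoint = Node | Smooth complex

definition smooth_part :: "epoint set" where
  "smooth_part = Smooth ` (- {0})"

definition E_curve :: "epoint set" where
  "E_curve = insert Node smooth_part"

fun local_ring :: "epoint \<Rightarrow> ratfun set" where
  "local_ring (Smooth x) = {f. regular_at x f}"
| "local_ring Node =
     {f. regular_at 0 f \<and> regular_inf f \<and> value_at 0 f = value_inf f}"

definition smooth_functions :: "ratfun set" where
  "smooth_functions = (\<Inter>p\<in>smooth_part. local_ring p)"

text \<open>The degree at a point of the Cartier divisor of a rational function \<open>f \<noteq> 0\<close>. At the node,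
  the length of the quotient of the local ring by a regular \<open>f\<close> is the sum of the orders of
  vanishing on the two branches.\<close>

fun local_degree :: "epoint \<Rightarrow> ratfun \<Rightarrow> int" where
  "local_degree (Smooth x) f = ord_at x f"
| "local_degree Node f = ord_at 0 f + ord_inf f"

section \<open>Vector bundles on the nodal cubic\<close>

text \<open>
  A vector bundle of rank \<open>n\<close> on the integral curve \<open>E\<close>, together with a basis of its generic
  stalk, is given by the family of its stalks inside \<open>\<complex>(z)\<^sup>n\<close>: each stalk is generated over the local
  ring by a basis of \<open>\<complex>(z)\<^sup>n\<close>, and almost all stalks are the standard ones. Sections over an open
  set are the vectors lying in all stalks over this set.
\<close>

type_synonym vbundle = "epoint \<Rightarrow> ratfun vec set"

definition standard_stalk :: "nat \<Rightarrow> epoint \<Rightarrow> ratfun vec set" where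
  "standard_stalk n p = {v \<in> carrier_vec n. \<forall>i<n. v $ i \<in> local_ring p}"

definition stalk_frame :: "nat \<Rightarrow> vbundle \<Rightarrow> epoint \<Rightarrow> ratfun mat \<Rightarrow> bool" where
  "stalk_frame n P p g \<longleftrightarrow> g \<in> carrier_mat n n \<and> det g \<noteq> 0 \<and>
     P p = (\<lambda>v. g *\<^sub>v v) ` standard_stalk n p"

definition vector_bundle :: "nat \<Rightarrow> vbundle \<Rightarrow> bool" where
  "vector_bundle n P \<longleftrightarrow>
     (\<forall>p\<in>E_curve. \<exists>g. stalk_frame n P p g) \<and> finite {p\<in>E_curve. P p \<noteq> standard_stalk n p}"

text \<open>The degree of the determinant line bundle, whose stalk at \<open>p\<close> is generated by \<open>det g\<close> for a
  frame \<open>g\<close> at \<open>p\<close>; the sign is such that allowing a pole increases the degree.\<close>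

definition bundle_local_degree :: "nat \<Rightarrow> vbundle \<Rightarrow> epoint \<Rightarrow> int" where
  "bundle_local_degree n P p = - local_degree p (det (SOME g. stalk_frame n P p g))"

definition bundle_degree :: "nat \<Rightarrow> vbundle \<Rightarrow> int" where
  "bundle_degree n P =
     (\<Sum>p\<in>{p\<in>E_curve. bundle_local_degree n P p \<noteq> 0}. bundle_local_degree n P p)"

definition end_stalk :: "nat \<Rightarrow> vbundle \<Rightarrow> epoint \<Rightarrow> ratfun mat set" where
  "end_stalk n P p = {\<phi> \<in> carrier_mat n n. \<forall>v\<in>P p. \<phi> *\<^sub>v v \<in> P p}"

definition simple_bundle :: "nat \<Rightarrow> vbundle \<Rightarrow> bool" where
  "simple_bundle n P \<longleftrightarrow> (\<Inter>p\<in>E_curve. end_stalk n P p) = range (\<lambda>a. const a \<cdot>\<^sub>m 1\<^sub>m n)"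

text \<open>The stalks of the kernel \<open>\<A>\<close> of the trace map on the sheaf of endomorphisms of \<open>P\<close>.\<close>

definition ad_stalk :: "nat \<Rightarrow> vbundle \<Rightarrow> epoint \<Rightarrow> ratfun mat set" where
  "ad_stalk n P p = {\<phi> \<in> end_stalk n P p. tr \<phi> = 0}"

text \<open>The sections of \<open>\<A>\<close> over the smooth part, and the global sections of the twist \<open>\<A>(x)\<close>.\<close>

definition ad_smooth_sections :: "nat \<Rightarrow> vbundle \<Rightarrow> ratfun mat set" where
  "ad_smooth_sections n P = (\<Inter>p\<in>smooth_part. ad_stalk n P p)"

definition ad_twist_sections :: "nat \<Rightarrow> vbundle \<Rightarrow> complex \<Rightarrow> ratfun mat set" where
  "ad_twist_sections n P x =
     {\<phi>. (\<forall>p\<in>E_curve - {Smooth x}. \<phi> \<in> ad_stalk n P p) \<and>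
         (zfun - const x) \<cdot>\<^sub>m \<phi> \<in> ad_stalk n P (Smooth x)}"

section \<open>The geometric r-matrix\<close>

text \<open>The fibre \<open>\<A>|\<^sub>x\<close> is the quotient of the stalk at \<open>x\<close> by the following congruence; its elements
  are represented by elements of the stalk.\<close>

definition fibre_eq :: "nat \<Rightarrow> vbundle \<Rightarrow> complex \<Rightarrow> ratfun mat \<Rightarrow> ratfun mat \<Rightarrow> bool" where
  "fibre_eq n P x a b \<longleftrightarrow> a \<in> ad_stalk n P (Smooth x) \<and> b \<in> ad_stalk n P (Smooth x) \<and>
     (\<exists>h\<in>ad_stalk n P (Smooth x). a - b = (zfun - const x) \<cdot>\<^sub>m h)"

definition fibre_form :: "complex \<Rightarrow> ratfun mat \<Rightarrow> ratfun mat \<Rightarrow> complex" where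
  "fibre_form x a b = value_at x (tr (a * b))"

text \<open>A representative of the residue at \<open>x\<close> of \<open>\<phi> \<cdot> dz/z\<close>, for a section \<open>\<phi>\<close> with at most a simple
  pole at \<open>x\<close>. The evaluation of \<open>\<phi>\<close> at \<open>y \<noteq> x\<close> is represented by \<open>\<phi>\<close> itself.\<close>

definition residue_rep :: "complex \<Rightarrow> ratfun mat \<Rightarrow> ratfun mat" where
  "residue_rep x \<phi> = ((zfun - const x) / zfun) \<cdot>\<^sub>m \<phi>"

text \<open>The list \<open>ts\<close> stands for the tensor \<open>\<Sum> a \<otimes> b\<close> in \<open>\<A>|\<^sub>x \<otimes> \<A>|\<^sub>y\<close>, where \<open>(a, b)\<close> runs through \<open>ts\<close>.
  The tensor is \<open>\<rho>(x, y)\<close> if the map \<open>v \<mapsto> \<Sum> tr(a v) b\<close> equals the composition of the evaluation at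
  \<open>y\<close> with the inverse of the residue at \<open>x\<close>.\<close>

definition represents_rho ::
  "nat \<Rightarrow> vbundle \<Rightarrow> complex \<Rightarrow> complex \<Rightarrow> (ratfun mat \<times> ratfun mat) list \<Rightarrow> bool" where
  "represents_rho n P x y ts \<longleftrightarrow>
     set ts \<subseteq> ad_stalk n P (Smooth x) \<times> ad_stalk n P (Smooth y) \<and>
     (\<forall>\<phi>\<in>ad_twist_sections n P x.
        fibre_eq n P y
          (mat n n (\<lambda>p. \<Sum>(a, b)\<leftarrow>ts. const (fibre_form x a (residue_rep x \<phi>)) * b $$ p)) \<phi>)"

section \<open>The trivialization\<close>

definition poly_mat :: "complex mat \<Rightarrow> complex poly mat" where
  "poly_mat A = map_mat (\<lambda>a. [:a:]) A"

definition Sol :: "nat \<Rightarrow> nat \<Rightarrow> complex \<Rightarrow> complex poly mat set" where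
  "Sol c d x = {F \<in> sl (c + d). \<exists>A0 A1 B C0 C1 C2 D0 D1.
     A0 \<in> carrier_mat c c \<and> A1 \<in> carrier_mat c c \<and> B \<in> carrier_mat c d \<and>
     C0 \<in> carrier_mat d c \<and> C1 \<in> carrier_mat d c \<and> C2 \<in> carrier_mat d c \<and>
     D0 \<in> carrier_mat d d \<and> D1 \<in> carrier_mat d d \<and>
     F = four_block_mat
           (poly_mat A0 + [:0, 1:] \<cdot>\<^sub>m poly_mat A1) (poly_mat B)
           (poly_mat C0 + [:0, 1:] \<cdot>\<^sub>m poly_mat C1 + [:0, 1:]\<^sup>2 \<cdot>\<^sub>m poly_mat C2)
           (poly_mat D0 + [:0, 1:] \<cdot>\<^sub>m poly_mat D1) \<and>
     four_block_mat A0 B C0 D0 = (- x) \<cdot>\<^sub>m sharp c (four_block_mat A1 B C2 D1)}"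

text \<open>
  The trivialization \<open>\<xi>\<close> is an isomorphism of Lie algebras over the ring of functions on the smooth
  part. Extended to sections with a pole, it sends \<open>\<phi> \<in> \<Gamma>(E, \<A>(x))\<close> to \<open>F / (z - x)\<close>, where
  \<open>F = \<xi>((z - x) \<phi>)\<close> is the image of \<open>\<phi>\<close> under the associated embedding into the polynomial matrices.
  This is the normalization for which the residue at \<open>x\<close> becomes \<open>F(x)/x\<close> and the evaluation at
  \<open>y\<close> becomes \<open>F(y)/(y - x)\<close>.
\<close>

definition xi_bar :: "(ratfun mat \<Rightarrow> ratfun mat) \<Rightarrow> complex \<Rightarrow> ratfun mat \<Rightarrow> ratfun mat" where
  "xi_bar \<xi> x \<phi> = \<xi> ((zfun - const x) \<cdot>\<^sub>m \<phi>)"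

definition is_trivialization ::
  "nat \<Rightarrow> nat \<Rightarrow> vbundle \<Rightarrow> (ratfun mat \<Rightarrow> ratfun mat) \<Rightarrow> bool" where
  "is_trivialization c d P \<xi> \<longleftrightarrow>
     bij_betw \<xi> (ad_smooth_sections (c + d) P)
       {A \<in> sl (c + d). \<forall>i<c + d. \<forall>j<c + d. A $$ (i, j) \<in> smooth_functions} \<and>
     (\<forall>\<phi>\<in>ad_smooth_sections (c + d) P. \<forall>\<psi>\<in>ad_smooth_sections (c + d) P.
        \<xi> (\<phi> + \<psi>) = \<xi> \<phi> + \<xi> \<psi> \<and> \<xi> (\<phi> * \<psi> - \<psi> * \<phi>) = \<xi> \<phi> * \<xi> \<psi> - \<xi> \<psi> * \<xi> \<phi>) \<and>
     (\<forall>h\<in>smooth_functions. \<forall>\<phi>\<in>ad_smooth_sections (c + d) P. \<xi> (h \<cdot>\<^sub>m \<phi>) = h \<cdot>\<^sub>m \<xi> \<phi>) \<and>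
     (\<forall>x. x \<noteq> 0 \<longrightarrow> xi_bar \<xi> x ` ad_twist_sections (c + d) P x = map_mat to_fract ` Sol c d x)"

text \<open>The isomorphism from the fibre at \<open>x\<close> to the traceless complex matrices induced by \<open>\<xi>\<close>.\<close>

definition xi_fibre ::
  "nat \<Rightarrow> vbundle \<Rightarrow> (ratfun mat \<Rightarrow> ratfun mat) \<Rightarrow> complex \<Rightarrow> ratfun mat \<Rightarrow> complex mat" where
  "xi_fibre n P \<xi> x a =
     (THE m. \<exists>s\<in>ad_smooth_sections n P. fibre_eq n P x s a \<and> m = map_mat (value_at x) (\<xi> s))"

definition rho_xi ::
  "nat \<Rightarrow> vbundle \<Rightarrow> (ratfun mat \<Rightarrow> ratfun mat) \<Rightarrow> complex \<Rightarrow> complex \<Rightarrow> tensor" where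
  "rho_xi n P \<xi> x y = (THE r. \<exists>ts. represents_rho n P x y ts \<and>
     r = (\<Sum>(a, b)\<leftarrow>ts. xi_fibre n P \<xi> x a \<otimes>\<^sub>t xi_fibre n P \<xi> y b))"

section \<open>The Lagrangian order and its solution\<close>

text \<open>Laurent series in \<open>z\<^sup>-\<^sup>1\<close> are elements of the type \<open>fls\<close> with formal variable \<open>fls_X\<close> standing
  for \<open>z\<^sup>-\<^sup>1\<close>, so that \<open>z\<close> is \<open>fls_X_inv\<close> and \<open>fls_nth f k\<close> is the coefficient of \<open>z\<^sup>-\<^sup>k\<close>.\<close>

type_synonym double = "complex fls mat \<times> complex mat"

definition form :: "double \<Rightarrow> double \<Rightarrow> complex" where
  "form v w = fls_nth (tr (fst v * fst w)) 0 - tr (snd v * snd w)"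

definition j_emb :: "complex poly mat \<Rightarrow> double" where
  "j_emb F =
     (map_mat (\<lambda>p. poly (map_poly fls_const p) fls_X_inv) F, map_mat (\<lambda>p. poly p 0) F)"

definition b_par :: "nat \<Rightarrow> nat \<Rightarrow> complex mat set" where
  "b_par c d = sl (c + d) \<inter> {four_block_mat A (0\<^sub>m c d) C D | A C D.
     A \<in> carrier_mat c c \<and> C \<in> carrier_mat d c \<and> D \<in> carrier_mat d d}"

definition n_par :: "nat \<Rightarrow> nat \<Rightarrow> complex mat set" where
  "n_par c d = {four_block_mat (0\<^sub>m c c) (0\<^sub>m c d) C (0\<^sub>m d d) | C. C \<in> carrier_mat d c}"

definition W_order :: "nat \<Rightarrow> nat \<Rightarrow> double set" where
  "W_order c d =
     {(fls_X\<^sup>2 \<cdot>\<^sub>m map_mat fps_to_fls G + fls_X \<cdot>\<^sub>m map_mat fls_const H + map_mat fls_const N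
         + four_block_mat (map_mat fls_const A) (fls_X \<cdot>\<^sub>m map_mat fls_const B)
             (fls_X_inv \<cdot>\<^sub>m map_mat fls_const C) (map_mat fls_const D),
       sharp c (four_block_mat A B C D)) | G H N A B C D.
       G \<in> sl (c + d) \<and> H \<in> b_par c d \<and> N \<in> n_par c d \<and>
       A \<in> carrier_mat c c \<and> B \<in> carrier_mat c d \<and> C \<in> carrier_mat d c \<and> D \<in> carrier_mat d d \<and>
       four_block_mat A B C D \<in> sl (c + d)}"

definition w_dual :: "nat \<Rightarrow> nat \<Rightarrow> complex mat set \<Rightarrow> nat \<Rightarrow> complex mat \<Rightarrow> double" where
  "w_dual c d B k b = (THE w. w \<in> W_order c d \<and>
     (\<forall>k'. \<forall>b'\<in>B. form (j_emb (map_mat (\<lambda>a. monom a k') b')) w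
                  = (if k' = k \<and> b' = b then 1 else 0)))"

text \<open>The solution is the value of a series which is convergent in the region where \<open>1/(y - x)\<close> can be
  expanded in powers of \<open>x/y\<close>. The argument \<open>1/y\<close> of \<open>eval_fls\<close> is the value of \<open>z\<^sup>-\<^sup>1\<close> at \<open>z = y\<close>.\<close>

definition solution_of_order ::
  "nat \<Rightarrow> nat \<Rightarrow> complex mat set \<Rightarrow> (complex \<Rightarrow> complex \<Rightarrow> tensor) \<Rightarrow> bool" where
  "solution_of_order c d B r \<longleftrightarrow> (\<forall>x y. 0 < norm x \<and> norm x < norm y \<longrightarrow>
     (\<forall>p q. ((\<lambda>(k, b). x ^ k *
                (b \<otimes>\<^sub>t map_mat (\<lambda>f. eval_fls f (1 / y)) (fst (w_dual c d B k b))) p q)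
             has_sum r x y p q) (UNIV \<times> B)))"

end

theory Submission
  imports Defs "HOL-Number_Theory.Cong"
begin

text \<open>
  Let \<open>F \<in> Sol\<close>, \<open>U = F(x)/x\<close> and \<open>A = F\<^sub>\<infinity>\<close>. Since \<open>\<sharp>\<close> shifts both indices by \<open>c\<close>, the condition
  \<open>F\<^sub>0 = -x F\<^sub>\<infinity>\<^sup>\<sharp>\<close> says that \<open>A\<^sub>\<alpha> - A\<^bsub>\<tau>(\<alpha>)\<^esub> = U\<^sub>\<alpha>\<close> for \<open>\<alpha>\<close> in the diagonal blocks, and \<open>A\<^bsub>\<tau>(\<alpha>)\<^esub> = -U\<^sub>\<alpha>\<close>,
  \<open>A\<^sub>\<alpha> = x U\<^sub>\<alpha>\<close> in the upper right block. As \<open>c\<close> and \<open>n\<close> are coprime, every \<open>\<tau>\<close>-orbit of roots runs from the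
  upper right block through positive roots to the lower left block, and from there through negative roots
  back to the upper right block. Hence \<open>A\<close> is determined by \<open>U\<close> through sums along these chains, and
  \<open>F(y)/(y - x)\<close> is the contraction of the formula with \<open>U\<close>. The elements of the order which are dual to
  \<open>z\<^sup>k g\<^sub>\<beta>\<close> are determined by the same system with other right-hand sides.

  The definition of \<open>\<rho>\<close> uses the trace form of the fibre \<open>\<A>|\<^sub>x\<close>, while \<open>\<xi>\<close> is only known to be an isomorphism of
  Lie algebras. On fibres it therefore preserves the Killing form, which is \<open>2n\<close> times the trace form.
\<close>

text \<open>The chains leave out the diagonal. There \<tau> moves the n positions in a single cycle,
  and the condition prescribes the differences of neighbouring entries of A. Around the cycle they
  add up to the trace of U, which is 0, so a solution exists; the free additive constant is fixed by
  the trace of A. The terms with \<open>q_dual\<close> and \<open>f_mat\<close> encode this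
  solution. In the lower left block no equation links \<open>A\<close> with its shift. The free
  middle coefficient of F takes up the difference there, so that F(x) can be prescribed in all
  entries, and F(y) = F(x) + (y - x)(X0 + y X1) with \<open>X0\<close> and \<open>X1\<close>
  depending on U only. Both halves of the claim rest on the linearity of the solution in the two
  right-hand sides G and b. For F they are U and x U. For the element dual to z^k g they are the
  dual vector of g and 0 when k = 0, the other way round when k = 1, and both 0 when k > 1. The
  series is therefore a geometric series with corrections at k = 0 and k = 1 only. Tensors are
  compared through their contractions with traceless matrices. This loses nothing as long as the
  first factors are traceless, which \<open>sl_tensor\<close> records.\<close>

lemma tau_pair: "tau n c (i, j) = ((i + c) mod n, (j + c) mod n)"
  by (simp add: tau_def)

lemma neg_root_pair [simp]: "neg_root (i, j) = (j, i)"
  by (simp add: neg_root_def)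

lemma neg_root_neg_root [simp]: "neg_root (neg_root q) = q"
  by (simp add: neg_root_def)

lemma neg_root_tau: "neg_root (tau n c q) = tau n c (neg_root q)"
  by (simp add: neg_root_def tau_def)

lemma neg_root_eq_iff: "neg_root p = q \<longleftrightarrow> p = neg_root q"
  by (cases p; cases q) auto

lemma finite_pos_roots [simp]: "finite (pos_roots n)"
  by (rule finite_subset[of _ "{..<n} \<times> {..<n}"]) (auto simp: pos_roots_def)

lemma pos_roots_not_neg: "q \<in> pos_roots n \<Longrightarrow> neg_root q \<notin> pos_roots n"
  by (cases q) (auto simp: pos_roots_def)

lemma tau_pow: "i < n \<Longrightarrow> j < n \<Longrightarrow>
    (tau n c ^^ k) (i, j) = ((i + k * c) mod n, (j + k * c) mod n)"
  by (induction k) (auto simp: tau_pair mod_simps algebra_simps)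

section \<open>Chains of positive roots under the shift\<close>

locale shift =
  fixes c d n :: nat
  assumes c_pos: "0 < c" and d_pos: "0 < d" and n_eq: "n = c + d" and coprime_cd: "coprime c d"
begin

lemma n_pos [simp]: "0 < n" and c_less: "c < n" and d_less: "d < n" and n_neq_0 [simp]: "n \<noteq> 0"
  using c_pos d_pos n_eq by auto

lemma coprime_cn: "coprime c n"
  using coprime_cd n_eq by (metis coprime_add_one_right gcd_add2 coprime_iff_gcd_eq_1)

lemma shift_mod: "i < n \<Longrightarrow> (i + c) mod n = (if i < d then i + c else i - d)"
  by (auto simp: n_eq mod_if)

lemma shift_less [simp]: "(i + c) mod n < n"
  by simp

lemma shift_inj: "i < n \<Longrightarrow> j < n \<Longrightarrow> (i + c) mod n = (j + c) mod n \<longleftrightarrow> i = j"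
  using n_eq by (subst (1 2) shift_mod) auto

lemma tau_inj:
  assumes "p \<in> {..<n} \<times> {..<n}" "q \<in> {..<n} \<times> {..<n}" "tau n c p = tau n c q"
  shows "p = q"
  using assms by (cases p; cases q) (auto simp: tau_pair shift_inj)

lemma tau_in: "tau n c q \<in> {..<n} \<times> {..<n}"
  by (cases q) (auto simp: tau_pair)

lemma tau_pow_in: "q \<in> {..<n} \<times> {..<n} \<Longrightarrow> (tau n c ^^ k) q \<in> {..<n} \<times> {..<n}"
  by (cases k) (auto intro: tau_in simp del: mem_Sigma_iff)

lemma pos_roots_in: "q \<in> pos_roots n \<Longrightarrow> q \<in> {..<n} \<times> {..<n}"
  by (auto simp: pos_roots_def)

lemma tau_neq: "fst q < n \<Longrightarrow> snd q < n \<Longrightarrow> fst q \<noteq> snd q \<Longrightarrow> fst (tau n c q) \<noteq> snd (tau n c q)"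
  by (cases q) (auto simp: tau_pair shift_inj)

text \<open>As c is invertible modulo n, the wanted k is (m - i)/c modulo n; \<open>n - i\<close>
  replaces -i in the natural numbers.\<close>

lemma reach: "i < n \<Longrightarrow> m < n \<Longrightarrow> \<exists>k<n. (i + k * c) mod n = m"
proof -
  assume im: "i < n" "m < n"
  obtain x0 where "[c * x0 = 1] (mod n)"
    using cong_solve_coprime_nat[OF coprime_cn] by auto
  then have "[c * x0 * (m + (n - i)) = 1 * (m + (n - i))] (mod n)"
    by (rule cong_mult) simp
  then obtain x where x: "[c * x = (m + (n - i))] (mod n)"
    by (metis mult.assoc mult_1)
  have "(i + (x mod n) * c) mod n = (i + c * x) mod n"
    by (metis mod_add_right_eq mod_mult_left_eq mult.commute)
  also have "\<dots> = (i + (m + (n - i))) mod n"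
    using x by (metis cong_def mod_add_right_eq)
  also have "i + (m + (n - i)) = m + n" using im by simp
  finally show ?thesis using im by (intro exI[of _ "x mod n"]) simp
qed

lemma p_fun_ex: 
  assumes "\<alpha> \<in> pos_roots n"
  shows "\<exists>k. 1 \<le> k \<and> k < n \<and> (tau n c ^^ k) \<alpha> \<notin> pos_roots n"
proof -
  obtain i j where ij: "\<alpha> = (i, j)" "i < j" "j < n" using assms by (auto simp: pos_roots_def)
  \<comment> \<open>No positive root has first index \<open>n - 1\<close>.\<close>
  then obtain k where k: "k < n" "(i + k * c) mod n = n - 1" using reach[of i "n - 1"] by auto
  have "1 \<le> k" using k ij by (cases k) auto
  moreover have "(tau n c ^^ k) \<alpha> \<notin> pos_roots n"
  proof -
    have "(j + k * c) mod n < n" by simp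
    then have "\<not> n - 1 < (j + k * c) mod n" by linarith
    then show ?thesis using ij k by (simp add: tau_pow pos_roots_def)
  qed
  ultimately show ?thesis using k by blast
qed

lemma p_fun_props:
  assumes "\<alpha> \<in> pos_roots n"
  shows p_fun_ge: "1 \<le> p_fun n c \<alpha>" and p_fun_not_pos: "(tau n c ^^ p_fun n c \<alpha>) \<alpha> \<notin> pos_roots n"
    and p_fun_less: "p_fun n c \<alpha> < n"
    and p_fun_below: "k < p_fun n c \<alpha> \<Longrightarrow> (tau n c ^^ k) \<alpha> \<in> pos_roots n"
proof -
  let ?Q = "\<lambda>k. 1 \<le> k \<and> (tau n c ^^ k) \<alpha> \<notin> pos_roots n"
  obtain k0 where k0: "?Q k0" "k0 < n" using p_fun_ex[OF assms] by auto
  have "?Q (p_fun n c \<alpha>)" unfolding p_fun_def by (rule LeastI[of ?Q, OF k0(1)])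
  then show "1 \<le> p_fun n c \<alpha>" "(tau n c ^^ p_fun n c \<alpha>) \<alpha> \<notin> pos_roots n" by auto
  show "p_fun n c \<alpha> < n" using Least_le[of ?Q, OF k0(1)] k0 unfolding p_fun_def by simp
  show "(tau n c ^^ k) \<alpha> \<in> pos_roots n" if "k < p_fun n c \<alpha>"
  proof -
    have "\<not> ?Q k" using that unfolding p_fun_def by (rule not_less_Least)
    then show ?thesis using assms by (cases "k = 0") auto
  qed
qed

text \<open>\<open>p_fun\<close> measures the distance of a positive root from the end of its chain.
  The one-step form drives all inductions along chains.\<close>

lemma p_fun_rec:
  assumes "\<alpha> \<in> pos_roots n"
  shows "p_fun n c \<alpha> = (if tau n c \<alpha> \<in> pos_roots n then Suc (p_fun n c (tau n c \<alpha>)) else 1)"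
proof (cases "tau n c \<alpha> \<in> pos_roots n")
  case False
  then have "\<not> 1 < p_fun n c \<alpha>" using p_fun_below[OF assms, of 1] by auto
  then show ?thesis using p_fun_ge[OF assms] False by simp
next
  case True
  let ?p = "p_fun n c (tau n c \<alpha>)"
  have "Suc ?p \<le> p_fun n c \<alpha>"
  proof (rule ccontr)
    assume a: "\<not> ?thesis"
    obtain k where k: "p_fun n c \<alpha> = Suc k" using p_fun_ge[OF assms] by (cases "p_fun n c \<alpha>") auto
    then have "k < ?p" using a by simp
    then have "(tau n c ^^ k) (tau n c \<alpha>) \<in> pos_roots n" by (rule p_fun_below[OF True])
    then show False using p_fun_not_pos[OF assms] k by (simp add: funpow_Suc_right del: funpow.simps)
  qed
  moreover have "p_fun n c \<alpha> \<le> Suc ?p"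
  proof (rule ccontr)
    assume "\<not> ?thesis"
    then have "(tau n c ^^ Suc ?p) \<alpha> \<in> pos_roots n" by (intro p_fun_below[OF assms]) simp
    then show False using p_fun_not_pos[OF True] by (simp add: funpow_Suc_right del: funpow.simps)
  qed
  ultimately show ?thesis using True by simp
qed

text \<open>\<open>chainS G q\<close> sums \<open>G\<close> over the positive roots that precede \<open>q\<close> in its \<open>\<tau>\<close>-orbit, back to the last
  negative root; \<open>chainT G b \<alpha>\<close> sums \<open>G\<close> over the negative roots that follow \<open>-\<alpha>\<close>, and ends with the
  value of \<open>b\<close> at the first positive root.\<close>

definition chainS :: "(nat \<times> nat \<Rightarrow> complex) \<Rightarrow> nat \<times> nat \<Rightarrow> complex" where
  "chainS G q = (\<Sum>\<alpha>\<in>pos_roots n. \<Sum>k = 1..p_fun n c \<alpha>. if (tau n c ^^ k) \<alpha> = q then G \<alpha> else 0)"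

definition chainT :: "(nat \<times> nat \<Rightarrow> complex) \<Rightarrow> (nat \<times> nat \<Rightarrow> complex) \<Rightarrow> nat \<times> nat \<Rightarrow> complex" where
  "chainT G b \<alpha> = (\<Sum>k = 1..p_fun n c \<alpha> - 1. G (neg_root ((tau n c ^^ k) \<alpha>)))
     + b (neg_root ((tau n c ^^ p_fun n c \<alpha>) \<alpha>))"

text \<open>Injectivity of \<tau> turns the condition for k into the condition for k - 1 at
  \<open>q\<close>. For positive \<open>q\<close> the index k - 1 = 0 contributes the new term
  \<open>G q\<close>, and nothing is lost at the upper end because the last member of a chain is not
  positive. For other \<open>q\<close> no index qualifies, since all members before the last are
  positive.\<close>

lemma chainS_tau:
  assumes q: "q \<in> {..<n} \<times> {..<n}"
  shows "chainS G (tau n c q) = (if q \<in> pos_roots n then G q + chainS G q else 0)"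
proof -
  have eq: "(tau n c ^^ Suc k) \<alpha> = tau n c q \<longleftrightarrow> (tau n c ^^ k) \<alpha> = q" if "\<alpha> \<in> pos_roots n" for k \<alpha>
    using tau_inj[OF tau_pow_in[OF pos_roots_in[OF that]] q] by auto
  have "(\<Sum>k = 1..p_fun n c \<alpha>. if (tau n c ^^ k) \<alpha> = tau n c q then G \<alpha> else 0)
      = (if q \<in> pos_roots n then (if \<alpha> = q then G q else 0) 
          + (\<Sum>k = 1..p_fun n c \<alpha>. if (tau n c ^^ k) \<alpha> = q then G \<alpha> else 0) else 0)"
    if \<alpha>: "\<alpha> \<in> pos_roots n" for \<alpha>
  proof -
    obtain m where m: "p_fun n c \<alpha> = Suc m" using p_fun_ge[OF \<alpha>] by (cases "p_fun n c \<alpha>") auto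
    have "(\<Sum>k = 1..p_fun n c \<alpha>. if (tau n c ^^ k) \<alpha> = tau n c q then G \<alpha> else 0)
       = (\<Sum>k = 0..m. if (tau n c ^^ Suc k) \<alpha> = tau n c q then G \<alpha> else 0)"
      unfolding m One_nat_def sum.atLeast_Suc_atMost_Suc_shift o_def ..
    also have "\<dots> = (\<Sum>k = 0..m. if (tau n c ^^ k) \<alpha> = q then G \<alpha> else 0)"
      by (intro sum.cong refl if_cong eq \<alpha>)
    also have "\<dots> = (if q \<in> pos_roots n then (if \<alpha> = q then G q else 0) 
          + (\<Sum>k = 1..p_fun n c \<alpha>. if (tau n c ^^ k) \<alpha> = q then G \<alpha> else 0) else 0)"
    proof (cases "q \<in> pos_roots n")
      case True
      then have "(tau n c ^^ Suc m) \<alpha> \<noteq> q" using p_fun_not_pos[OF \<alpha>] m by auto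
      moreover have "(\<Sum>k = 0..m. if (tau n c ^^ k) \<alpha> = q then G \<alpha> else 0) 
        = (if \<alpha> = q then G q else 0) + (\<Sum>k = 1..m. if (tau n c ^^ k) \<alpha> = q then G \<alpha> else 0)"
        by (subst sum.atLeast_Suc_atMost) auto
      ultimately show ?thesis using True m by (simp del: funpow.simps)
    next
      case False
      have "(tau n c ^^ k) \<alpha> \<noteq> q" if "k \<le> m" for k using p_fun_below[OF \<alpha>, of k] m that False by auto
      then show ?thesis using False by simp
    qed
    finally show ?thesis .
  qed
  then have "chainS G (tau n c q) = (\<Sum>\<alpha>\<in>pos_roots n. if q \<in> pos_roots n then (if \<alpha> = q then G q else 0) 
          + (\<Sum>k = 1..p_fun n c \<alpha>. if (tau n c ^^ k) \<alpha> = q then G \<alpha> else 0) else 0)"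
    unfolding chainS_def by (rule sum.cong[OF refl])
  note eq_sum = this
  show ?thesis
  proof (cases "q \<in> pos_roots n")
    case True
    have "chainS G (tau n c q) = (\<Sum>\<alpha>\<in>pos_roots n. if \<alpha> = q then G q else 0) + chainS G q"
      unfolding eq_sum unfolding chainS_def using True by (simp only: if_True sum.distrib)
    also have "(\<Sum>\<alpha>\<in>pos_roots n. if \<alpha> = q then G q else 0) = G q"
      using True by simp
    finally show ?thesis using True by simp
  next
    case False
    then show ?thesis unfolding eq_sum by simp
  qed
qed

text \<open>Either the first summand is split off and the rest is the chain of the shifted root, or
  \<open>p_fun\<close> is 1 and only the end value \<open>b\<close> is left.\<close>

lemma chainT_rec:
  assumes "\<alpha> \<in> pos_roots n"
  shows "chainT G b \<alpha> = (if tau n c \<alpha> \<in> pos_roots n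
     then G (neg_root (tau n c \<alpha>)) + chainT G b (tau n c \<alpha>) else b (neg_root (tau n c \<alpha>)))"
proof (cases "tau n c \<alpha> \<in> pos_roots n")
  case True
  let ?p = "p_fun n c (tau n c \<alpha>)"
  obtain m where m: "?p = Suc m" using p_fun_ge[OF True] by (cases ?p) auto
  have "p_fun n c \<alpha> = Suc ?p" using p_fun_rec[OF assms] True by simp
  then have "chainT G b \<alpha> = (\<Sum>k = Suc 0..Suc m. G (neg_root ((tau n c ^^ k) \<alpha>)))
     + b (neg_root ((tau n c ^^ Suc (Suc m)) \<alpha>))"
    by (simp add: chainT_def m)
  also have "(\<Sum>k = Suc 0..Suc m. G (neg_root ((tau n c ^^ k) \<alpha>))) 
      = G (neg_root (tau n c \<alpha>)) + (\<Sum>k = Suc 1..Suc m. G (neg_root ((tau n c ^^ k) \<alpha>)))"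
    by (subst sum.atLeast_Suc_atMost) auto
  also have "(\<Sum>k = Suc 1..Suc m. G (neg_root ((tau n c ^^ k) \<alpha>))) 
    = (\<Sum>k = 1..m. G (neg_root ((tau n c ^^ k) (tau n c \<alpha>))))"
    unfolding One_nat_def sum.atLeast_Suc_atMost_Suc_shift o_def by (simp add: funpow_swap1)
  finally show ?thesis using True by (simp add: chainT_def m funpow_swap1)
next
  case False
  then show ?thesis using p_fun_rec[OF assms] by (simp add: chainT_def)
qed

end

section \<open>The linear system for the leading coefficients\<close>

context shift begin

text \<open>The off-diagonal blocks of the decomposition \<open>n = c + d\<close>: upper right and lower left.\<close>

definition UR :: "(nat \<times> nat) set" where "UR = {(i, j). i < c \<and> c \<le> j \<and> j < n}"
definition LL :: "(nat \<times> nat) set" where "LL = {(i, j). j < c \<and> c \<le> i \<and> i < n}"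

lemma UR_pos: "q \<in> UR \<Longrightarrow> q \<in> pos_roots n"
  by (auto simp: UR_def pos_roots_def)

lemma LL_neg: "q \<in> LL \<Longrightarrow> neg_root q \<in> pos_roots n"
  by (auto simp: LL_def pos_roots_def)

text \<open>The cyclic shift reverses the order of two indices exactly when one of them wraps
  around. The wrapped index lands below c and the other one at c or above, so a change of sign
  always ends in an off-diagonal block. \<open>tau_UR_iff\<close> is the opposite change of
  sign.\<close>

lemma tau_LL_iff: "q \<in> {..<n} \<times> {..<n} \<Longrightarrow> tau n c q \<in> LL \<longleftrightarrow> q \<in> pos_roots n \<and> tau n c q \<notin> pos_roots n"
proof -
  assume "q \<in> {..<n} \<times> {..<n}"
  then obtain i j where q: "q = (i, j)" "i < n" "j < n" by auto
  then have "tau n c q = (if i < d then i + c else i - d, if j < d then j + c else j - d)"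
    by (simp add: tau_pair shift_mod)
  then show ?thesis
    unfolding LL_def pos_roots_def using n_eq q by (cases "i < d"; cases "j < d") auto
qed

lemma tau_UR_iff: "q \<in> {..<n} \<times> {..<n} \<Longrightarrow> tau n c q \<in> UR \<longleftrightarrow> neg_root q \<in> pos_roots n \<and> tau n c q \<in> pos_roots n"
proof -
  assume "q \<in> {..<n} \<times> {..<n}"
  then obtain i j where q: "q = (i, j)" "i < n" "j < n" by auto
  then have "tau n c q = (if i < d then i + c else i - d, if j < d then j + c else j - d)"
    by (simp add: tau_pair shift_mod)
  then show ?thesis
    unfolding UR_def pos_roots_def using n_eq q by (cases "i < d"; cases "j < d") auto
qed

lemma tau_surj:
  assumes "q \<in> {..<n} \<times> {..<n}"
  obtains q' where "q' \<in> {..<n} \<times> {..<n}" "q = tau n c q'"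
proof -
  obtain i j where q: "q = (i, j)" by (cases q)
  have e: "i + d + c = i + n" "j + d + c = j + n" using n_eq by auto
  have "(i + d + c) mod n = i" "(j + d + c) mod n = j" unfolding e using assms q by auto
  then have "q = tau n c ((i + d) mod n, (j + d) mod n)"
    using q by (simp add: tau_pair mod_simps)
  then show ?thesis by (intro that[of "((i + d) mod n, (j + d) mod n)"]) auto
qed

text \<open>The predecessor of such a root is negative, so a chain of positive roots starts here and
  nothing has accumulated yet.\<close>

lemma chainS_UR: "q \<in> UR \<Longrightarrow> chainS G q = 0"
  by (metis UR_pos chainS_tau pos_roots_in pos_roots_not_neg tau_UR_iff tau_surj)

lemma chainS_neg: "neg_root q \<in> pos_roots n \<Longrightarrow> q \<notin> LL \<Longrightarrow> chainS G q = 0"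
proof -
  assume q: "neg_root q \<in> pos_roots n" "q \<notin> LL"
  then have "q \<in> {..<n} \<times> {..<n}" by (cases q) (auto simp: pos_roots_def)
  then obtain q' where q': "q' \<in> {..<n} \<times> {..<n}" "q = tau n c q'" by (rule tau_surj)
  then have "q' \<notin> pos_roots n" 
    using q(2) q'(2) tau_LL_iff[OF q'(1)] pos_roots_not_neg[OF q(1)] by auto
  then show ?thesis using q' chainS_tau by simp
qed

section \<open>The diagonal entries: the shift as a single cycle on the indices\<close>

definition sg :: "nat \<Rightarrow> nat" where "sg m = m * c mod n"

lemma sg_less [simp]: "sg m < n" by (simp add: sg_def)

lemma sg_0 [simp]: "sg 0 = 0" by (simp add: sg_def)

lemma sg_Suc: "(sg m + c) mod n = sg (Suc m)"
  by (simp add: sg_def mod_simps add.commute)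

lemma sg_n: "sg n = 0" by (simp add: sg_def)

lemma bij_sg: "bij_betw sg {..<n} {..<n}"
proof -
  have "sg ` {..<n} = {..<n}"
  proof
    show "{..<n} \<subseteq> sg ` {..<n}"
    proof
      fix m assume "m \<in> {..<n}"
      then obtain k where "k < n" "(0 + k * c) mod n = m" using reach[of 0 m] by auto
      then show "m \<in> sg ` {..<n}" by (auto simp: sg_def)
    qed
  qed auto
  then show ?thesis by (simp add: bij_betw_def eq_card_imp_inj_on)
qed

lemma sg_inj: "i < n \<Longrightarrow> j < n \<Longrightarrow> sg i = sg j \<longleftrightarrow> i = j"
  using bij_sg by (auto simp: bij_betw_def inj_on_def)

lemma sum_sg: "(\<Sum>i<n. f (sg i)) = (\<Sum>i<n. f i)"
  by (rule sum.reindex_bij_betw[OF bij_sg])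

text \<open>In the parametrization \<open>sg\<close> the shift is m to m + 1, and the shifted sum
  closes up because \<open>sg n\<close> and \<open>sg 0\<close> agree.\<close>

lemma sum_tau_diag: "(\<Sum>i<n. f (tau n c (i, i))) = (\<Sum>i<n. f (i, i))" for f :: "nat \<times> nat \<Rightarrow> complex"
proof -
  have "(\<Sum>i<n. f (tau n c (i, i))) = (\<Sum>m<n. f (tau n c (sg m, sg m)))"
    using sum_sg[of "\<lambda>i. f (tau n c (i, i))"] by simp
  also have "\<dots> = (\<Sum>m<n. f (sg (Suc m), sg (Suc m)))" by (simp add: tau_pair sg_Suc)
  also have "\<dots> = (\<Sum>m<Suc n. f (sg m, sg m)) - f (sg 0, sg 0)" by (subst sum.lessThan_Suc_shift) simp
  also have "\<dots> = (\<Sum>m<n. f (sg m, sg m))" by (simp add: sg_n)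
  also have "\<dots> = (\<Sum>i<n. f (i, i))" by (rule sum_sg[of "\<lambda>i. f (i, i)"])
  finally show ?thesis .
qed

lemma sg_cases:
  assumes "i < n" obtains m where "m < n" "i = sg m"
  using assms bij_sg by (auto simp: bij_betw_def)

text \<open>Tail sums along the cycle. For traceless \<open>G\<close> this is the trace pairing with
  the dual of q_j, see \<open>tr_hq\<close>.\<close>

definition dsum :: "(nat \<times> nat \<Rightarrow> complex) \<Rightarrow> nat \<Rightarrow> complex" where
  "dsum G j = (\<Sum>m = j..<n. G (sg m, sg m))"

text \<open>What the closed formula contributes on the diagonal besides x/(y - x) times the Casimir
  element: the diagonals of the f_j weighted by the pairings with the duals of the q_j, and G/2 from
  (y + x)/(y - x) = 2x/(y - x) + 1, halved.\<close>

definition diagY :: "(nat \<times> nat \<Rightarrow> complex) \<Rightarrow> nat \<Rightarrow> complex" where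
  "diagY G i = G (i, i) / 2 + (\<Sum>j = 1..n - 1. dsum G j *
     ((if i = sg j then 1 / 2 else 0) + (if i = sg (j - 1) then 1 / 2 else 0) - 1 / of_nat n))"

lemma dsum_Suc: "m < n \<Longrightarrow> dsum G m = G (sg m, sg m) + dsum G (Suc m)"
  unfolding dsum_def by (rule sum.atLeast_Suc_lessThan)

lemma dsum_n: "dsum G n = 0" by (simp add: dsum_def)

lemma dsum_0: "(\<Sum>i<n. G (i, i)) = 0 \<Longrightarrow> dsum G 0 = 0"
  using sum_sg[of "\<lambda>i. G (i, i)"] by (simp add: dsum_def atLeast0LessThan)

text \<open>Only j = m and j = m + 1 meet position m, with weight 1/2 each. Since
  \<open>dsum\<close> at m exceeds that at m + 1 by the entry itself, these halves and G/2 add up to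
  \<open>dsum G m\<close>. The values j = 0 and j = n, which the range omits, do no harm because
  \<open>dsum\<close> vanishes there. The -1/n parts add up to a constant independent of m.\<close>

lemma diagY_sg:
  assumes "(\<Sum>i<n. G (i, i)) = 0" "m < n"
  shows "diagY G (sg m) = dsum G m - (\<Sum>j = 1..n - 1. dsum G j / of_nat n)"
proof -
  have "(\<Sum>j = 1..n - 1. dsum G j * ((if sg m = sg j then 1 / 2 else 0) 
            + (if sg m = sg (j - 1) then 1 / 2 else 0) - 1 / of_nat n))
    = (\<Sum>j = 1..n - 1. (if j = m then dsum G j / 2 else 0) + (if j = Suc m then dsum G j / 2 else 0)
        - dsum G j / of_nat n)"
  proof (intro sum.cong refl)
    fix j assume "j \<in> {1..n - 1}"
    then have "sg m = sg j \<longleftrightarrow> j = m" "sg m = sg (j - 1) \<longleftrightarrow> j = Suc m"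
      using assms(2) by (auto simp: sg_inj)
    then show "dsum G j * ((if sg m = sg j then 1 / 2 else 0) + (if sg m = sg (j - 1) then 1 / 2 else 0) - 1 / of_nat n)
      = (if j = m then dsum G j / 2 else 0) + (if j = Suc m then dsum G j / 2 else 0) - dsum G j / of_nat n"
      by (cases "j = m") (auto simp: field_simps)
  qed
  also have "\<dots> = (\<Sum>j = 1..n - 1. if j = m then dsum G j / 2 else 0) 
      + (\<Sum>j = 1..n - 1. if j = Suc m then dsum G j / 2 else 0) - (\<Sum>j = 1..n - 1. dsum G j / of_nat n)"
    by (simp only: sum.distrib sum_subtractf)
  also have "(\<Sum>j = 1..n - 1. if j = m then dsum G j / 2 else 0) = dsum G m / 2"
    using assms dsum_0[OF assms(1)] by (cases "m = 0") auto
  also have "(\<Sum>j = 1..n - 1. if j = Suc m then dsum G j / 2 else 0) = dsum G (Suc m) / 2"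
    using assms dsum_n[of G] by (cases "Suc m = n") (auto)
  finally show ?thesis unfolding diagY_def using dsum_Suc[OF assms(2), of G] by (simp add: field_simps)
qed

lemma diagY_rec:
  assumes "(\<Sum>i<n. G (i, i)) = 0" "i < n"
  shows "diagY G i - diagY G ((i + c) mod n) = G (i, i)"
proof -
  obtain m where m: "m < n" "i = sg m" using assms(2) by (rule sg_cases)
  have "diagY G (sg (Suc m)) = dsum G (Suc m) - (\<Sum>j = 1..n - 1. dsum G j / of_nat n)"
  \<comment> \<open>At the wrap-around the next position is \<open>sg 0\<close>, and
    \<open>dsum\<close> is 0 at both ends because \<open>G\<close> is traceless.\<close>
  proof (cases "Suc m = n")
    case True
    then show ?thesis using diagY_sg[OF assms(1) n_pos] dsum_0[OF assms(1)] dsum_n[of G] sg_n by simp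
  next
    case False
    then show ?thesis using diagY_sg[OF assms(1), of "Suc m"] m by simp
  qed
  then show ?thesis using diagY_sg[OF assms(1) m(1)] dsum_Suc[OF m(1), of G] by (simp add: m sg_Suc)
qed

text \<open>Each weight is the diagonal of a traceless matrix: 1/2 + 1/2 - n/n = 0.\<close>

lemma diagY_sum:
  assumes "(\<Sum>i<n. G (i, i)) = 0"
  shows "(\<Sum>i<n. diagY G i) = 0"
proof -
  have "(\<Sum>i<n. diagY G i) = (\<Sum>j = 1..n - 1. \<Sum>i<n. dsum G j *
     ((if i = sg j then 1 / 2 else 0) + (if i = sg (j - 1) then 1 / 2 else 0) - 1 / of_nat n))"
    unfolding diagY_def sum.distrib using assms by (subst sum.swap) (simp add: sum_divide_distrib[symmetric])
  also have "\<dots> = (\<Sum>j = 1..n - 1. dsum G j * 0)"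
    by (simp only: sum_distrib_left[symmetric] sum_subtractf sum.distrib) simp
  finally show ?thesis by simp
qed

text \<open>Two solutions of the same difference equation along one cycle differ by a constant, and
  the vanishing traces force it to be 0.\<close>

lemma diag_unique:
  assumes "(\<Sum>i<n. G (i, i)) = 0" "\<And>i. i < n \<Longrightarrow> A i - A ((i + c) mod n) = G (i, i)"
    "(\<Sum>i<n. A i) = 0" "i < n"
  shows "A i = diagY G i"
proof -
  have D: "A (sg m) - diagY G (sg m) = A 0 - diagY G 0" for m
  proof (induction m)
    case (Suc m)
    have "A (sg m) - A (sg (Suc m)) = G (sg m, sg m)" "diagY G (sg m) - diagY G (sg (Suc m)) = G (sg m, sg m)"
      using assms(2)[of "sg m"] diagY_rec[OF assms(1), of "sg m"] by (simp_all add: sg_Suc)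
    then have "A (sg (Suc m)) = A (sg m) - G (sg m, sg m)" "diagY G (sg (Suc m)) = diagY G (sg m) - G (sg m, sg m)"
      by (metis diff_diff_eq2 diff_add_cancel add_diff_cancel_left')+
    then show ?case using Suc by simp
  qed simp
  have "(\<Sum>m<n. A (sg m) - diagY G (sg m)) = 0"
    using assms(3) diagY_sum[OF assms(1)] by (simp add: sum_subtractf sum_sg)
  then have "A 0 - diagY G 0 = 0" unfolding D by simp
  moreover obtain m where "i = sg m" using assms(4) by (rule sg_cases)
  ultimately show ?thesis using D[of m] by simp
qed

text \<open>\<open>X0\<close> and \<open>X1\<close> are the parts of degree \<open>0\<close> and \<open>1\<close> in \<open>z\<close> of the elements that the
  system below determines.\<close>

definition X0 :: "(nat \<times> nat \<Rightarrow> complex) \<Rightarrow> (nat \<times> nat \<Rightarrow> complex) \<Rightarrow> nat \<times> nat \<Rightarrow> complex" where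
  "X0 G b q = (if q \<in> pos_roots n then - chainS G q
     else if neg_root q \<in> pos_roots n then G q + chainT G b (neg_root q) else diagY G (fst q))"

definition X1 :: "(nat \<times> nat \<Rightarrow> complex) \<Rightarrow> nat \<times> nat \<Rightarrow> complex" where
  "X1 G q = (if neg_root q \<in> pos_roots n then - chainS G q else 0)"

text \<open>With \<open>A = F\<^sub>\<infinity>\<close>, \<open>G = F(x)/x\<close> and \<open>b = F(x)\<close> this is the condition on \<open>F \<in> Sol\<close>; for elements of the
  order, \<open>A\<close> is the parameter in \<open>\<gg>\<close>, and \<open>G\<close>, \<open>b\<close> come from the pairings with \<open>\<jmath>(g)\<close>, \<open>\<jmath>(z g)\<close>.\<close>

definition system :: "(nat \<times> nat \<Rightarrow> complex) \<Rightarrow> (nat \<times> nat \<Rightarrow> complex) \<Rightarrow> (nat \<times> nat \<Rightarrow> complex) \<Rightarrow> bool" where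
  "system G b A \<longleftrightarrow> (\<Sum>i<n. A (i, i)) = 0 \<and>
     (\<forall>q \<in> {..<n} \<times> {..<n}. q \<notin> UR \<longrightarrow> q \<notin> LL \<longrightarrow> A q - A (tau n c q) = G q) \<and>
     (\<forall>q \<in> UR. A (tau n c q) = - G q \<and> A q = b q)"

section \<open>Uniqueness and existence of the solution of the system\<close>

lemma system_sum: "system G b A \<Longrightarrow> (\<Sum>i<n. A (i, i)) = 0"
  and system_diag: "system G b A \<Longrightarrow> q \<in> {..<n} \<times> {..<n} \<Longrightarrow> q \<notin> UR \<Longrightarrow> q \<notin> LL \<Longrightarrow>
    A q = G q + A (tau n c q)"
  and system_UR: "system G b A \<Longrightarrow> q \<in> UR \<Longrightarrow> A (tau n c q) = - G q"
  and system_UR': "system G b A \<Longrightarrow> q \<in> UR \<Longrightarrow> A q = b q"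
  unfolding system_def by (simp, metis diff_add_cancel add.commute, simp, simp)

lemma X1_notLL: "q \<notin> LL \<Longrightarrow> X1 G q = 0"
  by (simp add: X1_def chainS_neg)

lemma X0_UR: "q \<in> UR \<Longrightarrow> X0 G b q = 0"
  by (simp add: X0_def chainS_UR UR_pos)

text \<open>Induction from the head of the chain, which lies in the upper right block and where the
  sum is the single term \<open>G q\<close>. As \<open>p_fun\<close> decreases along the chain, its
  complement in n serves as the measure.\<close>

lemma system_tau_pos:
  assumes A: "system G b A" and q: "q \<in> pos_roots n"
  shows "A (tau n c q) = - chainS G (tau n c q)"
  using q
proof (induction "n - p_fun n c q" arbitrary: q rule: less_induct)
  case less
  note q = less.prems and qn = pos_roots_in[OF less.prems]
  show ?case
  proof (cases "q \<in> UR")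
    case True
    then show ?thesis using system_UR[OF A True] q chainS_tau[OF qn] chainS_UR[OF True] by simp
  next
    case False
    obtain q' where q': "q' \<in> {..<n} \<times> {..<n}" "q = tau n c q'" using qn by (rule tau_surj)
    \<comment> \<open>A positive root whose predecessor is negative lies in the upper right block,
      which this case excludes; the shift also preserves being off the diagonal.\<close>
    have "q' \<in> pos_roots n"
    proof (rule ccontr)
      assume "q' \<notin> pos_roots n"
      moreover have "fst q' \<noteq> snd q'" using q q' by (cases q') (auto simp: tau_pair pos_roots_def)
      ultimately have "neg_root q' \<in> pos_roots n" using q' by (cases q') (auto simp: pos_roots_def)
      then show False using tau_UR_iff[OF q'(1)] q q' False by simp
    qed
    moreover have "n - p_fun n c q' < n - p_fun n c q"
      using p_fun_rec[OF \<open>q' \<in> pos_roots n\<close>] p_fun_less[OF q] q q' by simp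
    ultimately have "A q = - chainS G q" using less.hyps[of q'] q' by simp
    moreover have "q \<notin> LL" using q LL_neg pos_roots_not_neg by blast
    ultimately have "A (tau n c q) = - chainS G q - G q" using system_diag[OF A qn False] 
      by (metis add_diff_cancel_left')
    then show ?thesis using chainS_tau[OF qn, of G] q by simp
  qed
qed

text \<open>The equation \<open>A q = G q + A (tau n c q)\<close> is unrolled along the negative
  roots until the orbit turns positive. This happens in the upper right block, where
  \<open>A\<close> has the prescribed value \<open>b\<close>.\<close>

lemma system_tau_neg:
  assumes A: "system G b A" and \<alpha>: "\<alpha> \<in> pos_roots n"
  shows "A (tau n c (neg_root \<alpha>)) = chainT G b \<alpha>"
  using \<alpha>
proof (induction "p_fun n c \<alpha>" arbitrary: \<alpha> rule: less_induct)
  case less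
  note \<alpha> = less.prems
  have nin: "neg_root \<alpha> \<in> {..<n} \<times> {..<n}" using \<alpha> by (cases \<alpha>) (auto simp: pos_roots_def)
  show ?case
  proof (cases "tau n c \<alpha> \<in> pos_roots n")
    case True
    let ?q = "tau n c (neg_root \<alpha>)"
    have nq: "neg_root ?q \<in> pos_roots n" using True by (simp add: neg_root_tau)
    have "?q \<notin> LL" using tau_LL_iff[OF nin] \<alpha> pos_roots_not_neg by blast
    moreover have "?q \<notin> UR" using nq UR_pos pos_roots_not_neg by blast
    ultimately have "A ?q = G ?q + A (tau n c ?q)" using system_diag[OF A tau_in] by blast
    moreover have "A (tau n c (neg_root (tau n c \<alpha>))) = chainT G b (tau n c \<alpha>)"
      using less.hyps[of "tau n c \<alpha>"] True p_fun_rec[OF \<alpha>] by simp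
    ultimately show ?thesis using chainT_rec[OF \<alpha>, of G b] True by (simp add: neg_root_tau)
  next
    case False
    have "tau n c (neg_root \<alpha>) \<in> pos_roots n"
      using False \<alpha> tau_neq[of "\<alpha>"] tau_in[of \<alpha>] 
      by (cases \<alpha>; cases "tau n c \<alpha>") (auto simp: pos_roots_def tau_pair)
    then have "tau n c (neg_root \<alpha>) \<in> UR" using tau_UR_iff[OF nin] \<alpha> by simp
    then show ?thesis using system_UR'[OF A] chainT_rec[OF \<alpha>, of G b] False by (simp add: neg_root_tau)
  qed
qed

lemma pos_cases:
  assumes "q \<in> {..<n} \<times> {..<n}"
  obtains "q \<in> pos_roots n" | "neg_root q \<in> pos_roots n" "q \<notin> pos_roots n" 
    | i where "i < n" "q = (i, i)" "q \<notin> pos_roots n" "neg_root q \<notin> pos_roots n"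
  using assms by (cases q) (fastforce simp: pos_roots_def)

text \<open>In the lower left block \<open>A q\<close> ends a chain of positive roots while
  \<open>A (tau n c q)\<close> belongs to the following chain of negative roots; the system does not
  relate the two. This is why such an entry carries both a part \<open>X1\<close> and a part
  \<open>X0\<close>.\<close>

lemma system_unique:
  assumes A: "system G b A" and G: "(\<Sum>i<n. G (i, i)) = 0" and q: "q \<in> {..<n} \<times> {..<n}"
  shows "q \<notin> UR \<Longrightarrow> q \<notin> LL \<Longrightarrow> A q = X0 G b q"
    and "q \<in> LL \<Longrightarrow> A q = X1 G q" and "q \<in> LL \<Longrightarrow> G q + A (tau n c q) = X0 G b q"
proof -
  obtain q' where q': "q' \<in> {..<n} \<times> {..<n}" "q = tau n c q'" using q by (rule tau_surj)
  show "A q = X0 G b q" if nUR: "q \<notin> UR" and nLL: "q \<notin> LL"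
    using q
  proof (cases rule: pos_cases)
    case 1
    have "fst q' \<noteq> snd q'" using 1 q' by (cases q') (auto simp: tau_pair pos_roots_def)
    then have "q' \<in> pos_roots n" using q' 1 nUR tau_UR_iff[OF q'(1)] 
      by (cases q') (auto simp: pos_roots_def)
    then show ?thesis using system_tau_pos[OF A] q' 1 by (simp add: X0_def)
  next
    case 2
    then show ?thesis using system_tau_neg[OF A 2(1)] system_diag[OF A q nUR nLL] by (simp add: X0_def)
  next
    case (3 i)
    have "A (i, i) = diagY G i"
    proof (rule diag_unique[OF G _ _ 3(1), of "\<lambda>i. A (i, i)"])
      show "(\<Sum>i<n. A (i, i)) = 0" by (rule system_sum[OF A])
      show "A (k, k) - A ((k + c) mod n, (k + c) mod n) = G (k, k)" if "k < n" for k
        using system_diag[OF A, of "(k, k)"] that by (simp add: tau_pair UR_def LL_def)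
    qed
    then show ?thesis using 3 by (simp add: X0_def)
  qed
  assume LL: "q \<in> LL"
  show "A q = X1 G q" using LL tau_LL_iff[OF q'(1)] system_tau_pos[OF A, of q'] q' LL_neg[OF LL]
    by (simp add: X1_def)
  show "G q + A (tau n c q) = X0 G b q" using LL_neg[OF LL] system_tau_neg[OF A, of "neg_root q"]
    pos_roots_not_neg[of q] by (auto simp: X0_def)
qed

text \<open>With the values forced by uniqueness, each equation is one recursion step of
  \<open>chainS\<close>, \<open>chainT\<close> or \<open>diagY\<close>, for \<open>q\<close>
  positive, negative or diagonal.\<close>

lemma system_exists:
  assumes G: "(\<Sum>i<n. G (i, i)) = 0"
  shows "system G b (\<lambda>q. if q \<in> UR then b q else if q \<in> LL then X1 G q else X0 G b q)" (is "system G b ?A")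
  unfolding system_def
proof (intro conjI ballI impI)
  have "(i, i) \<notin> UR" "(i, i) \<notin> LL" for i by (auto simp: UR_def LL_def)
  then show "(\<Sum>i<n. ?A (i, i)) = 0" using diagY_sum[OF G] by (simp add: X0_def pos_roots_def)
next
  fix q assume q: "q \<in> {..<n} \<times> {..<n}" and nUR: "q \<notin> UR" and nLL: "q \<notin> LL"
  let ?t = "tau n c q"
  show "?A q - ?A ?t = G q"
    using q
  proof (cases rule: pos_cases)
    case 1
    have "?t \<notin> UR" using tau_UR_iff[OF q] 1 pos_roots_not_neg by blast
    moreover have "?t \<in> LL \<longleftrightarrow> ?t \<notin> pos_roots n" using tau_LL_iff[OF q] 1 by simp
    ultimately have "?A ?t = - chainS G ?t" using LL_neg[of ?t] by (auto simp: X1_def X0_def)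
    then show ?thesis using 1 chainS_tau[OF q] nUR nLL by (simp add: X0_def)
  next
    case 2
    have "?t \<notin> LL" using tau_LL_iff[OF q] 2 by blast
    have nt: "neg_root ?t = tau n c (neg_root q)" by (simp add: neg_root_tau)
    have "?A ?t = chainT G b (neg_root q)"
    proof (cases "?t \<in> UR")
      case True
      then have "neg_root ?t \<notin> pos_roots n" using UR_pos pos_roots_not_neg by blast
      then show ?thesis using chainT_rec[OF 2(1), of G b] True nt by (simp add: neg_root_tau)
    next
      case False
      then have "?t \<notin> pos_roots n" using tau_UR_iff[OF q] 2 by simp
      then have "neg_root ?t \<in> pos_roots n" using tau_neq[of q] 2 q tau_in[of q]
        by (cases q; cases ?t) (auto simp: pos_roots_def)
      then show ?thesis using chainT_rec[OF 2(1), of G b] False \<open>?t \<notin> LL\<close> \<open>?t \<notin> pos_roots n\<close> nt 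
        by (simp add: X0_def neg_root_tau)
    qed
    then show ?thesis using 2 nUR nLL by (simp add: X0_def)
  next
    case (3 i)
    have "(k, k) \<notin> UR" "(k, k) \<notin> LL" for k by (auto simp: UR_def LL_def)
    then show ?thesis using 3 diagY_rec[OF G 3(1)] by (simp add: tau_pair X0_def pos_roots_def)
  qed
next
  fix q assume q: "q \<in> UR"
  let ?t = "tau n c q"
  note qp = UR_pos[OF q] and qn = pos_roots_in[OF UR_pos[OF q]]
  have "?t \<notin> UR" using tau_UR_iff[OF qn] qp pos_roots_not_neg by blast
  moreover have "?t \<in> LL \<longleftrightarrow> ?t \<notin> pos_roots n" using tau_LL_iff[OF qn] qp by simp
  ultimately have "?A ?t = - chainS G ?t" using LL_neg[of ?t] by (auto simp: X1_def X0_def)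
  then show "?A ?t = - G q" using qp chainS_tau[OF qn] chainS_UR[OF q] by simp
  show "?A q = b q" using q by simp
qed

text \<open>Linearity in the pair of right-hand sides. In the series, the two summands come from k =
  0 and from k = 1, the latter with the factor x^1.\<close>

lemma X0_split: "X0 G (\<lambda>q. x * b q) q = X0 G (\<lambda>_. 0) q + x * X0 (\<lambda>_. 0) b q"
  by (simp add: X0_def chainT_def chainS_def diagY_def dsum_def algebra_simps)

end

section \<open>Contraction of tensors with traceless matrices\<close>

lemma tr_mult:
  "A \<in> carrier_mat n n \<Longrightarrow> B \<in> carrier_mat n n \<Longrightarrow> tr (A * B) = (\<Sum>i<n. \<Sum>j<n. A $$ (i, j) * B $$ (j, i))"
  by (simp add: tr_def scalar_prod_def atLeast0LessThan)

lemma tr_comm: "A \<in> carrier_mat n n \<Longrightarrow> B \<in> carrier_mat n n \<Longrightarrow> tr (A * B) = tr (B * A)"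
  unfolding tr_mult[of A n B] tr_mult[of B n A] by (subst sum.swap) (simp add: mult.commute)

lemma tr_add: "A \<in> carrier_mat n n \<Longrightarrow> B \<in> carrier_mat n n \<Longrightarrow> tr (A + B) = tr A + tr B"
  by (simp add: tr_def sum.distrib)

lemma tr_minus: "A \<in> carrier_mat n n \<Longrightarrow> B \<in> carrier_mat n n \<Longrightarrow> tr (A - B) = tr A - tr B"
  by (simp add: tr_def sum_subtractf)

lemma tr_smult: "tr (a \<cdot>\<^sub>m A) = a * tr A" if "A \<in> carrier_mat n n"
  using that by (simp add: tr_def sum_distrib_left)

lemma slI: "A \<in> carrier_mat n n \<Longrightarrow> (\<Sum>i<n. A $$ (i, i)) = 0 \<Longrightarrow> A \<in> sl n"
  by (simp add: sl_def tr_def)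

lemma sl_carrier: "A \<in> sl n \<Longrightarrow> A \<in> carrier_mat n n"
  by (simp add: sl_def)

lemma sl_sum: "A \<in> sl n \<Longrightarrow> (\<Sum>i<n. A $$ (i, i)) = 0"
  by (auto simp: sl_def tr_def)

lemma sl_add: "A \<in> sl n \<Longrightarrow> B \<in> sl n \<Longrightarrow> A + B \<in> sl n"
  by (auto simp: sl_def tr_add)

lemma sl_minus: "A \<in> sl n \<Longrightarrow> B \<in> sl n \<Longrightarrow> A - B \<in> sl n"
  by (auto simp: sl_def tr_minus)

lemma sl_smult: "A \<in> sl n \<Longrightarrow> a \<cdot>\<^sub>m A \<in> sl n"
  by (auto simp: sl_def tr_smult)

lemma sl_commutator: "A \<in> carrier_mat n n \<Longrightarrow> B \<in> carrier_mat n n \<Longrightarrow> A * B - B * A \<in> sl n"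
  by (simp add: sl_def tr_minus[of "A * B" n "B * A"] tr_comm[of B n A] minus_carrier_mat)

lemma sl_zero: "0\<^sub>m n n \<in> sl n"
  by (rule slI) auto

lemma e_mat_carrier [simp]: "e_mat n \<alpha> \<in> carrier_mat n n"
  by (simp add: e_mat_def)

lemma e_mat_dim [simp]: "dim_row (e_mat n \<alpha>) = n" "dim_col (e_mat n \<alpha>) = n"
  by (simp_all add: e_mat_def)

lemma e_mat_index: "i < n \<Longrightarrow> j < n \<Longrightarrow> e_mat n \<alpha> $$ (i, j) = (if (i, j) = \<alpha> then 1 else 0)"
  by (simp add: e_mat_def)

lemma tr_e_mat:
  assumes "U \<in> carrier_mat n n" "i < n" "j < n"
  shows "tr (e_mat n (i, j) * U) = U $$ (j, i)"
proof -
  have "tr (e_mat n (i, j) * U) = (\<Sum>k<n. \<Sum>l<n. if k = i then (if l = j then U $$ (l, k) else 0) else 0)"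
    unfolding tr_mult[OF e_mat_carrier assms(1)]
    by (intro sum.cong refl) (auto simp: e_mat_index)
  also have "\<dots> = (\<Sum>k<n. if k = i then U $$ (j, k) else 0)"
    using assms by (intro sum.cong refl) auto
  finally show ?thesis using assms by simp
qed

lemma e_mat_sl: "i \<noteq> j \<Longrightarrow> e_mat n (i, j) \<in> sl n"
  by (rule slI) (auto simp: e_mat_index intro!: sum.neutral)

lemma e_mat_diff_sl: "i < n \<Longrightarrow> j < n \<Longrightarrow> e_mat n (i, i) - e_mat n (j, j) \<in> sl n"
  by (rule slI) (auto simp: e_mat_index sum_subtractf minus_carrier_mat)

text \<open>The linear map that the trace form on the first factor attaches to a tensor: a \<otimes>
  b becomes U to tr(a U) b.\<close>

definition contr :: "nat \<Rightarrow> tensor \<Rightarrow> complex mat \<Rightarrow> nat \<times> nat \<Rightarrow> complex" where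
  "contr n T U q = (\<Sum>i<n. \<Sum>j<n. T (i, j) q * U $$ (j, i))"

text \<open>Contractions with traceless matrices cannot see multiples of the identity in the first
  factor. Excluding these makes the test in \<open>tensor_eqI\<close> conclusive.\<close>

definition sl_tensor :: "nat \<Rightarrow> tensor \<Rightarrow> bool" where
  "sl_tensor n T \<longleftrightarrow> (\<forall>i j q. \<not> (i < n \<and> j < n) \<longrightarrow> T (i, j) q = 0) \<and> (\<forall>q. (\<Sum>i<n. T (i, i) q) = 0)"

lemma sl_tensor_out: "sl_tensor n T \<Longrightarrow> \<not> (i < n \<and> j < n) \<Longrightarrow> T (i, j) q = 0"
  and sl_tensor_trace: "sl_tensor n T \<Longrightarrow> (\<Sum>i<n. T (i, i) q) = 0"
  unfolding sl_tensor_def by blast+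

lemma contr_eq_tr: "U \<in> carrier_mat n n \<Longrightarrow> contr n T U q = tr (mat n n (\<lambda>p. T p q) * U)"
  by (simp add: tr_mult[of _ n] contr_def)

lemma contr_minus: "contr n (T - T') U q = contr n T U q - contr n T' U q"
  by (simp add: contr_def sum_subtractf left_diff_distrib)

lemma contr_add: "contr n (T + T') U q = contr n T U q + contr n T' U q"
  by (simp add: contr_def sum.distrib distrib_right)

lemma contr_scale: "contr n (s \<cdot>\<^sub>t T) U q = s * contr n T U q"
  by (simp add: contr_def scale_def sum_distrib_left mult.assoc)

lemma contr_zero: "contr n 0 U q = 0"
  by (simp add: contr_def)

lemma contr_sum: "contr n (sum T A) U q = (\<Sum>a\<in>A. contr n (T a) U q)"
  by (induction A rule: infinite_finite_induct) (simp_all only: sum.infinite sum.empty sum.insert contr_zero contr_add not_False_eq_True)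

lemma contr_tensor:
  assumes "a \<in> carrier_mat n n" "b \<in> carrier_mat n n" "U \<in> carrier_mat n n"
  shows "contr n (a \<otimes>\<^sub>t b) U q = (if fst q < n \<and> snd q < n then tr (a * U) * b $$ q else 0)"
proof -
  obtain k l where q: "q = (k, l)" by (cases q)
  have "contr n (a \<otimes>\<^sub>t b) U q = (\<Sum>i<n. \<Sum>j<n. a $$ (i, j) * U $$ (j, i) * (if k < n \<and> l < n then b $$ (k, l) else 0))"
    unfolding contr_def q using assms by (intro sum.cong refl) (simp add: tensor_def)
  then show ?thesis by (simp add: q tr_mult[OF assms(1,3)] sum_distrib_right)
qed

lemma sl_tensor_zero: "sl_tensor n 0"
  by (simp add: sl_tensor_def)

lemma sl_tensor_add: "sl_tensor n T \<Longrightarrow> sl_tensor n T' \<Longrightarrow> sl_tensor n (T + T')"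
  by (simp add: sl_tensor_def sum.distrib)

lemma sl_tensor_minus: "sl_tensor n T \<Longrightarrow> sl_tensor n T' \<Longrightarrow> sl_tensor n (T - T')"
  by (simp add: sl_tensor_def sum_subtractf)

lemma sl_tensor_scale: "sl_tensor n T \<Longrightarrow> sl_tensor n (s \<cdot>\<^sub>t T)"
  by (simp add: sl_tensor_def scale_def sum_distrib_left[symmetric])

lemma sl_tensor_sum: "(\<And>a. a \<in> A \<Longrightarrow> sl_tensor n (T a)) \<Longrightarrow> sl_tensor n (sum T A)"
proof (induction A rule: infinite_finite_induct)
  case (insert x F)
  then have "sl_tensor n (T x + sum T F)" by (intro sl_tensor_add) auto
  then show ?case using insert by (simp only: sum.insert not_False_eq_True)
qed (simp_all only: sum.infinite sum.empty sl_tensor_zero not_False_eq_True)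

lemma sl_tensor_tensor:
  assumes "a \<in> sl n" shows "sl_tensor n (a \<otimes>\<^sub>t b)"
proof -
  have "(\<Sum>i<n. (a \<otimes>\<^sub>t b) (i, i) q) = (\<Sum>i<n. a $$ (i, i)) * (if fst q < dim_row b \<and> snd q < dim_col b then b $$ q else 0)" for q
    using sl_carrier[OF assms] unfolding sum_distrib_right by (cases q) (auto simp: tensor_def)
  then show ?thesis using sl_carrier[OF assms] sl_sum[OF assms] by (auto simp: sl_tensor_def tensor_def)
qed

lemma sl_tensor_wedge: "a \<in> sl n \<Longrightarrow> b \<in> sl n \<Longrightarrow> sl_tensor n (a \<and>\<^sub>t b)"
  by (simp add: wedge_def sl_tensor_minus sl_tensor_tensor)

text \<open>Testing with \<open>e_mat\<close> off the diagonal kills the entries there; testing with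
  differences of diagonal units makes the diagonal constant, and the trace condition makes it
  0.\<close>

lemma sl_nondegenerate:
  assumes a: "a \<in> sl n" and z: "\<And>U. U \<in> sl n \<Longrightarrow> tr (a * U) = (0 :: complex)"
  shows "a = 0\<^sub>m n n"
proof (rule eq_matI)
  fix i j assume ij: "i < dim_row (0\<^sub>m n n :: complex mat)" "j < dim_col (0\<^sub>m n n :: complex mat)"
  note ac = sl_carrier[OF a]
  have diag: "a $$ (k, k) = a $$ (l, l)" if "k < n" "l < n" for k l
  proof -
    have "tr (a * (e_mat n (k, k) - e_mat n (l, l))) = tr ((e_mat n (k, k) - e_mat n (l, l)) * a)"
      using ac by (intro tr_comm[of _ n]) (auto simp: minus_carrier_mat)
    also have "\<dots> = a $$ (k, k) - a $$ (l, l)"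
      using ac that tr_minus[OF mult_carrier_mat[OF e_mat_carrier ac] mult_carrier_mat[OF e_mat_carrier ac], of "(k, k)" "(l, l)"]
      by (subst minus_mult_distrib_mat[of _ n n]) (auto simp: tr_e_mat)
    finally show ?thesis using z[OF e_mat_diff_sl[OF that]] by simp
  qed
  show "a $$ (i, j) = 0\<^sub>m n n $$ (i, j)"
  proof (cases "i = j")
    case False
    have "tr (a * e_mat n (j, i)) = a $$ (i, j)"
      using ac ij tr_comm[OF ac e_mat_carrier] by (simp add: tr_e_mat)
    then show ?thesis using z[OF e_mat_sl, of j i] False ij by simp
  next
    case True
    have "(\<Sum>k<n. a $$ (k, k)) = (\<Sum>k<n. a $$ (i, i))"
      using ij by (intro sum.cong refl diag) auto
    then have "(\<Sum>k<n. a $$ (k, k)) = of_nat n * a $$ (i, i)" by simp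
    then show ?thesis using sl_sum[OF a] True ij by simp
  qed
qed (use sl_carrier[OF a] in auto)

lemma tensor_eqI:
  assumes "sl_tensor n T" "sl_tensor n T'"
    and "\<And>U q. U \<in> sl n \<Longrightarrow> contr n T U q = contr n T' U q"
  shows "T = T'"
proof (intro ext)
  fix p q
  let ?D = "T - T'"
  have D: "sl_tensor n ?D" using assms(1,2) by (rule sl_tensor_minus)
  have "mat n n (\<lambda>p. ?D p q) = 0\<^sub>m n n"
  proof (rule sl_nondegenerate)
    show "mat n n (\<lambda>p. ?D p q) \<in> sl n" using sl_tensor_trace[OF D, of q] by (intro slI) auto
    show "tr (mat n n (\<lambda>p. ?D p q) * U) = 0" if "U \<in> sl n" for U
      using assms(3)[OF that, of q] contr_minus[of n T T' U q]
      unfolding contr_eq_tr[OF sl_carrier[OF that], symmetric] by simp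
  qed
  then have z: "mat n n (\<lambda>p. ?D p q) $$ (i, j) = 0\<^sub>m n n $$ (i, j)" for i j by (rule arg_cong)
  have "?D (i, j) q = 0" if "i < n" "j < n" for i j using z[of i j] that by simp
  then show "T p q = T' p q" using sl_tensor_out[OF D] by (cases p; cases "fst p < n \<and> snd p < n") auto
qed

section \<open>Dual bases for the trace form\<close>

locale basis =
  fixes n :: nat and B :: "complex mat set"
  assumes basis: "sl_basis n B" and n0: "0 < n"
begin

lemma finite_B: "finite B" and B_sl: "b \<in> B \<Longrightarrow> b \<in> sl n"
  using basis by (auto simp: sl_basis_def)

definition comb :: "(complex mat \<Rightarrow> complex) \<Rightarrow> complex mat" where
  "comb s = mat n n (\<lambda>p. \<Sum>b\<in>B. s b * b $$ p)"

lemma coord_ex: "a \<in> sl n \<Longrightarrow> \<exists>!s. (\<forall>b. b \<notin> B \<longrightarrow> s b = 0) \<and> a = comb s"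
  using basis by (simp add: sl_basis_def comb_def)

definition coord :: "complex mat \<Rightarrow> complex mat \<Rightarrow> complex" where
  "coord a = (THE s. (\<forall>b. b \<notin> B \<longrightarrow> s b = 0) \<and> a = comb s)"

lemma comb_coord: "a \<in> sl n \<Longrightarrow> comb (coord a) = a"
  and coord_out: "a \<in> sl n \<Longrightarrow> b \<notin> B \<Longrightarrow> coord a b = 0"
  unfolding coord_def using theI'[OF coord_ex] by (metis (no_types, lifting))+

lemma coord_eqI: "a \<in> sl n \<Longrightarrow> (\<And>b. b \<notin> B \<Longrightarrow> s b = 0) \<Longrightarrow> a = comb s \<Longrightarrow> coord a = s"
  unfolding coord_def by (rule the1_equality[OF coord_ex]) auto

lemma coord_basis: "b \<in> B \<Longrightarrow> coord b = (\<lambda>b'. if b' = b then 1 else 0)"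
proof (rule coord_eqI[OF B_sl])
  assume b: "b \<in> B"
  show "b = comb (\<lambda>b'. if b' = b then 1 else 0)"
    using finite_B b sl_carrier[OF B_sl[OF b]] 
    by (intro eq_matI) (auto simp: comb_def if_distrib[of "\<lambda>x. x * _"] cong: if_cong)
qed auto

lemma coord_add: "a \<in> sl n \<Longrightarrow> a' \<in> sl n \<Longrightarrow> coord (a + a') = (\<lambda>b. coord a b + coord a' b)"
proof (rule coord_eqI)
  assume a: "a \<in> sl n" "a' \<in> sl n"
  have "a + a' = comb (coord a) + comb (coord a')" using a by (simp add: comb_coord)
  also have "\<dots> = comb (\<lambda>b. coord a b + coord a' b)"
    by (intro eq_matI) (auto simp: comb_def sum.distrib algebra_simps)
  finally show "a + a' = comb (\<lambda>b. coord a b + coord a' b)" .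
qed (auto simp: sl_add coord_out)

lemma coord_smult: "a \<in> sl n \<Longrightarrow> coord (s \<cdot>\<^sub>m a) = (\<lambda>b. s * coord a b)"
proof (rule coord_eqI)
  assume a: "a \<in> sl n"
  have "s \<cdot>\<^sub>m a = s \<cdot>\<^sub>m comb (coord a)" using a by (simp add: comb_coord)
  also have "\<dots> = comb (\<lambda>b. s * coord a b)"
    by (intro eq_matI) (auto simp: comb_def sum_distrib_left algebra_simps)
  finally show "s \<cdot>\<^sub>m a = comb (\<lambda>b. s * coord a b)" .
qed (auto simp: sl_smult coord_out)

text \<open>The matrix \<open>u i j\<close> is the projection of \<open>e\<^sub>i\<^sub>j\<close> to the traceless matrices, so that every
  traceless \<open>U\<close> is the sum of the \<open>U\<^sub>i\<^sub>j u i j\<close>.\<close>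

definition u :: "nat \<Rightarrow> nat \<Rightarrow> complex mat" where
  "u i j = e_mat n (i, j) - (if i = j then 1 / of_nat n else 0) \<cdot>\<^sub>m 1\<^sub>m n"

lemma u_sl: "i < n \<Longrightarrow> j < n \<Longrightarrow> u i j \<in> sl n"
  using n0 by (intro slI; cases "i = j")
    (simp_all add: u_def e_mat_index sum_subtractf minus_carrier_mat conj_commute cong: conj_cong)

lemma sum_mat_sl:
  assumes "finite I" "\<And>i. i \<in> I \<Longrightarrow> f i \<in> sl n"
  shows "mat n n (\<lambda>p. \<Sum>i\<in>I. f i $$ p) \<in> sl n"
proof (rule slI)
  have "(\<Sum>k<n. mat n n (\<lambda>p. \<Sum>i\<in>I. f i $$ p) $$ (k, k)) = (\<Sum>i\<in>I. \<Sum>k<n. f i $$ (k, k))"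
    by (subst sum.swap) simp
  then show "(\<Sum>k<n. mat n n (\<lambda>p. \<Sum>i\<in>I. f i $$ p) $$ (k, k)) = 0"
    using sl_sum[OF assms(2)] by simp
qed simp

lemma coord_zero: "coord (0\<^sub>m n n) b = 0"
proof -
  have "0 \<cdot>\<^sub>m 0\<^sub>m n n = (0\<^sub>m n n :: complex mat)" by (intro eq_matI) auto
  then show ?thesis using coord_smult[OF sl_zero, of 0] by simp
qed

lemma coord_sum:
  assumes "finite I" "\<And>i. i \<in> I \<Longrightarrow> f i \<in> sl n"
  shows "coord (mat n n (\<lambda>p. \<Sum>i\<in>I. f i $$ p)) b = (\<Sum>i\<in>I. coord (f i) b)"
  using assms
proof (induction I rule: finite_induct)
  case empty
  have "mat n n (\<lambda>p. \<Sum>i\<in>{}. f i $$ p) = 0\<^sub>m n n" by (intro eq_matI) auto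
  then show ?case by (simp only: coord_zero sum.empty)
next
  case (insert i I)
  have "mat n n (\<lambda>p. \<Sum>i\<in>insert i I. f i $$ p) = f i + mat n n (\<lambda>p. \<Sum>i\<in>I. f i $$ p)"
    using insert sl_carrier[of "f i" n] by (intro eq_matI) auto
  then show ?case using insert coord_add[of "f i" "mat n n (\<lambda>p. \<Sum>i\<in>I. f i $$ p)"] sum_mat_sl[of I f] by simp
qed

text \<open>A coordinate is a linear functional, hence determined by its values on the
  \<open>u i j\<close>. The matrix of these values is transposed because tr(a U) pairs the (i, j)
  entry of a with the (j, i) entry of U.\<close>

lemma coord_eq_tr:
  assumes U: "U \<in> sl n"
  shows "coord U b = tr (mat n n (\<lambda>(i, j). coord (u j i) b) * U)"
proof -
  have Uc: "U \<in> carrier_mat n n" using U by (rule sl_carrier)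
  let ?I = "{..<n} \<times> {..<n}"
  have "(\<Sum>(i, j)\<in>?I. (U $$ (i, j) \<cdot>\<^sub>m u i j) $$ (k, l)) = U $$ (k, l)" if kl: "k < n" "l < n" for k l
  proof -
    have "(\<Sum>(i, j)\<in>?I. (U $$ (i, j) \<cdot>\<^sub>m u i j) $$ (k, l)) 
      = (\<Sum>i<n. \<Sum>j<n. (if j = l then (if i = k then U $$ (i, j) else 0) else 0) - (if i = j then U $$ (i, j) * (if k = l then 1 / of_nat n else 0) else 0))"
      unfolding sum.cartesian_product[symmetric] using kl
      by (intro sum.cong refl) (auto simp: u_def e_mat_index right_diff_distrib)
    also have "\<dots> = U $$ (k, l) - (\<Sum>i<n. U $$ (i, i)) * (if k = l then 1 / of_nat n else 0)"
      using kl by (simp add: sum_subtractf sum_distrib_right)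
    finally show ?thesis using sl_sum[OF U] by simp
  qed
  then have "U = mat n n (\<lambda>p. \<Sum>i\<in>?I. (case i of (i, j) \<Rightarrow> U $$ (i, j) \<cdot>\<^sub>m u i j) $$ p)"
    using Uc by (intro eq_matI) (auto simp: case_prod_unfold)
  then have "coord U b = coord (mat n n (\<lambda>p. \<Sum>i\<in>?I. (case i of (i, j) \<Rightarrow> U $$ (i, j) \<cdot>\<^sub>m u i j) $$ p)) b"
    by (rule arg_cong)
  also have "\<dots> = (\<Sum>i\<in>?I. coord (case i of (i, j) \<Rightarrow> U $$ (i, j) \<cdot>\<^sub>m u i j) b)"
    by (rule coord_sum) (auto simp: u_sl sl_smult)
  also have "\<dots> = (\<Sum>(i, j)\<in>?I. U $$ (i, j) * coord (u i j) b)"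
    by (intro sum.cong refl) (auto simp: u_sl coord_smult)
  also have "\<dots> = (\<Sum>i<n. \<Sum>j<n. U $$ (i, j) * coord (u i j) b)"
    by (rule sum.cartesian_product[symmetric])
  also have "\<dots> = tr (mat n n (\<lambda>(i, j). coord (u j i) b) * U)"
    unfolding tr_mult[OF mat_carrier Uc] by (subst sum.swap) (intro sum.cong refl, simp)
  finally show ?thesis .
qed

lemma dual_ex:
  assumes "b \<in> B"
  shows "\<exists>a \<in> sl n. \<forall>U\<in>sl n. tr (a * U) = coord U b"
proof (intro bexI ballI)
  let ?a = "mat n n (\<lambda>(i, j). coord (u j i) b)"
  show "?a \<in> sl n"
  proof (rule slI)
    \<comment> \<open>The diagonal projections add up to I - n (1/n) I = 0, so the representing
      matrix is traceless and can serve as a dual vector.\<close>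
    have "(\<Sum>i<n. u i i $$ (k, l)) = 0" if "k < n" "l < n" for k l
    proof (cases "k = l")
      case True
      then show ?thesis using n0 that by (simp add: u_def e_mat_index sum_subtractf)
    next
      case False
      then show ?thesis using that by (intro sum.neutral) (auto simp: u_def e_mat_index)
    qed
    then have "mat n n (\<lambda>p. \<Sum>i<n. u i i $$ p) = 0\<^sub>m n n" by (intro eq_matI) auto
    then have "(\<Sum>i<n. coord (u i i) b) = coord (0\<^sub>m n n) b"
      using coord_sum[of "{..<n}" "\<lambda>i. u i i" b] u_sl by simp
    also have "\<dots> = 0" by (rule coord_zero)
    finally show "(\<Sum>i<n. ?a $$ (i, i)) = 0" by simp
  qed simp
  show "tr (?a * U) = coord U b" if "U \<in> sl n" for U using coord_eq_tr[OF that] by simp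
qed

lemma nondegenerate_B:
  assumes a: "a \<in> sl n" and z: "\<And>b. b \<in> B \<Longrightarrow> tr (a * b) = 0"
  shows "a = 0\<^sub>m n n"
proof (rule sl_nondegenerate[OF a])
  fix U :: "complex mat" assume U: "U \<in> sl n"
  note ac = sl_carrier[OF a]
  have "tr (a * U) = tr (a * comb (coord U))" by (simp add: comb_coord U)
  also have "\<dots> = (\<Sum>i<n. \<Sum>j<n. \<Sum>b\<in>B. coord U b * (a $$ (i, j) * b $$ (j, i)))"
    using tr_mult[OF ac, of "comb (coord U)"] by (simp add: comb_def sum_distrib_left algebra_simps)
  also have "\<dots> = (\<Sum>i<n. \<Sum>b\<in>B. \<Sum>j<n. coord U b * (a $$ (i, j) * b $$ (j, i)))"
    by (subst sum.swap) (rule refl)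
  also have "\<dots> = (\<Sum>b\<in>B. \<Sum>i<n. \<Sum>j<n. coord U b * (a $$ (i, j) * b $$ (j, i)))"
    by (rule sum.swap)
  also have "\<dots> = (\<Sum>b\<in>B. coord U b * tr (a * b))"
    using tr_mult[OF ac sl_carrier[OF B_sl]] by (simp add: sum_distrib_left)
  finally show "tr (a * U) = 0" using z by simp
qed

lemma eq_B:
  assumes "a \<in> sl n" "a' \<in> sl n" "\<And>b. b \<in> B \<Longrightarrow> tr (a * b) = tr (a' * b)"
  shows "a = a'"
proof -
  note c = sl_carrier[OF assms(1)] sl_carrier[OF assms(2)]
  have "a - a' = 0\<^sub>m n n"
  proof (rule nondegenerate_B)
    show "tr ((a - a') * b) = 0" if "b \<in> B" for b
      using assms(3)[OF that] sl_carrier[OF B_sl[OF that]] c tr_minus[OF mult_carrier_mat[of a n n b n] mult_carrier_mat[of a' n n b n]]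
      by (simp add: minus_mult_distrib_mat[of a n n a' b n])
  qed (rule sl_minus[OF assms(1,2)])
  then have "(a - a') $$ (i, j) = 0" if "i < n" "j < n" for i j using that by simp
  then show ?thesis using c by (intro eq_matI) auto
qed

lemma dual_vector_props:
  assumes "b \<in> B"
  shows dual_sl: "dual_vector n B b \<in> sl n"
    and dual_pairing: "b' \<in> B \<Longrightarrow> tr (dual_vector n B b * b') = (if b' = b then 1 else 0)"
    and dual_coord: "U \<in> sl n \<Longrightarrow> tr (dual_vector n B b * U) = coord U b"
    and dual_eqI: "a \<in> sl n \<Longrightarrow> (\<And>b'. b' \<in> B \<Longrightarrow> tr (a * b') = (if b' = b then 1 else 0)) \<Longrightarrow>
      dual_vector n B b = a"
proof -
  let ?P = "\<lambda>a. a \<in> sl n \<and> (\<forall>b'\<in>B. tr (a * b') = (if b' = b then 1 else 0))"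
  have uniq: "a = a'" if "?P a" "?P a'" for a a' using that by (intro eq_B) auto
  obtain a where a: "a \<in> sl n" "\<And>U. U \<in> sl n \<Longrightarrow> tr (a * U) = coord U b"
    using dual_ex[OF assms] by auto
  have Pa: "?P a" using a coord_basis B_sl by auto
  have eq: "dual_vector n B b = a" unfolding dual_vector_def by (rule the_equality[of ?P, OF Pa]) (rule uniq[OF _ Pa])
  show "dual_vector n B b \<in> sl n" "b' \<in> B \<Longrightarrow> tr (dual_vector n B b * b') = (if b' = b then 1 else 0)"
    "U \<in> sl n \<Longrightarrow> tr (dual_vector n B b * U) = coord U b"
    using Pa a by (auto simp: eq)
  show "dual_vector n B b = a'" if "a' \<in> sl n" "\<And>b'. b' \<in> B \<Longrightarrow> tr (a' * b') = (if b' = b then 1 else 0)" for a'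
    unfolding eq using uniq[OF Pa] that by auto
qed

lemma dual_dims [simp]: "b \<in> B \<Longrightarrow> dim_row (dual_vector n B b) = n" "b \<in> B \<Longrightarrow> dim_col (dual_vector n B b) = n"
  using sl_carrier[OF dual_sl] by auto

lemma expand_dual:
  assumes "U \<in> sl n" "i < n" "j < n"
  shows "(\<Sum>b\<in>B. tr (dual_vector n B b * U) * b $$ (i, j)) = U $$ (i, j)"
proof -
  have "U $$ (i, j) = comb (coord U) $$ (i, j)" using comb_coord[OF assms(1)] by simp
  then show ?thesis using assms by (simp add: comb_def dual_coord)
qed

lemma expand_basis:
  assumes U: "U \<in> sl n"
  shows "U = mat n n (\<lambda>p. \<Sum>b\<in>B. tr (b * U) * dual_vector n B b $$ p)" (is "_ = ?V")
proof (rule eq_B[OF U])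
  have eqV: "?V = mat n n (\<lambda>p. \<Sum>b\<in>B. (tr (b * U) \<cdot>\<^sub>m dual_vector n B b) $$ p)"
    by (intro eq_matI) (auto intro!: sum.cong)
  show "?V \<in> sl n" unfolding eqV by (intro sum_mat_sl finite_B sl_smult dual_sl)
  fix b' assume b': "b' \<in> B"
  note c = sl_carrier[OF B_sl[OF b']]
  have "tr (?V * b') = (\<Sum>i<n. \<Sum>j<n. \<Sum>b\<in>B. tr (b * U) * (dual_vector n B b $$ (i, j) * b' $$ (j, i)))"
    by (subst tr_mult[OF mat_carrier c]) (simp add: sum_distrib_right mult.assoc)
  also have "\<dots> = (\<Sum>i<n. \<Sum>b\<in>B. \<Sum>j<n. tr (b * U) * (dual_vector n B b $$ (i, j) * b' $$ (j, i)))"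
    by (subst sum.swap) (rule refl)
  also have "\<dots> = (\<Sum>b\<in>B. \<Sum>i<n. \<Sum>j<n. tr (b * U) * (dual_vector n B b $$ (i, j) * b' $$ (j, i)))"
    by (rule sum.swap)
  also have "\<dots> = (\<Sum>b\<in>B. tr (b * U) * tr (dual_vector n B b * b'))"
    using tr_mult[OF sl_carrier[OF dual_sl] c] by (simp add: sum_distrib_left)
  also have "\<dots> = (\<Sum>b\<in>B. if b = b' then tr (b * U) else 0)"
    using b' by (intro sum.cong) (auto simp: dual_pairing)
  also have "\<dots> = tr (b' * U)" using b' finite_B by simp
  finally show "tr (U * b') = tr (?V * b')" using tr_comm[OF sl_carrier[OF U] c] by simp
qed

text \<open>Pairing with the dual vectors yields the coordinates of U, so the Casimir element is the
  tensor of the identity map.\<close>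

lemma contr_casimir:
  assumes U: "U \<in> sl n"
  shows "contr n (casimir n B) U (i, j) = (if i < n \<and> j < n then U $$ (i, j) else 0)"
proof -
  have "contr n (casimir n B) U (i, j) = (\<Sum>b\<in>B. if i < n \<and> j < n then tr (dual_vector n B b * U) * b $$ (i, j) else 0)"
    unfolding casimir_def contr_sum
    using sl_carrier[OF U] sl_carrier[OF dual_sl] sl_carrier[OF B_sl] by (intro sum.cong refl) (simp add: contr_tensor)
  then show ?thesis using expand_dual[OF U] by (cases "i < n \<and> j < n") auto
qed

lemma sl_tensor_casimir: "sl_tensor n (casimir n B)"
  unfolding casimir_def by (intro sl_tensor_sum sl_tensor_tensor dual_sl)

lemma contr_expand:
  assumes U: "U \<in> sl n"
  shows "contr n T U q = (\<Sum>b\<in>B. tr (b * U) * contr n T (dual_vector n B b) q)"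
proof -
  have "contr n T U q = contr n T (mat n n (\<lambda>p. \<Sum>b\<in>B. tr (b * U) * dual_vector n B b $$ p)) q"
    using expand_basis[OF U] by simp
  also have "\<dots> = (\<Sum>i<n. \<Sum>j<n. \<Sum>b\<in>B. T (i, j) q * (tr (b * U) * dual_vector n B b $$ (j, i)))"
    by (simp add: contr_def sum_distrib_left)
  also have "\<dots> = (\<Sum>b\<in>B. \<Sum>i<n. \<Sum>j<n. T (i, j) q * (tr (b * U) * dual_vector n B b $$ (j, i)))"
    by (subst (2) sum.swap, subst sum.swap) (rule refl)
  also have "\<dots> = (\<Sum>b\<in>B. tr (b * U) * contr n T (dual_vector n B b) q)"
    by (simp add: contr_def sum_distrib_left algebra_simps)
  finally show ?thesis .
qed

text \<open>The shape in which the series of the order presents itself: a basis vector in the first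
  factor, and in the second the image of its dual vector.\<close>

lemma tensor_expand:
  assumes T: "sl_tensor n T"
  shows "T (i, j) q = (if i < n \<and> j < n then \<Sum>b\<in>B. b $$ (i, j) * contr n T (dual_vector n B b) q else 0)"
proof -
  let ?T = "\<lambda>p q. if fst p < n \<and> snd p < n then \<Sum>b\<in>B. b $$ p * contr n T (dual_vector n B b) q else 0"
  have "T = ?T"
  proof (rule tensor_eqI[OF T])
    show "sl_tensor n ?T" unfolding sl_tensor_def
    proof (intro conjI allI impI)
      fix q
      have "(\<Sum>i<n. ?T (i, i) q) = (\<Sum>b\<in>B. (\<Sum>i<n. b $$ (i, i)) * contr n T (dual_vector n B b) q)"
        unfolding sum_distrib_right by (subst sum.swap) simp
      then show "(\<Sum>i<n. ?T (i, i) q) = 0" using sl_sum[OF B_sl] by simp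
    qed auto
    fix U :: "complex mat" and q assume U: "U \<in> sl n"
    have "contr n T U q = (\<Sum>b\<in>B. tr (b * U) * contr n T (dual_vector n B b) q)"
      by (rule contr_expand[OF U])
    also have "\<dots> = (\<Sum>b\<in>B. \<Sum>i<n. \<Sum>j<n. b $$ (i, j) * U $$ (j, i) * contr n T (dual_vector n B b) q)"
      using tr_mult[OF sl_carrier[OF B_sl] sl_carrier[OF U]] by (simp add: sum_distrib_right)
    also have "\<dots> = (\<Sum>i<n. \<Sum>j<n. \<Sum>b\<in>B. b $$ (i, j) * U $$ (j, i) * contr n T (dual_vector n B b) q)"
      by (subst sum.swap, subst (2) sum.swap) (rule refl)
    also have "\<dots> = contr n ?T U q"
      unfolding contr_def[of n ?T] by (intro sum.cong refl) (simp add: sum_distrib_left mult_ac)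
    finally show "contr n T U q = contr n ?T U q" .
  qed
  from fun_cong[OF fun_cong[OF this], of "(i, j)" q] show ?thesis by (simp only: fst_conv snd_conv)
qed

end

section \<open>Contraction of the explicit formula\<close>

lemma diff_swap: "a - b = p - q \<Longrightarrow> a - p = b - q" for a b p q :: complex
proof -
  assume "a - b = p - q"
  then have "a = p - q + b" by (metis diff_add_cancel)
  then show "a - p = b - q" by simp
qed

locale shift_basis = shift c d n + basis n B for c d n B
begin

lemma tau_mat_e:
  assumes "s < n"
  shows "tau_mat n c (e_mat n (s, s)) = e_mat n ((s + c) mod n, (s + c) mod n)"
proof -
  have nc: "n - c = d" using n_eq by simp
  have "(i + d) mod n = s \<longleftrightarrow> i = (s + c) mod n" if "i < n" for i
  proof -
    have "(i + d) mod n = (if i < c then i + d else i - c)" using that by (auto simp: n_eq mod_if)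
    moreover have "(s + c) mod n = (if s < d then s + c else s - d)" by (rule shift_mod[OF assms])
    ultimately show ?thesis using that assms n_eq by auto
  qed
  then show ?thesis
    unfolding tau_mat_def nc by (intro eq_matI) (auto simp: e_mat_index)
qed

lemma tau_mat_pow: "(tau_mat n c ^^ i) (e_mat n (0, 0)) = e_mat n (sg i, sg i)"
  by (induction i) (simp_all add: tau_mat_e sg_Suc)

lemma q_mat_eq: "q_mat n c i = e_mat n (sg i, sg i) - e_mat n (sg (i - 1), sg (i - 1))"
  by (simp only: q_mat_def tau_mat_pow)

lemma f_mat_carrier: "f_mat n c i \<in> carrier_mat n n"
  by (simp add: f_mat_def tau_mat_pow minus_carrier_mat)

lemma f_mat_index: "a < n \<Longrightarrow> b < n \<Longrightarrow> f_mat n c j $$ (a, b) = (if a = b then (if a = sg j then 1 / 2 else 0) 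
    + (if a = sg (j - 1) then 1 / 2 else 0) - 1 / of_nat n else 0)"
  by (simp add: f_mat_def tau_mat_pow e_mat_index)

text \<open>The explicit dual of q_j: the indicator of the tail of the cycle from position j on,
  minus its mean. Along the cycle its diagonal jumps only from position j - 1 to j, by 1, apart from
  the jump at the wrap-around, which no q_i tests.\<close>

definition hq :: "nat \<Rightarrow> complex mat" where
  "hq j = mat n n (\<lambda>(a, b). if a = b then (if a \<in> sg ` {j..<n} then 1 else 0) - of_nat (n - j) / of_nat n else 0)"

lemma sg_image: "a < n \<Longrightarrow> sg a \<in> sg ` {j..<n} \<longleftrightarrow> j \<le> a"
  by (auto simp: sg_inj)

lemma sum_sg_image: "(\<Sum>a<n. if a \<in> sg ` {j..<n} then f a else 0) = (\<Sum>m = j..<n. f (sg m))"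
proof -
  have "(\<Sum>a<n. if a \<in> sg ` {j..<n} then f a else 0) = (\<Sum>a\<in>sg ` {j..<n}. f a)"
    by (subst sum.inter_restrict[symmetric]) (auto intro: sum.cong)
  also have "\<dots> = (\<Sum>m = j..<n. f (sg m))"
    by (subst sum.reindex) (auto simp: inj_on_def sg_inj)
  finally show ?thesis .
qed

lemma hq_sl: "hq j \<in> sl n"
proof (cases "j \<le> n")
  case True
  have "(\<Sum>a<n. hq j $$ (a, a)) = (\<Sum>a<n. if a \<in> sg ` {j..<n} then 1 else 0) - of_nat (n - j)"
    by (simp add: hq_def sum_subtractf)
  also have "\<dots> = 0" unfolding sum_sg_image by simp
  finally show ?thesis by (intro slI) (auto simp: hq_def)
next
  case False
  then show ?thesis by (intro slI) (auto simp: hq_def)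
qed

lemma tr_hq:
  assumes U: "U \<in> sl n"
  shows "tr (hq j * U) = dsum (\<lambda>p. U $$ p) j"
proof -
  have "tr (hq j * U) = (\<Sum>a<n. \<Sum>b<n. if a = b then ((if a \<in> sg ` {j..<n} then U $$ (a, a) else 0) - of_nat (n - j) / of_nat n * U $$ (a, a)) else 0)"
    unfolding tr_mult[OF sl_carrier[OF hq_sl] sl_carrier[OF U]]
    by (intro sum.cong refl) (simp add: hq_def left_diff_distrib)
  also have "\<dots> = (\<Sum>a<n. (if a \<in> sg ` {j..<n} then U $$ (a, a) else 0)) - of_nat (n - j) / of_nat n * (\<Sum>a<n. U $$ (a, a))"
    by (simp add: sum_subtractf sum_distrib_left)
  finally show ?thesis unfolding sum_sg_image using sl_sum[OF U] by (simp add: dsum_def)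
qed

lemma tr_diff_e:
  assumes "h \<in> carrier_mat n n" "a < n" "b < n"
  shows "tr (h * (e_mat n (a, a) - e_mat n (b, b))) = h $$ (a, a) - h $$ (b, b)"
proof -
  have "tr (h * (e_mat n (a, a) - e_mat n (b, b))) = tr ((e_mat n (a, a) - e_mat n (b, b)) * h)"
    using assms by (intro tr_comm[of _ n]) (auto simp: minus_carrier_mat)
  also have "(e_mat n (a, a) - e_mat n (b, b)) * h = e_mat n (a, a) * h - e_mat n (b, b) * h"
    using assms by (intro minus_mult_distrib_mat[of _ n n]) auto
  also have "tr \<dots> = h $$ (a, a) - h $$ (b, b)"
    using assms tr_minus[OF mult_carrier_mat[OF e_mat_carrier assms(1)] mult_carrier_mat[OF e_mat_carrier assms(1)]]
    by (simp add: tr_e_mat)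
  finally show ?thesis .
qed

lemma tr_q_mat: "h \<in> carrier_mat n n \<Longrightarrow> tr (h * q_mat n c i) = h $$ (sg i, sg i) - h $$ (sg (i - 1), sg (i - 1))"
  unfolding q_mat_eq by (rule tr_diff_e) simp_all

lemma tr_hq_q: "1 \<le> i \<Longrightarrow> i < n \<Longrightarrow> 1 \<le> j \<Longrightarrow> tr (hq j * q_mat n c i) = (if i = j then 1 else 0)"
  unfolding tr_q_mat[OF sl_carrier[OF hq_sl]] by (auto simp: hq_def sg_image)

text \<open>Pairing with q_i reads off the difference of two neighbouring entries on the cycle.
  These differences determine a diagonal matrix up to a scalar, which tracelessness removes.\<close>

lemma q_dual_eq:
  assumes j: "1 \<le> j" "j < n"
  shows "q_dual n c j = hq j"
  unfolding q_dual_def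
proof (rule the_equality)
  show "hq j \<in> sl n \<and> diagonal_mat (hq j) \<and> (\<forall>i\<in>{1..n - 1}. tr (hq j * q_mat n c i) = (if i = j then 1 else 0))"
  proof (intro conjI ballI hq_sl)
    show "diagonal_mat (hq j)" by (auto simp: diagonal_mat_def hq_def)
    show "tr (hq j * q_mat n c i) = (if i = j then 1 else 0)" if "i \<in> {1..n - 1}" for i
      using that j by (intro tr_hq_q) auto
  qed
  fix h assume h: "h \<in> sl n \<and> diagonal_mat h \<and> (\<forall>i\<in>{1..n - 1}. tr (h * q_mat n c i) = (if i = j then 1 else 0))"
  then have hc: "h \<in> carrier_mat n n" and hs: "h \<in> sl n" by (auto intro: sl_carrier)
  define D where "D a = h $$ (a, a) - hq j $$ (a, a)" for a
  have D: "D (sg m) = D 0" if "m < n" for m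
    using that
  proof (induction m)
    case (Suc m)
    have "tr (h * q_mat n c (Suc m)) = tr (hq j * q_mat n c (Suc m))"
      using h Suc.prems j by (simp add: tr_hq_q)
    then have "h $$ (sg (Suc m), sg (Suc m)) - h $$ (sg m, sg m) = hq j $$ (sg (Suc m), sg (Suc m)) - hq j $$ (sg m, sg m)"
      unfolding tr_q_mat[OF hc] tr_q_mat[OF sl_carrier[OF hq_sl]] by simp
    then have "D (sg (Suc m)) = D (sg m)" unfolding D_def by (rule diff_swap)
    then show ?case using Suc by simp
  qed simp
  have "(\<Sum>a<n. D a) = 0" using sl_sum[OF hs] sl_sum[OF hq_sl, of j] by (simp add: D_def sum_subtractf)
  then have "(\<Sum>a<n. D (sg a)) = 0" by (simp only: sum_sg)
  then have D0: "D 0 = 0" using D by simp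
  show "h = hq j"
  proof (rule eq_matI)
    fix a b assume "a < dim_row (hq j)" "b < dim_col (hq j)"
    then have ab: "a < n" "b < n" by (simp_all add: hq_def)
    obtain m where m: "m < n" "a = sg m" using ab(1) by (rule sg_cases)
    have "D a = 0" using D[OF m(1)] D0 m by simp
    then show "h $$ (a, b) = hq j $$ (a, b)"
      using h hc ab by (cases "a = b") (auto simp: D_def hq_def diagonal_mat_def)
  qed (use hc in \<open>auto simp: hq_def\<close>)
qed

lemma contr_e:
  assumes "\<alpha> \<in> {..<n} \<times> {..<n}" "\<beta> \<in> {..<n} \<times> {..<n}" "U \<in> carrier_mat n n"
  shows "contr n (e_mat n \<alpha> \<otimes>\<^sub>t e_mat n \<beta>) U q = (if q = \<beta> then U $$ neg_root \<alpha> else 0)"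
  using assms by (cases \<alpha>; cases \<beta>; cases q) (auto simp: contr_tensor tr_e_mat e_mat_index)

lemma contr_e_wedge:
  assumes "\<alpha> \<in> {..<n} \<times> {..<n}" "\<beta> \<in> {..<n} \<times> {..<n}" "U \<in> carrier_mat n n"
  shows "contr n (e_mat n \<alpha> \<and>\<^sub>t e_mat n \<beta>) U q =
    (if q = \<beta> then U $$ neg_root \<alpha> else 0) - (if q = \<alpha> then U $$ neg_root \<beta> else 0)"
  using assms by (simp only: wedge_def contr_minus contr_e)

definition rform :: "complex \<Rightarrow> complex \<Rightarrow> tensor" where
  "rform x y = (1 / 2) \<cdot>\<^sub>t (((y + x) / (y - x)) \<cdot>\<^sub>t casimir n B
          + (\<Sum>\<alpha>\<in>pos_roots n. e_mat n \<alpha> \<and>\<^sub>t e_mat n (neg_root \<alpha>)))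
        + (\<Sum>\<alpha>\<in>pos_roots n.
            (\<Sum>k = 1..p_fun n c \<alpha> - 1. e_mat n ((tau n c ^^ k) \<alpha>) \<and>\<^sub>t e_mat n (neg_root \<alpha>))
            + x \<cdot>\<^sub>t (e_mat n ((tau n c ^^ p_fun n c \<alpha>) \<alpha>) \<otimes>\<^sub>t e_mat n (neg_root \<alpha>))
            - y \<cdot>\<^sub>t (e_mat n (neg_root \<alpha>) \<otimes>\<^sub>t e_mat n ((tau n c ^^ p_fun n c \<alpha>) \<alpha>)))
        + (\<Sum>i = 1..n - 1. q_dual n c i \<otimes>\<^sub>t f_mat n c i)"

lemma neg_root_in: "\<alpha> \<in> pos_roots n \<Longrightarrow> neg_root \<alpha> \<in> {..<n} \<times> {..<n}"
  by (auto simp: pos_roots_def)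

lemma tau_pow_off: "\<alpha> \<in> {..<n} \<times> {..<n} \<Longrightarrow> fst \<alpha> \<noteq> snd \<alpha> \<Longrightarrow> fst ((tau n c ^^ k) \<alpha>) \<noteq> snd ((tau n c ^^ k) \<alpha>)"
proof (induction k)
  case (Suc k)
  then show ?case using tau_neq[of "(tau n c ^^ k) \<alpha>"] tau_pow_in[of \<alpha> k] by (auto simp: mem_Times_iff)
qed simp

lemma off_sl: "\<alpha> \<in> pos_roots n \<Longrightarrow> e_mat n ((tau n c ^^ k) \<alpha>) \<in> sl n"
  using tau_pow_off[of \<alpha> k] e_mat_sl[of "fst ((tau n c ^^ k) \<alpha>)" "snd ((tau n c ^^ k) \<alpha>)" n]
  by (cases \<alpha>) (auto simp: pos_roots_def)

lemma neg_off_sl: "\<alpha> \<in> pos_roots n \<Longrightarrow> e_mat n (neg_root \<alpha>) \<in> sl n"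
  by (cases \<alpha>) (auto simp: pos_roots_def intro: e_mat_sl)

lemma sl_tensor_rform: "sl_tensor n (rform x y)"
proof -
  have 1: "sl_tensor n (e_mat n ((tau n c ^^ k) \<alpha>) \<and>\<^sub>t e_mat n (neg_root \<alpha>))" if "\<alpha> \<in> pos_roots n" for k \<alpha>
    using off_sl[OF that] neg_off_sl[OF that] by (intro sl_tensor_wedge)
  have 2: "sl_tensor n (q_dual n c i \<otimes>\<^sub>t f_mat n c i)" if "i \<in> {1..n - 1}" for i
    using that hq_sl[of i] q_dual_eq[of i] by (intro sl_tensor_tensor) auto
  have 3: "sl_tensor n (e_mat n ((tau n c ^^ k) \<alpha>) \<otimes>\<^sub>t b)" if "\<alpha> \<in> pos_roots n" for k \<alpha> b
    using off_sl[OF that] by (intro sl_tensor_tensor)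
  have 4: "sl_tensor n (e_mat n (neg_root \<alpha>) \<otimes>\<^sub>t b)" if "\<alpha> \<in> pos_roots n" for \<alpha> b
    using neg_off_sl[OF that] by (intro sl_tensor_tensor)
  show ?thesis
    unfolding rform_def by (intro sl_tensor_add sl_tensor_minus sl_tensor_scale sl_tensor_sum sl_tensor_casimir
      1 1[of _ 0, simplified] 2 3 4)
qed

text \<open>\<open>diagY\<close> includes the half of the diagonal that the Casimir term supplies;
  it is subtracted here.\<close>

lemma contr_diag_part:
  assumes U: "U \<in> sl n"
  shows "contr n (\<Sum>i = 1..n - 1. q_dual n c i \<otimes>\<^sub>t f_mat n c i) U (k, l)
    = (if k < n \<and> k = l then diagY (\<lambda>p. U $$ p) k - U $$ (k, k) / 2 else 0)"
proof -
  have "contr n (\<Sum>i = 1..n - 1. q_dual n c i \<otimes>\<^sub>t f_mat n c i) U (k, l)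
    = (\<Sum>i = 1..n - 1. if k < n \<and> k = l then dsum (\<lambda>p. U $$ p) i * ((if k = sg i then 1 / 2 else 0) 
    + (if k = sg (i - 1) then 1 / 2 else 0) - 1 / of_nat n) else 0)"
    unfolding contr_sum
  proof (intro sum.cong refl)
    fix i assume "i \<in> {1..n - 1}"
    then have "q_dual n c i = hq i" by (intro q_dual_eq) auto
    then show "contr n (q_dual n c i \<otimes>\<^sub>t f_mat n c i) U (k, l) = (if k < n \<and> k = l then dsum (\<lambda>p. U $$ p) i * ((if k = sg i then 1 / 2 else 0) 
    + (if k = sg (i - 1) then 1 / 2 else 0) - 1 / of_nat n) else 0)"
      using contr_tensor[OF sl_carrier[OF hq_sl] f_mat_carrier sl_carrier[OF U], of i i "(k, l)"] 
      by (cases "k < n \<and> l < n") (auto simp: tr_hq[OF U] f_mat_index)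
  qed
  then show ?thesis by (cases "k < n \<and> k = l") (auto simp: diagY_def)
qed

lemma contr_wedge_part:
  assumes U: "U \<in> carrier_mat n n"
  shows "contr n (\<Sum>\<alpha>\<in>pos_roots n. e_mat n \<alpha> \<and>\<^sub>t e_mat n (neg_root \<alpha>)) U q
    = (if neg_root q \<in> pos_roots n then U $$ q else 0) - (if q \<in> pos_roots n then U $$ q else 0)"
proof -
  have "contr n (\<Sum>\<alpha>\<in>pos_roots n. e_mat n \<alpha> \<and>\<^sub>t e_mat n (neg_root \<alpha>)) U q
    = (\<Sum>\<alpha>\<in>pos_roots n. (if \<alpha> = neg_root q then U $$ q else 0) - (if \<alpha> = q then U $$ q else 0))"
    unfolding contr_sum
  proof (intro sum.cong refl)
    fix \<alpha> assume \<alpha>: "\<alpha> \<in> pos_roots n"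
    show "contr n (e_mat n \<alpha> \<and>\<^sub>t e_mat n (neg_root \<alpha>)) U q = (if \<alpha> = neg_root q then U $$ q else 0) - (if \<alpha> = q then U $$ q else 0)"
      unfolding contr_e_wedge[OF pos_roots_in[OF \<alpha>] neg_root_in[OF \<alpha>] U] by (auto simp: neg_root_eq_iff)
  qed
  then show ?thesis by (simp add: sum_subtractf)
qed

text \<open>Splits \<open>chainS\<close> by the end of the path: the wedge terms of the formula (k
  below \<open>p_fun\<close>) end in positive roots, while the term with factor y ends in the first
  root that is no longer positive. Hence \<open>S1\<close> and \<open>S2\<close> live on opposite
  halves and give the constant and the y-part.\<close>

definition S1 :: "(nat \<times> nat \<Rightarrow> complex) \<Rightarrow> nat \<times> nat \<Rightarrow> complex" where
  "S1 G q = (\<Sum>\<alpha>\<in>pos_roots n. \<Sum>k = 1..p_fun n c \<alpha> - 1. if q = (tau n c ^^ k) \<alpha> then G \<alpha> else 0)"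

definition S2 :: "(nat \<times> nat \<Rightarrow> complex) \<Rightarrow> nat \<times> nat \<Rightarrow> complex" where
  "S2 G q = (\<Sum>\<alpha>\<in>pos_roots n. if q = (tau n c ^^ p_fun n c \<alpha>) \<alpha> then G \<alpha> else 0)"

lemma chainS_split: "chainS G q = S1 G q + S2 G q"
  unfolding chainS_def S1_def S2_def sum.distrib[symmetric]
proof (intro sum.cong refl)
  fix \<alpha> assume "\<alpha> \<in> pos_roots n"
  then obtain m where "p_fun n c \<alpha> = Suc m" using p_fun_ge by (metis Suc_le_D One_nat_def)
  then show "(\<Sum>k = 1..p_fun n c \<alpha>. if (tau n c ^^ k) \<alpha> = q then G \<alpha> else 0)
    = (\<Sum>k = 1..p_fun n c \<alpha> - 1. if q = (tau n c ^^ k) \<alpha> then G \<alpha> else 0) 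
      + (if q = (tau n c ^^ p_fun n c \<alpha>) \<alpha> then G \<alpha> else 0)"
    by (simp add: eq_commute[of q] del: funpow.simps)
qed

lemma S1_zero: "q \<notin> pos_roots n \<Longrightarrow> S1 G q = 0"
  unfolding S1_def
proof (intro sum.neutral ballI)
  fix \<alpha> k assume "q \<notin> pos_roots n" "\<alpha> \<in> pos_roots n" "k \<in> {1..p_fun n c \<alpha> - 1}"
  then show "(if q = (tau n c ^^ k) \<alpha> then G \<alpha> else 0) = 0"
    using p_fun_below[of \<alpha> k] by auto
qed

lemma S2_zero: "neg_root q \<notin> pos_roots n \<Longrightarrow> S2 G q = 0"
  unfolding S2_def
proof (intro sum.neutral ballI)
  fix \<alpha> assume q: "neg_root q \<notin> pos_roots n" and \<alpha>: "\<alpha> \<in> pos_roots n"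
  have "fst \<alpha> \<noteq> snd \<alpha>" using \<alpha> by (auto simp: pos_roots_def)
  then have "q \<noteq> (tau n c ^^ p_fun n c \<alpha>) \<alpha>"
    using q p_fun_not_pos[OF \<alpha>] tau_pow_in[OF pos_roots_in[OF \<alpha>], of "p_fun n c \<alpha>"] 
      tau_pow_off[OF pos_roots_in[OF \<alpha>], of "p_fun n c \<alpha>"]
    by (cases q) (auto simp: pos_roots_def)
  then show "(if q = (tau n c ^^ p_fun n c \<alpha>) \<alpha> then G \<alpha> else 0) = 0" by simp
qed

text \<open>The tensors whose second factor is e_{-\<alpha>} read U at the negatives of the shifted
  roots and assemble to \<open>chainT\<close>, ending with x U. Those whose first factor is
  e_{-\<alpha>} read U at \<alpha> and place it along the chain, which gives the sums with a minus
  sign.\<close>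

lemma contr_chain_part:
  assumes U: "U \<in> carrier_mat n n"
  shows "contr n (\<Sum>\<alpha>\<in>pos_roots n.
            (\<Sum>k = 1..p_fun n c \<alpha> - 1. e_mat n ((tau n c ^^ k) \<alpha>) \<and>\<^sub>t e_mat n (neg_root \<alpha>))
            + x \<cdot>\<^sub>t (e_mat n ((tau n c ^^ p_fun n c \<alpha>) \<alpha>) \<otimes>\<^sub>t e_mat n (neg_root \<alpha>))
            - y \<cdot>\<^sub>t (e_mat n (neg_root \<alpha>) \<otimes>\<^sub>t e_mat n ((tau n c ^^ p_fun n c \<alpha>) \<alpha>))) U q
    = (if neg_root q \<in> pos_roots n then chainT (\<lambda>p. U $$ p) (\<lambda>p. x * U $$ p) (neg_root q) else 0)
      - S1 (\<lambda>p. U $$ p) q - y * S2 (\<lambda>p. U $$ p) q" (is "contr n (\<Sum>\<alpha>\<in>_. ?t \<alpha>) U q = _")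
proof -
  let ?G = "\<lambda>p. U $$ p"
  have "contr n (\<Sum>\<alpha>\<in>pos_roots n. ?t \<alpha>) U q
    = (\<Sum>\<alpha>\<in>pos_roots n. (if \<alpha> = neg_root q then chainT ?G (\<lambda>p. x * U $$ p) \<alpha> else 0)
        - (\<Sum>k = 1..p_fun n c \<alpha> - 1. if q = (tau n c ^^ k) \<alpha> then U $$ \<alpha> else 0)
        - y * (if q = (tau n c ^^ p_fun n c \<alpha>) \<alpha> then U $$ \<alpha> else 0))"
    unfolding contr_sum
  proof (intro sum.cong refl)
    fix \<alpha> assume \<alpha>: "\<alpha> \<in> pos_roots n"
    note i = pos_roots_in[OF \<alpha>] and j = neg_root_in[OF \<alpha>]
    have eq: "q = neg_root \<alpha> \<longleftrightarrow> \<alpha> = neg_root q" by (auto simp: neg_root_eq_iff)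
    show "contr n (?t \<alpha>) U q = (if \<alpha> = neg_root q then chainT ?G (\<lambda>p. x * U $$ p) \<alpha> else 0)
        - (\<Sum>k = 1..p_fun n c \<alpha> - 1. if q = (tau n c ^^ k) \<alpha> then U $$ \<alpha> else 0)
        - y * (if q = (tau n c ^^ p_fun n c \<alpha>) \<alpha> then U $$ \<alpha> else 0)"
      unfolding contr_add contr_minus contr_scale contr_sum contr_e_wedge[OF tau_pow_in[OF i] j U]
        contr_e[OF tau_pow_in[OF i] j U] contr_e[OF j tau_pow_in[OF i] U] eq neg_root_neg_root
      by (simp add: sum_subtractf chainT_def)
  qed
  also have "\<dots> = (if neg_root q \<in> pos_roots n then chainT ?G (\<lambda>p. x * U $$ p) (neg_root q) else 0)
      - S1 ?G q - y * S2 ?G q"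
    by (simp add: sum_subtractf S1_def S2_def sum_distrib_left if_distrib[of "\<lambda>z. y * z"] cong: if_cong)
  finally show ?thesis .
qed

text \<open>With (y + x)/(y - x) = 2x/(y - x) + 1, the summand 1 and the wedge sum over the positive
  roots combine: the halves of U cancel on positive roots, add up to U on negative roots and leave
  U/2 on the diagonal. This is the asymmetry visible in \<open>X0\<close>.\<close>

lemma contr_rform:
  assumes U: "U \<in> sl n" and xy: "x \<noteq> y"
  shows "contr n (rform x y) U (k, l) = (if k < n \<and> l < n then x / (y - x) * U $$ (k, l)
     + X0 (\<lambda>p. U $$ p) (\<lambda>p. x * U $$ p) (k, l) + y * X1 (\<lambda>p. U $$ p) (k, l) else 0)"
proof -
  let ?q = "(k, l)" and ?G = "\<lambda>p. U $$ p"
  note Uc = sl_carrier[OF U]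
  have E: "contr n (rform x y) U ?q = 1 / 2 * ((y + x) / (y - x) * (if k < n \<and> l < n then U $$ (k, l) else 0)
      + ((if neg_root ?q \<in> pos_roots n then U $$ ?q else 0) - (if ?q \<in> pos_roots n then U $$ ?q else 0)))
      + ((if neg_root ?q \<in> pos_roots n then chainT ?G (\<lambda>p. x * U $$ p) (neg_root ?q) else 0)
      - S1 ?G ?q - y * S2 ?G ?q) + (if k < n \<and> k = l then diagY ?G k - U $$ (k, k) / 2 else 0)"
    unfolding rform_def
    by (simp only: contr_add contr_scale contr_casimir[OF U] contr_wedge_part[OF Uc] contr_chain_part[OF Uc] contr_diag_part[OF U])
  define w where "w = x / (y - x)"
  have w: "(y + x) / (y - x) = 2 * w + 1" using xy by (simp add: w_def field_simps)
  show ?thesis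
  proof (cases "k < n \<and> l < n")
    case False
    then have e: "(k < n \<and> l < n) = False" "(k < n \<and> k = l) = False" "((k, l) \<in> pos_roots n) = False" 
      "((l, k) \<in> pos_roots n) = False" by (auto simp: pos_roots_def)
    show ?thesis unfolding E by (simp only: e neg_root_pair S1_zero S2_zero if_False not_False_eq_True) simp
  next
    case True
    then have e: "(k < n \<and> l < n) = True" by simp
    from True have "?q \<in> {..<n} \<times> {..<n}" by simp
    then show ?thesis
    proof (cases rule: pos_cases)
      case 1
      then have e': "(k < n \<and> k = l) = False" "((k, l) \<in> pos_roots n) = True" 
        "((l, k) \<in> pos_roots n) = False" by (auto simp: pos_roots_def)
      show ?thesis unfolding E X0_def X1_def chainS_split w w_def[symmetric]
        by (simp only: e e' neg_root_pair S2_zero if_False if_True not_False_eq_True) (simp add: algebra_simps)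
    next
      case 2
      then have e': "(k < n \<and> k = l) = False" "((k, l) \<in> pos_roots n) = False" 
        "((l, k) \<in> pos_roots n) = True" by (auto simp: pos_roots_def)
      show ?thesis unfolding E X0_def X1_def chainS_split w w_def[symmetric]
        by (simp only: e e' neg_root_pair S1_zero if_False if_True not_False_eq_True) (simp add: algebra_simps)
    next
      case (3 i)
      then have e': "k = i" "l = i" "(i < n \<and> i = i) = True" "((i, i) \<in> pos_roots n) = False" 
        by (auto simp: pos_roots_def)
      show ?thesis unfolding E X0_def X1_def chainS_split w w_def[symmetric]
        by (simp only: e e' neg_root_pair S1_zero S2_zero if_False if_True not_False_eq_True fst_conv) 
          (simp add: 3 algebra_simps)
    qed
  qed
qed

end

section \<open>The polynomial description of the sections\<close>

context shift begin

lemma sharp_carrier: "M \<in> carrier_mat n n \<Longrightarrow> sharp c M \<in> carrier_mat n n"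
  using n_eq by (auto simp: sharp_def split_block_def Let_def four_block_mat_def)

lemma sharp_index:
  assumes "M \<in> carrier_mat n n" "i < n" "j < n"
  shows "sharp c M $$ (i, j) = M $$ tau n c (i, j)"
proof -
  have "tau n c (i, j) = (if i < d then i + c else i - d, if j < d then j + c else j - d)"
    using assms by (simp add: tau_pair shift_mod)
  then show ?thesis using assms n_eq
    by (auto simp: sharp_def split_block_def Let_def four_block_mat_def add.commute)
qed

lemma cd_eq: "c + d = n" and sub_less: "i < n \<Longrightarrow> \<not> i < c \<Longrightarrow> i - c < d"
  using n_eq by auto

text \<open>\<open>A\<close> is the leading matrix and \<open>C\<close> the free block C_1. The
  constant terms are those of -x times the shifted leading matrix. In the upper right block the
  leading and the constant matrix share the entry B, whence the side condition on \<open>A\<close>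
  in the next two lemmas.\<close>

definition sol_mat :: "(nat \<times> nat \<Rightarrow> complex) \<Rightarrow> (nat \<times> nat \<Rightarrow> complex) \<Rightarrow> complex \<Rightarrow> complex poly mat" where
  "sol_mat A C x = mat n n (\<lambda>q. if q \<in> UR then [:A q:]
     else if q \<in> LL then [:- x * A (tau n c q), C q, A q:] else [:- x * A (tau n c q), A q:])"

lemma sol_mat_diag: "i < n \<Longrightarrow> sol_mat A C x $$ (i, i) = [:- x * A (tau n c (i, i)), A (i, i):]"
  by (auto simp: sol_mat_def UR_def LL_def)

lemma Sol_imp:
  assumes F: "F \<in> Sol c d x"
  obtains A C where "F = sol_mat A C x" "\<And>q. q \<in> UR \<Longrightarrow> A q = - x * A (tau n c q)" "(\<Sum>i<n. A (i, i)) = 0"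
proof -
  obtain A0 A1 B C0 C1 C2 D0 D1 where car: "A0 \<in> carrier_mat c c" "A1 \<in> carrier_mat c c" "B \<in> carrier_mat c d"
     "C0 \<in> carrier_mat d c" "C1 \<in> carrier_mat d c" "C2 \<in> carrier_mat d c" "D0 \<in> carrier_mat d d" "D1 \<in> carrier_mat d d"
    and F_eq: "F = four_block_mat
           (poly_mat A0 + [:0, 1:] \<cdot>\<^sub>m poly_mat A1) (poly_mat B)
           (poly_mat C0 + [:0, 1:] \<cdot>\<^sub>m poly_mat C1 + [:0, 1:]\<^sup>2 \<cdot>\<^sub>m poly_mat C2)
           (poly_mat D0 + [:0, 1:] \<cdot>\<^sub>m poly_mat D1)"
    and M0: "four_block_mat A0 B C0 D0 = (- x) \<cdot>\<^sub>m sharp c (four_block_mat A1 B C2 D1)"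
    and F_sl: "F \<in> sl n"
    using F unfolding Sol_def n_eq by auto
  let ?M = "four_block_mat A1 B C2 D1"
  define A where "A q = ?M $$ q" for q
  define C where "C q = C1 $$ (fst q - c, snd q)" for q
  have Mc: "?M \<in> carrier_mat n n" using car by (auto simp: n_eq)
  have M0_index: "four_block_mat A0 B C0 D0 $$ (i, j) = - x * A (tau n c (i, j))" if "i < n" "j < n" for i j
    using that sharp_carrier[OF Mc] sharp_index[OF Mc that] unfolding M0 A_def by simp
  have "F = sol_mat A C x"
  proof (rule eq_matI)
    fix i j assume "i < dim_row (sol_mat A C x)" "j < dim_col (sol_mat A C x)"
    then have ij: "i < n" "j < n" by (auto simp: sol_mat_def)
    show "F $$ (i, j) = sol_mat A C x $$ (i, j)"
      using M0_index[OF ij] ij car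
      by (auto simp: F_eq sol_mat_def UR_def LL_def A_def C_def poly_mat_def power2_eq_square cd_eq sub_less)
  qed (use car in \<open>auto simp: F_eq sol_mat_def poly_mat_def cd_eq\<close>)
  moreover have "A q = - x * A (tau n c q)" if q: "q \<in> UR" for q
  proof -
    obtain i j where ij: "q = (i, j)" "i < c" "c \<le> j" "j < n" using q by (auto simp: UR_def)
    then have "i < n" using c_less by simp
    from M0_index[OF this ij(4)] show ?thesis using ij car by (auto simp: A_def cd_eq)
  qed
  moreover have "(\<Sum>i<n. A (i, i)) = 0"
  proof -
    \<comment> \<open>On the diagonal, A is the coefficient of z, so its trace is the linear
      coefficient of the trace of F.\<close>
    have "coeff (\<Sum>i<n. F $$ (i, i)) 1 = 0" using sl_sum[OF F_sl] by simp
    then show ?thesis unfolding \<open>F = sol_mat A C x\<close> by (simp add: coeff_sum sol_mat_diag)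
  qed
  ultimately show ?thesis by (rule that)
qed

lemma sol_mat_Sol:
  assumes UR: "\<And>q. q \<in> UR \<Longrightarrow> A q = - x * A (tau n c q)" and tr0: "(\<Sum>i<n. A (i, i)) = 0"
  shows "sol_mat A C x \<in> Sol c d x"
proof -
  define A0 where "A0 = mat c c (\<lambda>(i, j). - x * A (tau n c (i, j)))"
  define A1 where "A1 = mat c c (\<lambda>(i, j). A (i, j))"
  define B where "B = mat c d (\<lambda>(i, j). A (i, j + c))"
  define C0 where "C0 = mat d c (\<lambda>(i, j). - x * A (tau n c (i + c, j)))"
  define C1 where "C1 = mat d c (\<lambda>(i, j). C (i + c, j))"
  define C2 where "C2 = mat d c (\<lambda>(i, j). A (i + c, j))"
  define D0 where "D0 = mat d d (\<lambda>(i, j). - x * A (tau n c (i + c, j + c)))"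
  define D1 where "D1 = mat d d (\<lambda>(i, j). A (i + c, j + c))"
  note defs = A0_def A1_def B_def C0_def C1_def C2_def D0_def D1_def
  let ?M = "four_block_mat A1 B C2 D1"
  have Mc: "?M \<in> carrier_mat n n" by (auto simp: n_eq defs)
  have M: "?M = mat n n A"
    by (rule eq_matI) (auto simp: defs cd_eq sub_less)
  have "four_block_mat A0 B C0 D0 = (- x) \<cdot>\<^sub>m sharp c ?M"
  proof (rule eq_matI)
    fix i j assume "i < dim_row ((- x) \<cdot>\<^sub>m sharp c ?M)" "j < dim_col ((- x) \<cdot>\<^sub>m sharp c ?M)"
    then have ij: "i < n" "j < n" using sharp_carrier[OF Mc] by auto
    have "tau n c (i, j) \<in> {..<n} \<times> {..<n}" by (rule tau_in)
    then have "sharp c ?M $$ (i, j) = A (tau n c (i, j))" 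
      using sharp_index[OF Mc ij] unfolding M by (cases "tau n c (i, j)") auto
    moreover have "(i, j) \<in> UR \<longleftrightarrow> i < c \<and> c \<le> j" using ij by (auto simp: UR_def)
    ultimately show "four_block_mat A0 B C0 D0 $$ (i, j) = ((- x) \<cdot>\<^sub>m sharp c ?M) $$ (i, j)"
      using ij UR[of "(i, j)"] sharp_carrier[OF Mc] by (auto simp: defs cd_eq sub_less)
  qed (use sharp_carrier[OF Mc] in \<open>auto simp: defs cd_eq\<close>)
  moreover have "sol_mat A C x = four_block_mat
           (poly_mat A0 + [:0, 1:] \<cdot>\<^sub>m poly_mat A1) (poly_mat B)
           (poly_mat C0 + [:0, 1:] \<cdot>\<^sub>m poly_mat C1 + [:0, 1:]\<^sup>2 \<cdot>\<^sub>m poly_mat C2)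
           (poly_mat D0 + [:0, 1:] \<cdot>\<^sub>m poly_mat D1)" (is "_ = ?F")
  proof (rule eq_matI)
    fix i j assume "i < dim_row ?F" "j < dim_col ?F"
    then have ij: "i < n" "j < n" by (auto simp: defs poly_mat_def cd_eq)
    then show "sol_mat A C x $$ (i, j) = ?F $$ (i, j)"
      by (auto simp: sol_mat_def UR_def LL_def defs poly_mat_def power2_eq_square cd_eq sub_less)
  qed (auto simp: defs poly_mat_def cd_eq sol_mat_def)
  moreover have "sol_mat A C x \<in> sl n"
  proof (rule slI)
    have "(\<Sum>i<n. - x * A (tau n c (i, i))) = 0" using tr0 sum_tau_diag[of A] by (simp add: sum_distrib_left[symmetric] sum_negf)
    then show "(\<Sum>i<n. sol_mat A C x $$ (i, i)) = 0"
    proof (intro poly_eqI)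
      fix k
      consider "k = 0" | "k = 1" | m where "k = Suc (Suc m)" by (metis One_nat_def not0_implies_Suc)
      then show "coeff (\<Sum>i<n. sol_mat A C x $$ (i, i)) k = coeff 0 k"
        using tr0 \<open>(\<Sum>i<n. - x * A (tau n c (i, i))) = 0\<close> by cases (simp_all add: coeff_sum sol_mat_diag)
    qed
  qed (simp add: sol_mat_def)
  moreover have "A0 \<in> carrier_mat c c" "A1 \<in> carrier_mat c c" "B \<in> carrier_mat c d"
     "C0 \<in> carrier_mat d c" "C1 \<in> carrier_mat d c" "C2 \<in> carrier_mat d c" "D0 \<in> carrier_mat d d" "D1 \<in> carrier_mat d d"
    by (simp_all add: defs)
  ultimately show ?thesis unfolding Sol_def n_eq by blast
qed

lemma Sol_sl: "F \<in> Sol c d x \<Longrightarrow> F \<in> sl n"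
  by (simp add: Sol_def n_eq)

definition mat_at :: "complex \<Rightarrow> complex poly mat \<Rightarrow> complex mat" where
  "mat_at x F = map_mat (\<lambda>p. poly p x) F"

lemma mat_at_sl: "F \<in> sl n \<Longrightarrow> mat_at x F \<in> sl n"
proof (rule slI)
  assume F: "F \<in> sl n"
  have "poly (\<Sum>i<n. F $$ (i, i)) x = 0" using sl_sum[OF F] by simp
  then show "(\<Sum>i<n. mat_at x F $$ (i, i)) = 0" using sl_carrier[OF F] by (auto simp: mat_at_def poly_sum)
qed (auto simp: mat_at_def sl_def)

text \<open>F satisfies the system with right-hand sides U and x U, so F is determined by its value
  at x. The identity says that the quotient of F(y) - F(x) by y - x is X0 + y X1.\<close>

lemma Sol_eval:
  assumes F: "F \<in> Sol c d x" and x: "x \<noteq> 0" "x \<noteq> y" and ij: "i < n" "j < n"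
  defines "U \<equiv> (1 / x) \<cdot>\<^sub>m mat_at x F"
  shows "poly (F $$ (i, j)) y / (y - x) = x / (y - x) * U $$ (i, j)
     + X0 (\<lambda>p. U $$ p) (\<lambda>p. x * U $$ p) (i, j) + y * X1 (\<lambda>p. U $$ p) (i, j)"
proof -
  obtain A C where F_eq: "F = sol_mat A C x" and A_UR: "\<And>q. q \<in> UR \<Longrightarrow> A q = - x * A (tau n c q)"
    and A_tr: "(\<Sum>i<n. A (i, i)) = 0" using F by (rule Sol_imp) blast
  let ?G = "\<lambda>p. U $$ p"
  have U_sl: "U \<in> sl n" unfolding U_def by (intro sl_smult mat_at_sl Sol_sl[OF F])
  have U: "x * U $$ q = poly (F $$ q) x" if "q \<in> {..<n} \<times> {..<n}" for q
    using that x by (cases q) (auto simp: U_def F_eq mat_at_def sol_mat_def)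
  have Fq: "F $$ q = (if q \<in> UR then [:A q:]
     else if q \<in> LL then [:- x * A (tau n c q), C q, A q:] else [:- x * A (tau n c q), A q:])"
     if "q \<in> {..<n} \<times> {..<n}" for q
    using that by (cases q) (auto simp: F_eq sol_mat_def)
  have nUL: "q \<notin> LL" if "q \<in> UR" for q using that by (auto simp: UR_def LL_def)
  have sys: "system ?G (\<lambda>p. x * U $$ p) A"
    unfolding system_def
  proof (intro conjI ballI impI A_tr)
    fix q assume q: "q \<in> {..<n} \<times> {..<n}" "q \<notin> UR" "q \<notin> LL"
    have "x * (A q - A (tau n c q)) = x * U $$ q" using q by (simp add: U Fq algebra_simps)
    then show "A q - A (tau n c q) = U $$ q" using x by simp
  next
    fix q assume q: "q \<in> UR"
    note qn = pos_roots_in[OF UR_pos[OF q]]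
    show "A q = x * U $$ q" using q qn by (simp add: U Fq)
    then have "x * (- A (tau n c q)) = x * U $$ q" using A_UR[OF q] by simp
    then have "- A (tau n c q) = U $$ q" by (simp only: mult_left_cancel[OF x(1)])
    then show "A (tau n c q) = - U $$ q" by (rule minus_equation_iff[THEN iffD1, symmetric])
  qed
  have G0: "(\<Sum>i<n. ?G (i, i)) = 0" by (rule sl_sum[OF U_sl])
  let ?q = "(i, j)"
  have q: "?q \<in> {..<n} \<times> {..<n}" using ij by simp
  note uniq = system_unique[OF sys G0 q]
  have yx: "y - x \<noteq> 0" using x by simp
  have dist: "(y - x) * (x / (y - x) * g + r) = x * g + (y - x) * r" for g r
    using yx by (simp add: distrib_left)
  consider "?q \<in> UR" | "?q \<in> LL" "?q \<notin> UR" | "?q \<notin> UR" "?q \<notin> LL" by blast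
  then show ?thesis
  proof cases
    case 1
    have "poly (F $$ ?q) y = x * U $$ ?q" using 1 U[OF q] Fq[OF q] by simp
    then show ?thesis using 1 by (simp add: X0_UR X1_notLL nUL)
  next
    case 2
    have X: "A ?q = X1 ?G ?q" "A (tau n c ?q) = X0 ?G (\<lambda>p. x * U $$ p) ?q - U $$ ?q" 
      using uniq(2,3)[OF 2(1)] by (auto simp: eq_diff_eq add.commute)
    define a where "a = X1 ?G ?q"
    define t where "t = X0 ?G (\<lambda>p. x * U $$ p) ?q"
    define g where "g = U $$ ?q"
    \<comment> \<open>In the lower left block F(x) = x U is the only equation involving the middle
      coefficient, and it determines \<open>C\<close> after division by x.\<close>
    have "x * g = x * (- (t - g) + C ?q + x * a)" using U[OF q] 2 unfolding Fq[OF q] X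
      by (simp add: algebra_simps a_def t_def g_def)
    then have "g = - (t - g) + C ?q + x * a" by (simp only: mult_left_cancel[OF x(1)])
    then have C: "C ?q = t - x * a" by (simp add: algebra_simps)
    have "poly (F $$ ?q) y = - x * (t - g) + y * (t - x * a) + y * y * a"
      using 2 unfolding Fq[OF q] X C by (simp add: algebra_simps a_def t_def g_def)
    also have "\<dots> = (y - x) * (x / (y - x) * g + (t + y * a))"
      unfolding dist by (simp add: algebra_simps)
    finally show ?thesis using yx by (simp add: a_def t_def g_def)
  next
    case 3
    define t where "t = X0 ?G (\<lambda>p. x * U $$ p) ?q"
    define g where "g = U $$ ?q"
    have A: "A ?q = t" using uniq(1) 3 by (simp add: t_def)
    have A': "A (tau n c ?q) = t - g" using system_diag[OF sys q 3] A by (simp add: g_def)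
    have "poly (F $$ ?q) y = - x * (t - g) + y * t"
      using 3 unfolding Fq[OF q] A' A by simp
    also have "\<dots> = (y - x) * (x / (y - x) * g + t)"
      unfolding dist by (simp add: algebra_simps)
    finally show ?thesis using yx 3 by (simp add: t_def g_def X1_notLL)
  qed
qed

text \<open>Solvability of the system makes the residue map onto: every traceless matrix arises as
  F(x)/x.\<close>

lemma Sol_surj:
  assumes U: "U \<in> sl n" and x: "x \<noteq> 0"
  obtains F where "F \<in> Sol c d x" "mat_at x F = x \<cdot>\<^sub>m U"
proof -
  let ?G = "\<lambda>p. U $$ p"
  define A where "A q = (if q \<in> UR then x * U $$ q else if q \<in> LL then X1 ?G q else X0 ?G (\<lambda>p. x * U $$ p) q)" for q
  \<comment> \<open>Chosen to make the lower left entries right: -x A(\<tau> q) + x C(q) + x^2 A(q)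
    = x U(q).\<close>
  define C where "C q = U $$ q + A (tau n c q) - x * A q" for q
  have sys: "system ?G (\<lambda>p. x * U $$ p) A"
    using system_exists[OF sl_sum[OF U], of "\<lambda>p. x * U $$ p"] unfolding A_def .
  have "sol_mat A C x \<in> Sol c d x"
  proof (rule sol_mat_Sol[OF _ system_sum[OF sys]])
    fix q assume "q \<in> UR"
    then show "A q = - x * A (tau n c q)" using system_UR[OF sys] system_UR'[OF sys] by simp
  qed
  moreover have "mat_at x (sol_mat A C x) = x \<cdot>\<^sub>m U"
  proof (rule eq_matI)
    fix i j assume "i < dim_row (x \<cdot>\<^sub>m U)" "j < dim_col (x \<cdot>\<^sub>m U)"
    then have ij: "i < n" "j < n" using sl_carrier[OF U] by auto
    then have q: "(i, j) \<in> {..<n} \<times> {..<n}" by simp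
    consider "(i, j) \<in> UR" | "(i, j) \<in> LL" "(i, j) \<notin> UR" | "(i, j) \<notin> UR" "(i, j) \<notin> LL" by blast
    then show "mat_at x (sol_mat A C x) $$ (i, j) = (x \<cdot>\<^sub>m U) $$ (i, j)"
    proof cases
      case 1
      then show ?thesis using ij sl_carrier[OF U] system_UR'[OF sys 1] by (simp add: mat_at_def sol_mat_def)
    next
      case 2
      then show ?thesis using ij sl_carrier[OF U] by (simp add: mat_at_def sol_mat_def C_def algebra_simps)
    next
      case 3
      then show ?thesis using ij sl_carrier[OF U] system_diag[OF sys q 3] 
        by (simp add: mat_at_def sol_mat_def algebra_simps)
    qed
  qed (use sl_carrier[OF U] in \<open>auto simp: mat_at_def sol_mat_def\<close>)
  ultimately show ?thesis by (rule that)
qed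

end

section \<open>Lie algebra monomorphisms preserve the trace form\<close>

definition lin_op :: "nat \<Rightarrow> (complex mat \<Rightarrow> complex mat) \<Rightarrow> bool" where
  "lin_op n L \<longleftrightarrow> (\<forall>A\<in>carrier_mat n n. L A \<in> carrier_mat n n) \<and>
     (\<forall>A\<in>carrier_mat n n. \<forall>B\<in>carrier_mat n n. L (A + B) = L A + L B) \<and>
     (\<forall>s. \<forall>A\<in>carrier_mat n n. L (s \<cdot>\<^sub>m A) = s \<cdot>\<^sub>m L A)"

definition op_trace :: "nat \<Rightarrow> (complex mat \<Rightarrow> complex mat) \<Rightarrow> complex" where
  "op_trace n L = (\<Sum>r\<in>{..<n} \<times> {..<n}. L (e_mat n r) $$ r)"

lemma lin_op_carrier: "lin_op n L \<Longrightarrow> A \<in> carrier_mat n n \<Longrightarrow> L A \<in> carrier_mat n n"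
  and lin_op_add: "lin_op n L \<Longrightarrow> A \<in> carrier_mat n n \<Longrightarrow> B \<in> carrier_mat n n \<Longrightarrow> L (A + B) = L A + L B"
  and lin_op_smult: "lin_op n L \<Longrightarrow> A \<in> carrier_mat n n \<Longrightarrow> L (s \<cdot>\<^sub>m A) = s \<cdot>\<^sub>m L A"
  unfolding lin_op_def by blast+

lemma lin_op_zero: "lin_op n L \<Longrightarrow> L (0\<^sub>m n n) = 0\<^sub>m n n"
proof -
  assume L: "lin_op n L"
  have "0 \<cdot>\<^sub>m 0\<^sub>m n n = (0\<^sub>m n n :: complex mat)" by (intro eq_matI) auto
  then have "L (0\<^sub>m n n) = 0 \<cdot>\<^sub>m L (0\<^sub>m n n)" using lin_op_smult[OF L, of "0\<^sub>m n n" 0] by simp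
  also have "\<dots> = 0\<^sub>m n n" using lin_op_carrier[OF L, of "0\<^sub>m n n"] by (intro eq_matI) auto
  finally show ?thesis .
qed

lemma lin_op_sum:
  assumes L: "lin_op n L" and "finite I" and f: "\<And>i. i \<in> I \<Longrightarrow> f i \<in> carrier_mat n n"
  shows "L (mat n n (\<lambda>r. \<Sum>i\<in>I. s i * f i $$ r)) = mat n n (\<lambda>r. \<Sum>i\<in>I. s i * L (f i) $$ r)"
  using assms(2,3)
proof (induction I rule: finite_induct)
  case empty
  have "mat n n (\<lambda>r. \<Sum>i\<in>{}. s i * g i $$ r) = 0\<^sub>m n n" for g :: "_ \<Rightarrow> complex mat" by (intro eq_matI) auto
  then show ?case using lin_op_zero[OF L] by simp
next
  case (insert i I)
  let ?M = "\<lambda>g. mat n n (\<lambda>r. \<Sum>i\<in>I. s i * g i $$ r)"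
  have fi: "f i \<in> carrier_mat n n" using insert by auto
  have split: "mat n n (\<lambda>r. \<Sum>i\<in>insert i I. s i * g i $$ r) = s i \<cdot>\<^sub>m g i + ?M g" 
    if "g i \<in> carrier_mat n n" for g
    using insert that by (intro eq_matI) auto
  have "L (s i \<cdot>\<^sub>m f i + ?M f) = s i \<cdot>\<^sub>m L (f i) + L (?M f)"
    using lin_op_add[OF L, of "s i \<cdot>\<^sub>m f i" "?M f"] lin_op_smult[OF L fi] fi by simp
  also have "L (?M f) = ?M (\<lambda>i. L (f i))" using insert by simp
  finally show ?case using split[of f] split[of "\<lambda>i. L (f i)"] fi lin_op_carrier[OF L fi] by simp
qed

lemma mat_expand:
  assumes "A \<in> carrier_mat n n"
  shows "A = mat n n (\<lambda>r. \<Sum>p\<in>{..<n} \<times> {..<n}. A $$ p * e_mat n p $$ r)"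
proof (rule eq_matI)
  fix i j assume "i < dim_row (mat n n (\<lambda>r. \<Sum>p\<in>{..<n} \<times> {..<n}. A $$ p * e_mat n p $$ r))"
    "j < dim_col (mat n n (\<lambda>r. \<Sum>p\<in>{..<n} \<times> {..<n}. A $$ p * e_mat n p $$ r))"
  then have ij: "i < n" "j < n" by auto
  have "(\<Sum>p\<in>{..<n} \<times> {..<n}. A $$ p * e_mat n p $$ (i, j)) = (\<Sum>p\<in>{..<n} \<times> {..<n}. if p = (i, j) then A $$ p else 0)"
    using ij by (intro sum.cong refl) (auto simp: e_mat_index)
  then show "A $$ (i, j) = mat n n (\<lambda>r. \<Sum>p\<in>{..<n} \<times> {..<n}. A $$ p * e_mat n p $$ r) $$ (i, j)"
    using ij by simp
qed (use assms in auto)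

lemma lin_op_expand:
  assumes L: "lin_op n L" and A: "A \<in> carrier_mat n n" and r: "r \<in> {..<n} \<times> {..<n}"
  shows "L A $$ r = (\<Sum>p\<in>{..<n} \<times> {..<n}. A $$ p * L (e_mat n p) $$ r)"
proof -
  have "L A = L (mat n n (\<lambda>r. \<Sum>p\<in>{..<n} \<times> {..<n}. A $$ p * e_mat n p $$ r))"
    using mat_expand[OF A] by (rule arg_cong)
  also have "\<dots> = mat n n (\<lambda>r. \<Sum>p\<in>{..<n} \<times> {..<n}. A $$ p * L (e_mat n p) $$ r)"
    by (rule lin_op_sum[OF L]) auto
  finally show ?thesis using r by (cases r) simp
qed

lemma op_trace_comm:
  assumes L: "lin_op n L" and M: "lin_op n M"
  shows "op_trace n (\<lambda>A. L (M A)) = op_trace n (\<lambda>A. M (L A))"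
proof -
  let ?I = "{..<n} \<times> {..<n}"
  have "op_trace n (\<lambda>A. L (M A)) = (\<Sum>r\<in>?I. \<Sum>p\<in>?I. M (e_mat n r) $$ p * L (e_mat n p) $$ r)"
    unfolding op_trace_def
    by (intro sum.cong refl lin_op_expand[OF L] lin_op_carrier[OF M] e_mat_carrier)
  also have "\<dots> = (\<Sum>p\<in>?I. \<Sum>r\<in>?I. L (e_mat n p) $$ r * M (e_mat n r) $$ p)"
    by (subst sum.swap) (simp add: mult.commute)
  also have "\<dots> = op_trace n (\<lambda>A. M (L A))"
    unfolding op_trace_def
    by (intro sum.cong refl lin_op_expand[OF M, symmetric] lin_op_carrier[OF L] e_mat_carrier)
  finally show ?thesis .
qed

section \<open>Injective operators on matrices are invertible\<close>

definition vc :: "nat \<Rightarrow> complex mat \<Rightarrow> complex Matrix.vec" where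
  "vc n A = Matrix.vec (n * n) (\<lambda>p. A $$ (p div n, p mod n))"

definition unvc :: "nat \<Rightarrow> complex Matrix.vec \<Rightarrow> complex mat" where
  "unvc n v = mat n n (\<lambda>(i, j). vec_index v (i * n + j))"

lemma idx_less: "i < n \<Longrightarrow> j < n \<Longrightarrow> i * n + j < n * n" for i j n :: nat
proof -
  assume "i < n" "j < n"
  then have "i * n + j < i * n + n" by simp
  also have "\<dots> = Suc i * n" by simp
  also have "\<dots> \<le> n * n" using \<open>i < n\<close> by (intro mult_right_mono) auto
  finally show ?thesis .
qed

lemma idx_bij: "(\<Sum>p<n * n. f (p div n, p mod n)) = (\<Sum>r\<in>{..<n} \<times> {..<n}. f r)" for n :: nat
proof (cases "n = 0")
  case False
  then show ?thesis
    by (intro sum.reindex_bij_witness[of _ "\<lambda>(i, j). i * n + j" "\<lambda>p. (p div n, p mod n)"])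
      (auto simp: idx_less less_mult_imp_div_less)
qed simp

lemma unvc_vc: "A \<in> carrier_mat n n \<Longrightarrow> unvc n (vc n A) = A"
  by (intro eq_matI) (auto simp: unvc_def vc_def idx_less)

lemma vc_unvc: "v \<in> carrier_vec (n * n) \<Longrightarrow> vc n (unvc n v) = v"
proof (intro eq_vecI)
  fix p assume "v \<in> carrier_vec (n * n)" "p < dim_vec v"
  then have p: "p < n * n" by simp
  then have "0 < n" by (cases n) auto
  then show "vec_index (vc n (unvc n v)) p = vec_index v p"
    using p by (simp add: unvc_def vc_def less_mult_imp_div_less)
qed (simp add: vc_def)

lemma vc_carrier: "vc n A \<in> carrier_vec (n * n)" and unvc_carrier: "unvc n v \<in> carrier_mat n n"
  by (simp_all add: vc_def unvc_def)

text \<open>Flattening matrices to vectors of length n^2 turns the operator into a square matrix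
  with trivial kernel. Its determinant is nonzero, and the inverse matrix is transported back to
  \<open>K\<close>.\<close>

lemma lin_op_inverse:
  assumes L: "lin_op n L" and inj: "\<And>A. A \<in> carrier_mat n n \<Longrightarrow> L A = 0\<^sub>m n n \<Longrightarrow> A = 0\<^sub>m n n"
  obtains K where "lin_op n K" "\<And>A. A \<in> carrier_mat n n \<Longrightarrow> L (K A) = A" "\<And>A. A \<in> carrier_mat n n \<Longrightarrow> K (L A) = A"
proof -
  let ?N = "n * n"
  define M where "M = mat ?N ?N (\<lambda>(p, q). L (e_mat n (q div n, q mod n)) $$ (p div n, p mod n))"
  have Mc: "M \<in> carrier_mat ?N ?N" by (simp add: M_def)
  have Mv: "M *\<^sub>v vc n A = vc n (L A)" if A: "A \<in> carrier_mat n n" for A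
  proof (rule eq_vecI)
    fix p assume "p < dim_vec (vc n (L A))"
    then have p: "p < ?N" by (simp add: vc_def)
    then have n: "0 < n" by (cases n) auto
    have r: "(p div n, p mod n) \<in> {..<n} \<times> {..<n}" using p n by (simp add: less_mult_imp_div_less)
    have "vec_index (M *\<^sub>v vc n A) p = (\<Sum>q<?N. L (e_mat n (q div n, q mod n)) $$ (p div n, p mod n) * A $$ (q div n, q mod n))"
      using p by (simp add: M_def vc_def scalar_prod_def atLeast0LessThan)
    also have "\<dots> = (\<Sum>q\<in>{..<n} \<times> {..<n}. L (e_mat n q) $$ (p div n, p mod n) * A $$ q)"
      by (rule idx_bij)
    also have "\<dots> = L A $$ (p div n, p mod n)"
      using lin_op_expand[OF L A r] by (simp add: mult.commute)
    finally show "vec_index (M *\<^sub>v vc n A) p = vec_index (vc n (L A)) p" using p by (simp add: vc_def)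
  qed (simp add: M_def vc_def)
  have "det M \<noteq> 0"
  proof
    assume "det M = 0"
    then obtain v where v: "v \<in> carrier_vec ?N" "v \<noteq> 0\<^sub>v ?N" "M *\<^sub>v v = 0\<^sub>v ?N"
      using det_0_iff_vec_prod_zero[OF Mc] by auto
    have "vc n (L (unvc n v)) = 0\<^sub>v ?N" using Mv[OF unvc_carrier, of v] v(3) unfolding vc_unvc[OF v(1)] by simp
    then have "L (unvc n v) = unvc n (0\<^sub>v ?N)" using unvc_vc[OF lin_op_carrier[OF L unvc_carrier], of v] by simp
    also have "\<dots> = 0\<^sub>m n n" by (intro eq_matI) (auto simp: unvc_def idx_less)
    finally have "unvc n v = 0\<^sub>m n n" by (rule inj[OF unvc_carrier])
    then have "v = vc n (0\<^sub>m n n)" using vc_unvc[OF v(1)] by simp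
    also have "\<dots> = 0\<^sub>v ?N"
    proof (intro eq_vecI)
      fix p assume "p < dim_vec (0\<^sub>v ?N :: complex Matrix.vec)"
      then have p: "p < ?N" by simp
      then have "0 < n" by (cases n) auto
      then show "vec_index (vc n (0\<^sub>m n n)) p = vec_index (0\<^sub>v ?N) p"
        using p by (simp add: vc_def less_mult_imp_div_less)
    qed (simp add: vc_def)
    finally show False using v by simp
  qed
  then have "M \<in> Units (ring_mat TYPE(complex) ?N ())" by (rule det_non_zero_imp_unit[OF Mc])
  then obtain M' where M'c: "M' \<in> carrier_mat ?N ?N" and MM: "M' * M = 1\<^sub>m ?N" "M * M' = 1\<^sub>m ?N"
    by (auto simp: Units_def ring_mat_def)
  define K where "K A = unvc n (M' *\<^sub>v vc n A)" for A
  have Kv: "vc n (K A) = M' *\<^sub>v vc n A" for A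
    using M'c vc_carrier[of n A] by (simp add: K_def vc_unvc)
  have vc_inj: "A = A'" if "A \<in> carrier_mat n n" "A' \<in> carrier_mat n n" "vc n A = vc n A'" for A A'
  proof -
    have "unvc n (vc n A) = unvc n (vc n A')" by (simp only: that(3))
    then show ?thesis by (simp only: unvc_vc that(1,2))
  qed
  have Kc: "K A \<in> carrier_mat n n" for A by (simp add: K_def unvc_carrier)
  have LK: "L (K A) = A" if A: "A \<in> carrier_mat n n" for A
  proof (rule vc_inj[OF lin_op_carrier[OF L Kc] A])
    have "vc n (L (K A)) = M *\<^sub>v (M' *\<^sub>v vc n A)" by (simp add: Mv[OF Kc, symmetric] Kv)
    also have "\<dots> = (M * M') *\<^sub>v vc n A" using Mc M'c vc_carrier by (intro assoc_mult_mat_vec[symmetric])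
    finally show "vc n (L (K A)) = vc n A" using MM vc_carrier[of n A] by simp
  qed
  have KL: "K (L A) = A" if A: "A \<in> carrier_mat n n" for A
  proof (rule vc_inj[OF Kc A])
    have "vc n (K (L A)) = M' *\<^sub>v (M *\<^sub>v vc n A)" by (simp add: Mv[OF A] Kv)
    also have "\<dots> = (M' * M) *\<^sub>v vc n A" using Mc M'c vc_carrier by (intro assoc_mult_mat_vec[symmetric])
    finally show "vc n (K (L A)) = vc n A" using MM vc_carrier[of n A] by simp
  qed
  have "lin_op n K"
  proof -
    have LI: "A = A'" if "A \<in> carrier_mat n n" "A' \<in> carrier_mat n n" "L A = L A'" for A A'
    proof -
      have "K (L A) = K (L A')" by (simp only: that(3))
      then show ?thesis by (simp only: KL that(1,2))
    qed
    show ?thesis unfolding lin_op_def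
    proof (intro conjI ballI allI Kc)
      fix A B :: "complex mat" assume AB: "A \<in> carrier_mat n n" "B \<in> carrier_mat n n"
      show "K (A + B) = K A + K B"
        by (rule LI) (use AB Kc in \<open>auto simp: lin_op_add[OF L Kc Kc] LK\<close>)
    next
      fix s and A :: "complex mat" assume A: "A \<in> carrier_mat n n"
      show "K (s \<cdot>\<^sub>m A) = s \<cdot>\<^sub>m K A"
        by (rule LI) (use A Kc in \<open>auto simp: lin_op_smult[OF L Kc] LK\<close>)
    qed
  qed
  then show ?thesis using LK KL by (rule that)
qed

section \<open>Commutators and the Killing form\<close>

definition com :: "'a::comm_ring_1 mat \<Rightarrow> 'a mat \<Rightarrow> 'a mat" where
  "com A B = A * B - B * A"

lemma com_carrier: "A \<in> carrier_mat n n \<Longrightarrow> B \<in> carrier_mat n n \<Longrightarrow> com A B \<in> carrier_mat n n"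
  by (simp add: com_def minus_carrier_mat)

lemma com_sl: "A \<in> carrier_mat n n \<Longrightarrow> B \<in> carrier_mat n n \<Longrightarrow> com A B \<in> sl n"
  by (simp add: com_def sl_commutator)

lemma lin_op_com:
  assumes a: "a \<in> carrier_mat n n"
  shows "lin_op n (com a)"
  unfolding lin_op_def
proof (intro conjI ballI allI com_carrier a)
  fix A B :: "complex mat" assume AB: "A \<in> carrier_mat n n" "B \<in> carrier_mat n n"
  have 1: "a * (A + B) = a * A + a * B" by (rule mult_add_distrib_mat[OF a AB])
  have 2: "(A + B) * a = A * a + B * a" by (rule add_mult_distrib_mat[OF AB a])
  show "com a (A + B) = com a A + com a B"
    unfolding com_def 1 2 using a AB by (intro eq_matI) auto
next
  fix s and A :: "complex mat" assume A: "A \<in> carrier_mat n n"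
  have 1: "a * (s \<cdot>\<^sub>m A) = s \<cdot>\<^sub>m (a * A)" by (rule mult_smult_distrib[OF a A])
  have 2: "(s \<cdot>\<^sub>m A) * a = s \<cdot>\<^sub>m (A * a)" by (rule mult_smult_assoc_mat[OF A a])
  show "com a (s \<cdot>\<^sub>m A) = s \<cdot>\<^sub>m com a A"
    unfolding com_def 1 2 using a A by (intro eq_matI) (auto simp: right_diff_distrib)
qed

lemma mult_e_mat:
  assumes "b \<in> carrier_mat n n" "i < n" "j < n" "k < n" "l < n"
  shows "(b * e_mat n (i, j)) $$ (k, l) = (if l = j then b $$ (k, i) else 0)"
    and "(e_mat n (i, j) * b) $$ (k, l) = (if k = i then b $$ (j, l) else 0)"
proof -
  have "(b * e_mat n (i, j)) $$ (k, l) = (\<Sum>m<n. b $$ (k, m) * e_mat n (i, j) $$ (m, l))"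
    using assms by (simp add: scalar_prod_def atLeast0LessThan)
  also have "\<dots> = (\<Sum>m<n. if m = i then (if l = j then b $$ (k, m) else 0) else 0)"
    using assms by (intro sum.cong refl) (simp add: e_mat_index)
  finally show "(b * e_mat n (i, j)) $$ (k, l) = (if l = j then b $$ (k, i) else 0)" using assms by simp
  have "(e_mat n (i, j) * b) $$ (k, l) = (\<Sum>m<n. e_mat n (i, j) $$ (k, m) * b $$ (m, l))"
    using assms by (simp add: scalar_prod_def atLeast0LessThan)
  also have "\<dots> = (\<Sum>m<n. if m = j then (if k = i then b $$ (m, l) else 0) else 0)"
    using assms by (intro sum.cong refl) (simp add: e_mat_index)
  finally show "(e_mat n (i, j) * b) $$ (k, l) = (if k = i then b $$ (j, l) else 0)" using assms by simp
qed

text \<open>In [a, [b, e]] = a b e - a e b - b e a + e b a the outer terms have trace n tr(a b) each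
  as operators in e, the middle ones -tr(a) tr(b) each. The trace runs over all matrices; on
  traceless a and b only the multiple of tr(a b) survives.\<close>

lemma killing_form:
  assumes a: "a \<in> carrier_mat n n" and b: "b \<in> carrier_mat n n"
  shows "op_trace n (\<lambda>A. com a (com b A)) = 2 * of_nat n * tr (a * b) - 2 * tr a * tr b"
proof -
  have E: "com a (com b (e_mat n (i, j))) $$ (i, j) 
      = (\<Sum>k<n. a $$ (i, k) * b $$ (k, i)) - a $$ (i, i) * b $$ (j, j) - b $$ (i, i) * a $$ (j, j) + (\<Sum>k<n. a $$ (k, j) * b $$ (j, k))"
    if ij: "i < n" "j < n" for i j
  proof -
    let ?C = "com b (e_mat n (i, j))"
    have Cc: "?C \<in> carrier_mat n n" using b by (intro com_carrier) auto
    have C: "?C $$ (k, l) = (if l = j then b $$ (k, i) else 0) - (if k = i then b $$ (j, l) else 0)" if "k < n" "l < n" for k l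
    proof -
      have "?C $$ (k, l) = (b * e_mat n (i, j)) $$ (k, l) - (e_mat n (i, j) * b) $$ (k, l)"
        using b that by (simp add: com_def)
      then show ?thesis unfolding mult_e_mat[OF b ij that] .
    qed
    have "com a ?C $$ (i, j) = (\<Sum>k<n. a $$ (i, k) * ?C $$ (k, j)) - (\<Sum>k<n. ?C $$ (i, k) * a $$ (k, j))"
      using a Cc ij by (simp add: com_def[of a] scalar_prod_def atLeast0LessThan)
    also have "(\<Sum>k<n. a $$ (i, k) * ?C $$ (k, j)) = (\<Sum>k<n. a $$ (i, k) * b $$ (k, i) - (if k = i then a $$ (i, k) * b $$ (j, j) else 0))"
      using ij by (intro sum.cong refl) (auto simp: C right_diff_distrib)
    also have "\<dots> = (\<Sum>k<n. a $$ (i, k) * b $$ (k, i)) - a $$ (i, i) * b $$ (j, j)"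
      using ij by (simp add: sum_subtractf)
    also have "(\<Sum>k<n. ?C $$ (i, k) * a $$ (k, j)) = (\<Sum>k<n. (if k = j then b $$ (i, i) * a $$ (k, j) else 0) - a $$ (k, j) * b $$ (j, k))"
      using ij by (intro sum.cong refl) (auto simp: C left_diff_distrib)
    also have "\<dots> = b $$ (i, i) * a $$ (j, j) - (\<Sum>k<n. a $$ (k, j) * b $$ (j, k))"
      using ij by (simp add: sum_subtractf)
    finally show ?thesis by (simp add: algebra_simps)
  qed
  have "op_trace n (\<lambda>A. com a (com b A)) = (\<Sum>i<n. \<Sum>j<n. (\<Sum>k<n. a $$ (i, k) * b $$ (k, i)) 
      - a $$ (i, i) * b $$ (j, j) - b $$ (i, i) * a $$ (j, j) + (\<Sum>k<n. a $$ (k, j) * b $$ (j, k)))"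
    unfolding op_trace_def sum.cartesian_product by (intro sum.cong refl) (auto simp: E)
  also have "\<dots> = of_nat n * (\<Sum>i<n. \<Sum>k<n. a $$ (i, k) * b $$ (k, i)) - (\<Sum>i<n. a $$ (i, i)) * (\<Sum>j<n. b $$ (j, j))
     - (\<Sum>i<n. b $$ (i, i)) * (\<Sum>j<n. a $$ (j, j)) + of_nat n * (\<Sum>j<n. \<Sum>k<n. a $$ (k, j) * b $$ (j, k))"
    unfolding sum.distrib sum_subtractf sum_product by (simp add: sum_distrib_left[symmetric])
  also have "(\<Sum>j<n. \<Sum>k<n. a $$ (k, j) * b $$ (j, k)) = tr (a * b)"
    unfolding tr_mult[OF a b] by (rule sum.swap)
  also have "(\<Sum>i<n. \<Sum>k<n. a $$ (i, k) * b $$ (k, i)) = tr (a * b)"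
    unfolding tr_mult[OF a b] ..
  finally show ?thesis using a b by (simp add: tr_def algebra_simps)
qed

text \<open>Extended by the identity on scalar matrices, \<open>\<Psi>\<close> becomes an invertible operator \<open>L\<close> that conjugates
  \<open>ad e \<circ> ad f\<close> into \<open>ad (\<Psi> e) \<circ> ad (\<Psi> f)\<close>, so that the Killing form is preserved.\<close>

lemma lie_monomorphism:
  fixes \<Psi> :: "complex mat \<Rightarrow> complex mat"
  assumes n: "0 < n"
    and sl: "\<And>e. e \<in> sl n \<Longrightarrow> \<Psi> e \<in> sl n"
    and add: "\<And>e f. e \<in> sl n \<Longrightarrow> f \<in> sl n \<Longrightarrow> \<Psi> (e + f) = \<Psi> e + \<Psi> f"
    and smult: "\<And>s e. e \<in> sl n \<Longrightarrow> \<Psi> (s \<cdot>\<^sub>m e) = s \<cdot>\<^sub>m \<Psi> e"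
    and comm: "\<And>e f. e \<in> sl n \<Longrightarrow> f \<in> sl n \<Longrightarrow> \<Psi> (com e f) = com (\<Psi> e) (\<Psi> f)"
    and inj: "\<And>e. e \<in> sl n \<Longrightarrow> \<Psi> e = 0\<^sub>m n n \<Longrightarrow> e = 0\<^sub>m n n"
  shows lie_mono_surj: "\<And>t. t \<in> sl n \<Longrightarrow> \<exists>e\<in>sl n. \<Psi> e = t"
    and lie_mono_tr: "\<And>e f. e \<in> sl n \<Longrightarrow> f \<in> sl n \<Longrightarrow> tr (\<Psi> e * \<Psi> f) = tr (e * f)"
proof -
  define \<mu> where "\<mu> A = tr A / of_nat n" for A :: "complex mat"
  define A0 where "A0 A = A - \<mu> A \<cdot>\<^sub>m 1\<^sub>m n" for A :: "complex mat"
  define L where "L A = \<Psi> (A0 A) + \<mu> A \<cdot>\<^sub>m 1\<^sub>m n" for A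
  have tr1: "tr (1\<^sub>m n :: complex mat) = of_nat n" by (simp add: tr_def)
  have A0_sl: "A0 A \<in> sl n" if "A \<in> carrier_mat n n" for A
    using that n by (auto simp: A0_def sl_def tr_minus[of _ n] tr_smult[of _ n] tr1 \<mu>_def minus_carrier_mat)
  have \<Psi>c: "\<Psi> (A0 A) \<in> carrier_mat n n" if "A \<in> carrier_mat n n" for A
    using A0_sl[OF that] sl sl_carrier by blast
  have Lc: "L A \<in> carrier_mat n n" if "A \<in> carrier_mat n n" for A
    using \<Psi>c[OF that] by (simp add: L_def)
  have L: "lin_op n L"
    unfolding lin_op_def
  proof (intro conjI ballI allI Lc)
    fix A B :: "complex mat" assume A: "A \<in> carrier_mat n n" and B: "B \<in> carrier_mat n n"
    have \<mu>: "\<mu> (A + B) = \<mu> A + \<mu> B" using tr_add[OF A B] by (simp add: \<mu>_def add_divide_distrib)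
    have "A0 (A + B) = A0 A + A0 B" using A B by (intro eq_matI) (auto simp: A0_def \<mu> algebra_simps)
    then show "L (A + B) = L A + L B" 
      using \<Psi>c[OF A] \<Psi>c[OF B] unfolding L_def \<mu> by (intro eq_matI) (auto simp: add A0_sl A B algebra_simps)
  next
    fix s and A :: "complex mat" assume A: "A \<in> carrier_mat n n"
    have \<mu>: "\<mu> (s \<cdot>\<^sub>m A) = s * \<mu> A" using tr_smult[OF A] by (simp add: \<mu>_def)
    have "A0 (s \<cdot>\<^sub>m A) = s \<cdot>\<^sub>m A0 A" using A by (intro eq_matI) (auto simp: A0_def \<mu> algebra_simps)
    then show "L (s \<cdot>\<^sub>m A) = s \<cdot>\<^sub>m L A"
      using \<Psi>c[OF A] unfolding L_def \<mu> by (intro eq_matI) (auto simp: smult A0_sl A algebra_simps)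
  qed
  have \<mu>0: "\<mu> e = 0" if "e \<in> sl n" for e using that by (simp add: \<mu>_def sl_def)
  have A00: "A0 e = e" if "e \<in> sl n" for e
    using sl_carrier[OF that] by (intro eq_matI) (auto simp: A0_def \<mu>0[OF that])
  have L_sl: "L e = \<Psi> e" if "e \<in> sl n" for e
    using sl_carrier[OF sl[OF that]] by (intro eq_matI) (auto simp: L_def \<mu>0[OF that] A00[OF that])
  \<comment> \<open>Used twice: the kernel of \<open>L\<close> consists of traceless matrices, where
    \<Psi> is injective, and preimages of traceless matrices under \<open>L\<close> are traceless,
    which gives surjectivity of \<Psi>.\<close>
  have tr_L: "tr (L A) = tr A" if A: "A \<in> carrier_mat n n" for A
    using n sl[OF A0_sl[OF A]] by (simp add: L_def tr_add[OF \<Psi>c[OF A]] tr_smult[of _ n] tr1 \<mu>_def sl_def)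
  have inj_L: "A = 0\<^sub>m n n" if A: "A \<in> carrier_mat n n" and "L A = 0\<^sub>m n n" for A
  proof -
    have "tr A = 0" using tr_L[OF A] that(2) by (simp add: tr_def)
    then have "A \<in> sl n" using A by (simp add: sl_def)
    then show ?thesis using inj L_sl that(2) by simp
  qed
  obtain K where K: "lin_op n K" "\<And>A. A \<in> carrier_mat n n \<Longrightarrow> L (K A) = A" "\<And>A. A \<in> carrier_mat n n \<Longrightarrow> K (L A) = A"
    using lin_op_inverse[OF L inj_L] by blast
  \<comment> \<open>Scalar matrices are central, so the scalar part added in \<open>L\<close> is
    invisible to commutators.\<close>
  have com_1: "com a (A + s \<cdot>\<^sub>m 1\<^sub>m n) = com a A" if "a \<in> carrier_mat n n" "A \<in> carrier_mat n n" for a A :: "complex mat" and s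
  proof -
    have "com a (A + s \<cdot>\<^sub>m 1\<^sub>m n) = com a A + s \<cdot>\<^sub>m com a (1\<^sub>m n)"
      using lin_op_add[OF lin_op_com[OF that(1)] that(2), of "s \<cdot>\<^sub>m 1\<^sub>m n"] 
        lin_op_smult[OF lin_op_com[OF that(1)], of "1\<^sub>m n" s] by simp
    also have "com a (1\<^sub>m n) = 0\<^sub>m n n" using that(1) by (simp add: com_def minus_r_inv_mat)
    also have "com a A + s \<cdot>\<^sub>m 0\<^sub>m n n = com a A" using com_carrier[OF that] by (intro eq_matI) auto
    finally show ?thesis .
  qed
  have com_L: "L (com e A) = com (\<Psi> e) (L A)" if e: "e \<in> sl n" and A: "A \<in> carrier_mat n n" for e A
  proof -
    have A_eq: "A0 A + \<mu> A \<cdot>\<^sub>m 1\<^sub>m n = A" using A by (intro eq_matI) (auto simp: A0_def)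
    have "com e A = com e (A0 A)" 
      using com_1[OF sl_carrier[OF e] sl_carrier[OF A0_sl[OF A]], of "\<mu> A"] unfolding A_eq .
    then have "L (com e A) = com (\<Psi> e) (\<Psi> (A0 A))"
      using comm[OF e A0_sl[OF A]] L_sl[OF com_sl[OF sl_carrier[OF e] sl_carrier[OF A0_sl[OF A]]]] by simp
    also have "\<dots> = com (\<Psi> e) (L A)"
      unfolding L_def by (rule com_1[OF sl_carrier[OF sl[OF e]] \<Psi>c[OF A], symmetric])
    finally show ?thesis .
  qed
  show "\<exists>e\<in>sl n. \<Psi> e = t" if t: "t \<in> sl n" for t
  proof (rule bexI)
    have Kt: "K t \<in> carrier_mat n n" by (rule lin_op_carrier[OF K(1) sl_carrier[OF t]])
    then show "K t \<in> sl n" using tr_L[OF Kt] K(2)[OF sl_carrier[OF t]] t by (simp add: sl_def)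
    then show "\<Psi> (K t) = t" using L_sl K(2)[OF sl_carrier[OF t]] by simp
  qed
  show "tr (\<Psi> e * \<Psi> f) = tr (e * f)" if e: "e \<in> sl n" and f: "f \<in> sl n" for e f
  proof -
    note ec = sl_carrier[OF e] and fc = sl_carrier[OF f] 
      and \<Psi>ec = sl_carrier[OF sl[OF e]] and \<Psi>fc = sl_carrier[OF sl[OF f]]
    let ?T = "\<lambda>A. com e (com f A)" and ?T' = "\<lambda>A. com (\<Psi> e) (com (\<Psi> f) A)"
    have lin: "lin_op n (\<lambda>A. f (g A))" if "lin_op n f" "lin_op n g" for f g
      using that unfolding lin_op_def by metis
    have T: "lin_op n ?T" by (rule lin[OF lin_op_com[OF ec] lin_op_com[OF fc]])
    have T': "L (?T A) = ?T' (L A)" if A: "A \<in> carrier_mat n n" for A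
      by (simp only: com_L[OF e com_carrier[OF fc A]] com_L[OF f A])
    have "op_trace n ?T' = op_trace n (\<lambda>A. L (?T (K A)))"
      unfolding op_trace_def
    proof (intro sum.cong refl)
      fix r
      have "L (?T (K (e_mat n r))) = ?T' (L (K (e_mat n r)))"
        by (rule T'[OF lin_op_carrier[OF K(1) e_mat_carrier]])
      then show "?T' (e_mat n r) $$ r = L (?T (K (e_mat n r))) $$ r" by (simp add: K(2))
    qed
    \<comment> \<open>The trace is invariant under cyclic exchange of \<open>K\<close>, after which
      \<open>K\<close> cancels against \<open>L\<close>.\<close>
    also have "\<dots> = op_trace n (\<lambda>A. K (L (?T A)))"
      using op_trace_comm[OF lin[OF L T] K(1)] .
    also have "\<dots> = op_trace n ?T"
      unfolding op_trace_def by (intro sum.cong refl) (simp add: K(3) com_carrier ec fc)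
    finally have "2 * of_nat n * tr (\<Psi> e * \<Psi> f) = 2 * of_nat n * tr (e * f)"
      unfolding killing_form[OF ec fc] killing_form[OF \<Psi>ec \<Psi>fc] using e f sl[OF e] sl[OF f] by (simp add: sl_def)
    then show ?thesis using n by simp
  qed
qed

section \<open>Local frames of the bundle\<close>

lemma regular_at_Fract: "poly b x \<noteq> 0 \<Longrightarrow> regular_at x (Fract a b)"
  by (auto simp: regular_at_def)

lemma value_at_Fract:
  assumes "poly b x \<noteq> 0"
  shows "value_at x (Fract a b) = poly a x / poly b x"
  unfolding value_at_def
proof (rule the_equality)
  show "\<exists>a' b'. Fract a b = Fract a' b' \<and> poly b' x \<noteq> 0 \<and> poly a x / poly b x = poly a' x / poly b' x"
    using assms by blast
  fix v assume "\<exists>a' b'. Fract a b = Fract a' b' \<and> poly b' x \<noteq> 0 \<and> v = poly a' x / poly b' x"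
  then obtain a' b' where ab: "Fract a b = Fract a' b'" "poly b' x \<noteq> 0" "v = poly a' x / poly b' x" by blast
  have "b \<noteq> 0" "b' \<noteq> 0" using assms ab(2) by auto
  then have "a * b' = a' * b" using ab(1) by (simp add: eq_fract)
  then have "poly a x * poly b' x = poly a' x * poly b x" by (metis poly_mult)
  then show "v = poly a x / poly b x" using assms ab(2) unfolding ab(3) by (simp add: frac_eq_eq)
qed

lemma regular_atE:
  assumes "regular_at x f"
  obtains a b where "f = Fract a b" "poly b x \<noteq> 0" "b \<noteq> 0" "value_at x f = poly a x / poly b x"
proof -
  obtain a b where ab: "f = Fract a b" "poly b x \<noteq> 0" using assms unfolding regular_at_def by blast
  then have "b \<noteq> 0" "value_at x f = poly a x / poly b x" using value_at_Fract[OF ab(2)] by auto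
  with ab show ?thesis by (rule that)
qed

lemma regular_value_add:
  assumes "regular_at x f" "regular_at x g"
  shows regular_add: "regular_at x (f + g)" and value_add: "value_at x (f + g) = value_at x f + value_at x g"
proof -
  obtain a b where f: "f = Fract a b" "poly b x \<noteq> 0" "b \<noteq> 0" "value_at x f = poly a x / poly b x"
    using assms(1) by (rule regular_atE)
  obtain a' b' where g: "g = Fract a' b'" "poly b' x \<noteq> 0" "b' \<noteq> 0" "value_at x g = poly a' x / poly b' x"
    using assms(2) by (rule regular_atE)
  have fg: "f + g = Fract (a * b' + a' * b) (b * b')" using f g by simp
  have nz: "poly (b * b') x \<noteq> 0" using f g by simp
  show "regular_at x (f + g)" unfolding fg using nz by (rule regular_at_Fract)
  show "value_at x (f + g) = value_at x f + value_at x g"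
    unfolding fg value_at_Fract[OF nz] f(4) g(4) using f(2) g(2) by (simp add: field_simps)
qed

lemma regular_value_mult:
  assumes "regular_at x f" "regular_at x g"
  shows regular_mult: "regular_at x (f * g)" and value_mult: "value_at x (f * g) = value_at x f * value_at x g"
proof -
  obtain a b where f: "f = Fract a b" "poly b x \<noteq> 0" "b \<noteq> 0" "value_at x f = poly a x / poly b x"
    using assms(1) by (rule regular_atE)
  obtain a' b' where g: "g = Fract a' b'" "poly b' x \<noteq> 0" "b' \<noteq> 0" "value_at x g = poly a' x / poly b' x"
    using assms(2) by (rule regular_atE)
  have fg: "f * g = Fract (a * a') (b * b')" using f g by simp
  have nz: "poly (b * b') x \<noteq> 0" using f g by simp
  show "regular_at x (f * g)" unfolding fg using nz by (rule regular_at_Fract)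
  show "value_at x (f * g) = value_at x f * value_at x g"
    unfolding fg value_at_Fract[OF nz] f(4) g(4) by simp
qed

lemma regular_to_fract: "regular_at x (to_fract p)" and value_to_fract: "value_at x (to_fract p) = poly p x"
  unfolding to_fract_def using regular_at_Fract[of 1 x p] value_at_Fract[of 1 x p] by simp_all

lemma regular_const: "regular_at x (const a)" and value_const: "value_at x (const a) = a"
  by (simp_all add: const_def regular_to_fract value_to_fract)

lemma const_1: "const 1 = 1" and const_0: "const 0 = 0" and const_add: "const (a + b) = const a + const b"
  and const_mult: "const (a * b) = const a * const b" and const_diff: "const (a - b) = const a - const b"
  and const_uminus: "const (- a) = - const a"
  by (simp_all add: const_def one_pCons[symmetric] to_fract_add[symmetric] to_fract_mult[symmetric] 
    to_fract_diff[symmetric] to_fract_uminus[symmetric] del: to_fract_add to_fract_mult to_fract_diff to_fract_uminus)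

lemma const_sum: "const (sum f A) = (\<Sum>i\<in>A. const (f i))"
  by (induction A rule: infinite_finite_induct) (simp_all add: const_0 const_add)

lemma regular_0: "regular_at x 0" and value_0: "value_at x 0 = 0"
  using regular_const[of x 0] value_const[of x 0] by (simp_all add: const_0)

lemma regular_1: "regular_at x 1"
  using regular_const[of x 1] by (simp add: const_1)

lemma regular_value_diff:
  assumes "regular_at x f" "regular_at x g"
  shows regular_diff: "regular_at x (f - g)" and value_diff: "value_at x (f - g) = value_at x f - value_at x g"
proof -
  have e: "f - g = f + const (- 1) * g" by (simp add: const_uminus const_1)
  note r = regular_mult[OF regular_const assms(2)]
  show "regular_at x (f - g)" unfolding e by (rule regular_add[OF assms(1) r])
  show "value_at x (f - g) = value_at x f - value_at x g"
    unfolding e value_add[OF assms(1) r] value_mult[OF regular_const assms(2)] value_const by simp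
qed

lemma regular_value_sum:
  assumes "\<And>i. i \<in> A \<Longrightarrow> regular_at x (f i)"
  shows regular_sum: "regular_at x (sum f A)" and value_sum: "value_at x (sum f A) = (\<Sum>i\<in>A. value_at x (f i))"
proof -
  have "regular_at x (sum f A) \<and> value_at x (sum f A) = (\<Sum>i\<in>A. value_at x (f i))"
    using assms
  proof (induction A rule: infinite_finite_induct)
    case (insert a A)
    then have "regular_at x (f a)" "regular_at x (sum f A)" by auto
    then show ?case using insert regular_add value_add by simp
  qed (simp_all add: regular_0 value_0)
  then show "regular_at x (sum f A)" "value_at x (sum f A) = (\<Sum>i\<in>A. value_at x (f i))" by auto
qed

lemma zfun_minus_const: "zfun - const x = to_fract [:- x, 1:]"
  by (simp add: zfun_def const_def to_fract_diff[symmetric] del: to_fract_diff)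

lemma zfun_minus_const_nz: "zfun - const x \<noteq> 0"
  unfolding zfun_minus_const by simp

lemma regular_zfun: "regular_at y (zfun - const x)" and value_zfun: "value_at y (zfun - const x) = y - x"
  unfolding zfun_minus_const by (simp_all add: regular_to_fract value_to_fract)

lemma regular_inverse_zfun: "y \<noteq> x \<Longrightarrow> regular_at y (inverse (zfun - const x))"
  unfolding zfun_minus_const by (simp add: to_fract_def regular_at_Fract)

lemma value_inverse_zfun: "y \<noteq> x \<Longrightarrow> value_at y (inverse (zfun - const x)) = 1 / (y - x)"
  unfolding zfun_minus_const by (simp add: to_fract_def value_at_Fract)

text \<open>The linear factor z - x splits off from the numerator, because the denominator does not
  vanish at x.\<close>

lemma zero_value_factor:
  assumes "regular_at x f" "value_at x f = 0"
  shows "regular_at x (inverse (zfun - const x) * f)"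
proof -
  obtain a b where f: "f = Fract a b" "poly b x \<noteq> 0" "b \<noteq> 0" "value_at x f = poly a x / poly b x"
    using assms(1) by (rule regular_atE)
  then have "poly a x = 0" using assms(2) by simp
  then obtain a' where a': "a = [:- x, 1:] * a'" by (metis poly_eq_0_iff_dvd dvdE)
  define l where "l = [:- x, 1:]"
  have "l \<noteq> 0" by (simp add: l_def)
  have "inverse (Fract l 1) * Fract (l * a') b = Fract (l * a') (l * b)" by simp
  also have "\<dots> = Fract a' b" using \<open>l \<noteq> 0\<close> by (rule mult_fract_cancel)
  finally have "inverse (zfun - const x) * f = Fract a' b"
    unfolding zfun_minus_const f(1) a' to_fract_def l_def .
  then show ?thesis using regular_at_Fract[OF f(2)] by simp
qed

definition regm :: "nat \<Rightarrow> complex \<Rightarrow> ratfun mat \<Rightarrow> bool" where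
  "regm n x A \<longleftrightarrow> A \<in> carrier_mat n n \<and> (\<forall>i<n. \<forall>j<n. regular_at x (A $$ (i, j)))"

abbreviation val :: "complex \<Rightarrow> ratfun mat \<Rightarrow> complex mat" where
  "val x \<equiv> map_mat (value_at x)"

lemma regmD: "regm n x A \<Longrightarrow> A \<in> carrier_mat n n" "regm n x A \<Longrightarrow> i < n \<Longrightarrow> j < n \<Longrightarrow> regular_at x (A $$ (i, j))"
  by (auto simp: regm_def)

lemma regm_val_add:
  assumes "regm n x A" "regm n x B"
  shows regm_add: "regm n x (A + B)" and val_add: "val x (A + B) = val x A + val x B"
  using assms by (auto simp: regm_def regular_add value_add)

lemma regm_val_minus:
  assumes "regm n x A" "regm n x B"
  shows regm_minus: "regm n x (A - B)" and val_minus: "val x (A - B) = val x A - val x B"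
  using assms by (auto simp: regm_def regular_diff value_diff minus_carrier_mat)

lemma regm_val_smult:
  assumes "regular_at x h" "regm n x A"
  shows regm_smult: "regm n x (h \<cdot>\<^sub>m A)" and val_smult: "val x (h \<cdot>\<^sub>m A) = value_at x h \<cdot>\<^sub>m val x A"
  using assms by (auto simp: regm_def regular_mult value_mult)

lemma regm_val_mult:
  assumes A: "regm n x A" and B: "regm n x B"
  shows regm_mult: "regm n x (A * B)" and val_mult: "val x (A * B) = val x A * val x B"
proof -
  note c = regmD(1)[OF A] regmD(1)[OF B]
  have e: "(A * B) $$ (i, j) = (\<Sum>k<n. A $$ (i, k) * B $$ (k, j))" if "i < n" "j < n" for i j
    using c that by (simp add: scalar_prod_def atLeast0LessThan)
  have r: "regular_at x (A $$ (i, k) * B $$ (k, j))" if "i < n" "j < n" "k < n" for i j k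
    using that by (intro regular_mult regmD(2)[OF A] regmD(2)[OF B])
  show "regm n x (A * B)" unfolding regm_def
  proof (intro conjI allI impI mult_carrier_mat[OF c])
    fix i j assume "i < n" "j < n"
    then show "regular_at x ((A * B) $$ (i, j))" unfolding e[OF \<open>i < n\<close> \<open>j < n\<close>] by (intro regular_sum r) auto
  qed
  show "val x (A * B) = val x A * val x B"
  proof (rule eq_matI)
    fix i j assume "i < dim_row (val x A * val x B)" "j < dim_col (val x A * val x B)"
    then have ij: "i < n" "j < n" using c by auto
    have "val x (A * B) $$ (i, j) = value_at x ((A * B) $$ (i, j))" using ij c by simp
    also have "\<dots> = (\<Sum>k<n. value_at x (A $$ (i, k)) * value_at x (B $$ (k, j)))"
      unfolding e[OF ij] using ij by (subst value_sum) (auto simp: r value_mult regmD(2)[OF A] regmD(2)[OF B])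
    also have "\<dots> = (val x A * val x B) $$ (i, j)" using ij c by (simp add: scalar_prod_def atLeast0LessThan)
    finally show "val x (A * B) $$ (i, j) = (val x A * val x B) $$ (i, j)" .
  qed (use c in auto)
qed

lemma regm_val_com:
  assumes "regm n x A" "regm n x B"
  shows regm_com: "regm n x (com A B)" and val_com: "val x (com A B) = com (val x A) (val x B)"
  unfolding com_def using assms by (simp_all add: regm_minus regm_mult val_minus[of n] val_mult[of n])

lemma value_tr: "regm n x A \<Longrightarrow> value_at x (tr A) = tr (val x A)"
  unfolding tr_def by (subst value_sum) (auto simp: regm_def)

locale frame =
  fixes n :: nat and P :: vbundle and x :: complex and g g' :: "ratfun mat"
  assumes g: "g \<in> carrier_mat n n" and g': "g' \<in> carrier_mat n n"
    and gg': "g * g' = 1\<^sub>m n" and g'g: "g' * g = 1\<^sub>m n"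
    and stalk: "P (Smooth x) = (\<lambda>v. g *\<^sub>v v) ` standard_stalk n (Smooth x)"
begin

definition cj :: "ratfun mat \<Rightarrow> ratfun mat" where "cj \<phi> = g' * \<phi> * g"

lemma cj_carrier: "\<phi> \<in> carrier_mat n n \<Longrightarrow> cj \<phi> \<in> carrier_mat n n"
  using g g' by (simp add: cj_def)

lemma g_g'_mult: "A \<in> carrier_mat n n \<Longrightarrow> g * (g' * A) = A"
  using g g' assoc_mult_mat[of g n n g' n A n] by (simp add: gg')

lemma cj_mult: "\<phi> \<in> carrier_mat n n \<Longrightarrow> \<psi> \<in> carrier_mat n n \<Longrightarrow> cj (\<phi> * \<psi>) = cj \<phi> * cj \<psi>"
  using g g' by (simp add: cj_def assoc_mult_mat[of _ n n _ n _ n] g_g'_mult)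

lemma cj_add: "\<phi> \<in> carrier_mat n n \<Longrightarrow> \<psi> \<in> carrier_mat n n \<Longrightarrow> cj (\<phi> + \<psi>) = cj \<phi> + cj \<psi>"
  using g g' by (simp add: cj_def mult_add_distrib_mat[of g' n n \<phi> n \<psi>] add_mult_distrib_mat[of "g' * \<phi>" n n "g' * \<psi>" g n])

lemma cj_minus: "\<phi> \<in> carrier_mat n n \<Longrightarrow> \<psi> \<in> carrier_mat n n \<Longrightarrow> cj (\<phi> - \<psi>) = cj \<phi> - cj \<psi>"
  using g g' by (simp add: cj_def mult_minus_distrib_mat[of g' n n \<phi> n \<psi>] minus_mult_distrib_mat[of "g' * \<phi>" n n "g' * \<psi>" g n])

lemma cj_smult: "\<phi> \<in> carrier_mat n n \<Longrightarrow> cj (h \<cdot>\<^sub>m \<phi>) = h \<cdot>\<^sub>m cj \<phi>"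
  using g g' by (simp add: cj_def mult_smult_distrib[of g' n n \<phi> n h] mult_smult_assoc_mat[of "g' * \<phi>" n n g n h])

lemma cj_com: "\<phi> \<in> carrier_mat n n \<Longrightarrow> \<psi> \<in> carrier_mat n n \<Longrightarrow> cj (com \<phi> \<psi>) = com (cj \<phi>) (cj \<psi>)"
  using cj_minus[of "\<phi> * \<psi>" "\<psi> * \<phi>"] by (simp add: com_def cj_mult)

lemma tr_cj: "\<phi> \<in> carrier_mat n n \<Longrightarrow> tr (cj \<phi>) = tr \<phi>"
proof -
  assume \<phi>: "\<phi> \<in> carrier_mat n n"
  have "tr (cj \<phi>) = tr (g * (g' * \<phi>))" unfolding cj_def using g g' \<phi> by (intro tr_comm[of _ n]) auto
  then show ?thesis using \<phi> by (simp add: g_g'_mult)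
qed

text \<open>\<open>cj\<close> writes an endomorphism in the frame. Its columns are the frame
  coordinates of the images of the frame vectors, so preserving the stalk amounts to regular
  entries.\<close>

lemma end_iff: "\<phi> \<in> end_stalk n P (Smooth x) \<longleftrightarrow> \<phi> \<in> carrier_mat n n \<and> regm n x (cj \<phi>)"
proof (intro iffI conjI)
  assume \<phi>: "\<phi> \<in> end_stalk n P (Smooth x)"
  then show \<phi>c: "\<phi> \<in> carrier_mat n n" by (simp add: end_stalk_def)
  show "regm n x (cj \<phi>)" unfolding regm_def
  proof (intro conjI allI impI cj_carrier[OF \<phi>c])
    fix i j assume ij: "i < n" "j < n"
    have uv: "unit_vec n j \<in> standard_stalk n (Smooth x)"
      using ij by (auto simp: standard_stalk_def unit_vec_def regular_0 regular_1)
    then have "\<phi> *\<^sub>v (g *\<^sub>v unit_vec n j) \<in> P (Smooth x)" using \<phi> by (auto simp: end_stalk_def stalk)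
    then obtain u where u: "u \<in> standard_stalk n (Smooth x)" "\<phi> *\<^sub>v (g *\<^sub>v unit_vec n j) = g *\<^sub>v u"
      by (auto simp: stalk)
    have uc: "u \<in> carrier_vec n" using u by (simp add: standard_stalk_def)
    have "u = g' *\<^sub>v (g *\<^sub>v u)"
      using g g' uc by (simp add: assoc_mult_mat_vec[of g' n n g n u, symmetric] g'g)
    also have "\<dots> = g' *\<^sub>v (\<phi> *\<^sub>v (g *\<^sub>v unit_vec n j))" by (simp only: u(2))
    also have "\<dots> = cj \<phi> *\<^sub>v unit_vec n j"
      using g g' \<phi>c by (simp add: cj_def assoc_mult_mat_vec[of _ n n _ n])
    also have "\<dots> = col (cj \<phi>) j" using cj_carrier[OF \<phi>c] ij by (intro eq_vecI) auto
    finally have "cj \<phi> $$ (i, j) = vec_index u i" using cj_carrier[OF \<phi>c] ij by simp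
    then show "regular_at x (cj \<phi> $$ (i, j))" using u(1) ij by (simp add: standard_stalk_def)
  qed
next
  assume a: "\<phi> \<in> carrier_mat n n \<and> regm n x (cj \<phi>)"
  then have \<phi>c: "\<phi> \<in> carrier_mat n n" and r: "regm n x (cj \<phi>)" by auto
  show "\<phi> \<in> end_stalk n P (Smooth x)" unfolding end_stalk_def
  proof (intro CollectI conjI ballI \<phi>c)
    fix v assume "v \<in> P (Smooth x)"
    then obtain w where w: "w \<in> standard_stalk n (Smooth x)" "v = g *\<^sub>v w" by (auto simp: stalk)
    have wc: "w \<in> carrier_vec n" using w by (simp add: standard_stalk_def)
    have "g *\<^sub>v (cj \<phi> *\<^sub>v w) = (g * cj \<phi>) *\<^sub>v w"
      using g cj_carrier[OF \<phi>c] wc by (intro assoc_mult_mat_vec[symmetric])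
    also have "g * cj \<phi> = \<phi> * g"
      using g g' \<phi>c by (simp add: cj_def assoc_mult_mat[of _ n n _ n _ n] g_g'_mult)
    also have "(\<phi> * g) *\<^sub>v w = \<phi> *\<^sub>v v" using g \<phi>c wc w by (simp add: assoc_mult_mat_vec[of _ n n _ n])
    finally have e: "\<phi> *\<^sub>v v = g *\<^sub>v (cj \<phi> *\<^sub>v w)" ..
    have "regular_at x (vec_index (cj \<phi> *\<^sub>v w) i)" if i: "i < n" for i
    proof -
      have "vec_index (cj \<phi> *\<^sub>v w) i = (\<Sum>k<n. cj \<phi> $$ (i, k) * vec_index w k)"
        using cj_carrier[OF \<phi>c] wc i by (simp add: scalar_prod_def atLeast0LessThan)
      moreover have "regular_at x (cj \<phi> $$ (i, k) * vec_index w k)" if "k < n" for k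
        using w(1) that i by (intro regular_mult regmD(2)[OF r]) (auto simp: standard_stalk_def)
      ultimately show ?thesis by (simp only:) (intro regular_sum, simp)
    qed
    then have "cj \<phi> *\<^sub>v w \<in> standard_stalk n (Smooth x)"
      using cj_carrier[OF \<phi>c] wc by (auto simp: standard_stalk_def)
    then show "\<phi> *\<^sub>v v \<in> P (Smooth x)" unfolding e stalk by (rule imageI)
  qed
qed

lemma ad_iff: "\<phi> \<in> ad_stalk n P (Smooth x) \<longleftrightarrow> \<phi> \<in> carrier_mat n n \<and> tr \<phi> = 0 \<and> regm n x (cj \<phi>)"
  by (auto simp: ad_stalk_def end_iff)

abbreviation ad where "ad \<equiv> ad_stalk n P (Smooth x)"

lemma ad_carrier: "\<phi> \<in> ad \<Longrightarrow> \<phi> \<in> carrier_mat n n"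
  and ad_tr: "\<phi> \<in> ad \<Longrightarrow> tr \<phi> = 0" and ad_regm: "\<phi> \<in> ad \<Longrightarrow> regm n x (cj \<phi>)"
  by (simp_all add: ad_iff)

text \<open>Identifies the fibre at x with traceless complex matrices by means of the frame. The
  frame is an arbitrary one; the comparison with \<xi> is made by \<open>\<Psi>\<close>
  below.\<close>

definition ev :: "ratfun mat \<Rightarrow> complex mat" where "ev \<phi> = val x (cj \<phi>)"

lemma ad_add: "\<phi> \<in> ad \<Longrightarrow> \<psi> \<in> ad \<Longrightarrow> \<phi> + \<psi> \<in> ad"
  by (simp add: ad_iff tr_add[of _ n] cj_add regm_add)

lemma ad_minus: "\<phi> \<in> ad \<Longrightarrow> \<psi> \<in> ad \<Longrightarrow> \<phi> - \<psi> \<in> ad"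
  by (simp add: ad_iff tr_minus[of _ n] cj_minus regm_minus minus_carrier_mat)

lemma ad_smult: "regular_at x h \<Longrightarrow> \<phi> \<in> ad \<Longrightarrow> h \<cdot>\<^sub>m \<phi> \<in> ad"
  by (simp add: ad_iff tr_smult[of _ n] cj_smult regm_smult)

lemma ad_com: "\<phi> \<in> ad \<Longrightarrow> \<psi> \<in> ad \<Longrightarrow> com \<phi> \<psi> \<in> ad"
  using com_sl[of \<phi> n \<psi>] by (simp add: ad_iff cj_com regm_com sl_def)

lemma ev_add: "\<phi> \<in> ad \<Longrightarrow> \<psi> \<in> ad \<Longrightarrow> ev (\<phi> + \<psi>) = ev \<phi> + ev \<psi>"
  by (simp add: ev_def ad_iff cj_add val_add[of n])

lemma ev_minus: "\<phi> \<in> ad \<Longrightarrow> \<psi> \<in> ad \<Longrightarrow> ev (\<phi> - \<psi>) = ev \<phi> - ev \<psi>"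
  by (simp add: ev_def ad_iff cj_minus val_minus[of n])

lemma ev_smult: "regular_at x h \<Longrightarrow> \<phi> \<in> ad \<Longrightarrow> ev (h \<cdot>\<^sub>m \<phi>) = value_at x h \<cdot>\<^sub>m ev \<phi>"
  by (simp add: ev_def ad_iff cj_smult val_smult[where n = n])

lemma ev_com: "\<phi> \<in> ad \<Longrightarrow> \<psi> \<in> ad \<Longrightarrow> ev (com \<phi> \<psi>) = com (ev \<phi>) (ev \<psi>)"
  by (simp add: ev_def ad_iff cj_com val_com[of n])

lemma ev_sl: "\<phi> \<in> ad \<Longrightarrow> ev \<phi> \<in> sl n"
  using value_tr[of n x "cj \<phi>"] by (auto simp: ev_def ad_iff sl_def tr_cj value_0 cj_carrier)

lemma fibre_form_ev: "\<phi> \<in> ad \<Longrightarrow> \<psi> \<in> ad \<Longrightarrow> fibre_form x \<phi> \<psi> = tr (ev \<phi> * ev \<psi>)"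
proof -
  assume \<phi>: "\<phi> \<in> ad" and \<psi>: "\<psi> \<in> ad"
  note c = ad_carrier[OF \<phi>] ad_carrier[OF \<psi>] and r = ad_regm[OF \<phi>] ad_regm[OF \<psi>]
  have "tr (\<phi> * \<psi>) = tr (cj \<phi> * cj \<psi>)"
    using tr_cj[OF mult_carrier_mat[OF c]] by (simp add: cj_mult c)
  then show ?thesis
    unfolding fibre_form_def ev_def by (simp add: value_tr[OF regm_mult[OF r]] val_mult[OF r])
qed

lemma ev_zero_factor:
  assumes \<phi>: "\<phi> \<in> ad" and z: "ev \<phi> = 0\<^sub>m n n"
  shows "inverse (zfun - const x) \<cdot>\<^sub>m \<phi> \<in> ad"
proof -
  let ?h = "inverse (zfun - const x)"
  note c = ad_carrier[OF \<phi>]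
  have "value_at x (cj \<phi> $$ (i, j)) = 0" if "i < n" "j < n" for i j
  proof -
    have "ev \<phi> $$ (i, j) = 0" unfolding z using that by simp
    then show ?thesis using that cj_carrier[OF c] by (simp add: ev_def)
  qed
  then have "regm n x (?h \<cdot>\<^sub>m cj \<phi>)"
    using cj_carrier[OF c] regmD(2)[OF ad_regm[OF \<phi>]] by (auto simp: regm_def zero_value_factor)
  then show ?thesis using c ad_tr[OF \<phi>] by (simp add: ad_iff cj_smult tr_smult[of _ n])
qed

lemma smult_inverse_cancel:
  "\<phi> \<in> carrier_mat n n \<Longrightarrow> (zfun - const x) \<cdot>\<^sub>m (inverse (zfun - const x) \<cdot>\<^sub>m \<phi>) = \<phi>"
  using zfun_minus_const_nz[of x] by (intro eq_matI) auto

text \<open>The kernel of \<open>ev\<close> on the stalk is the stalk times z - x: one inclusion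
  holds because z - x has value 0 at x, the other by \<open>ev_zero_factor\<close>.\<close>

lemma fibre_eq_iff: "fibre_eq n P x a b \<longleftrightarrow> a \<in> ad \<and> b \<in> ad \<and> ev a = ev b"
proof (intro iffI conjI)
  assume f: "fibre_eq n P x a b"
  then show a: "a \<in> ad" and b: "b \<in> ad" by (simp_all add: fibre_eq_def)
  obtain h where h: "h \<in> ad" "a - b = (zfun - const x) \<cdot>\<^sub>m h" using f by (auto simp: fibre_eq_def)
  have "ev a - ev b = ev (a - b)" by (rule ev_minus[OF a b, symmetric])
  also have "\<dots> = 0 \<cdot>\<^sub>m ev h" unfolding h(2) using ev_smult[OF regular_zfun h(1), of x] value_zfun[of x x] by simp
  finally have e: "ev a - ev b = 0 \<cdot>\<^sub>m ev h" .
  note cc = sl_carrier[OF ev_sl[OF a]] sl_carrier[OF ev_sl[OF b]] sl_carrier[OF ev_sl[OF h(1)]]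
  have "(ev a - ev b) $$ (i, j) = 0" if "i < n" "j < n" for i j unfolding e using cc that by simp
  then show "ev a = ev b" using cc by (intro eq_matI) auto
next
  assume a: "a \<in> ad \<and> b \<in> ad \<and> ev a = ev b"
  then have d: "a - b \<in> ad" by (simp add: ad_minus)
  have "ev (a - b) = 0\<^sub>m n n" using a ev_minus[of a b] sl_carrier[OF ev_sl[of b]] by (simp add: minus_r_inv_mat)
  then have "inverse (zfun - const x) \<cdot>\<^sub>m (a - b) \<in> ad" by (rule ev_zero_factor[OF d])
  moreover have "a - b = (zfun - const x) \<cdot>\<^sub>m (inverse (zfun - const x) \<cdot>\<^sub>m (a - b))"
    by (rule smult_inverse_cancel[OF ad_carrier[OF d], symmetric])
  ultimately show "fibre_eq n P x a b" unfolding fibre_eq_def using a by blast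
qed

end

lemma frame_exists:
  assumes "vector_bundle n P" "x \<noteq> 0"
  obtains g g' where "frame n P x g g'"
proof -
  have "Smooth x \<in> E_curve" using assms by (simp add: E_curve_def smooth_part_def)
  then obtain g where g: "stalk_frame n P (Smooth x) g" using assms by (auto simp: vector_bundle_def)
  then have gc: "g \<in> carrier_mat n n" and "det g \<noteq> 0" by (auto simp: stalk_frame_def)
  then have "g \<in> Units (ring_mat TYPE(ratfun) n ())" by (rule det_non_zero_imp_unit)
  then obtain g' where "g' \<in> carrier_mat n n" "g' * g = 1\<^sub>m n" "g * g' = 1\<^sub>m n"
    by (auto simp: Units_def ring_mat_def)
  then have "frame n P x g g'" using g gc by unfold_locales (auto simp: stalk_frame_def)
  then show ?thesis by (rule that)
qed

section \<open>The geometric tensor\<close>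

lemma smooth_functions_iff: "h \<in> smooth_functions \<longleftrightarrow> (\<forall>x. x \<noteq> 0 \<longrightarrow> regular_at x h)"
  by (auto simp: smooth_functions_def smooth_part_def)

lemma map_const_add: "A \<in> carrier_mat n n \<Longrightarrow> B \<in> carrier_mat n n \<Longrightarrow> map_mat const (A + B) = map_mat const A + map_mat const B"
  by (intro eq_matI) (auto simp: const_add)

lemma map_const_smult: "map_mat const (a \<cdot>\<^sub>m A) = const a \<cdot>\<^sub>m map_mat const A"
  by (intro eq_matI) (auto simp: const_mult)

lemma map_const_mult:
  assumes "A \<in> carrier_mat n n" "B \<in> carrier_mat n n"
  shows "map_mat const (A * B) = map_mat const A * map_mat const B"
  using assms by (intro eq_matI) (auto simp: scalar_prod_def const_sum const_mult)

lemma map_const_com: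
  assumes "A \<in> carrier_mat n n" "B \<in> carrier_mat n n"
  shows "map_mat const (com A B) = com (map_mat const A) (map_mat const B)"
  using assms by (intro eq_matI) (auto simp: com_def const_diff map_const_mult[OF assms, symmetric] map_const_mult[OF assms(2,1), symmetric])

lemma val_const: "val x (map_mat const e) = e"
  by (intro eq_matI) (auto simp: value_const)

locale trivialization = shift c d n for c d n +
  fixes P :: vbundle and \<xi> :: "ratfun mat \<Rightarrow> ratfun mat"
  assumes vb: "vector_bundle n P" and triv: "is_trivialization c d P \<xi>"
begin

abbreviation Sm where "Sm \<equiv> ad_smooth_sections n P"

lemma Sm_iff: "\<phi> \<in> Sm \<longleftrightarrow> (\<forall>x. x \<noteq> 0 \<longrightarrow> \<phi> \<in> ad_stalk n P (Smooth x))"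
  by (auto simp: ad_smooth_sections_def smooth_part_def)

lemma xi_bij: "bij_betw \<xi> Sm {A \<in> sl n. \<forall>i<n. \<forall>j<n. A $$ (i, j) \<in> smooth_functions}"
  and xi_add: "\<phi> \<in> Sm \<Longrightarrow> \<psi> \<in> Sm \<Longrightarrow> \<xi> (\<phi> + \<psi>) = \<xi> \<phi> + \<xi> \<psi>"
  and xi_com: "\<phi> \<in> Sm \<Longrightarrow> \<psi> \<in> Sm \<Longrightarrow> \<xi> (com \<phi> \<psi>) = com (\<xi> \<phi>) (\<xi> \<psi>)"
  and xi_smult: "h \<in> smooth_functions \<Longrightarrow> \<phi> \<in> Sm \<Longrightarrow> \<xi> (h \<cdot>\<^sub>m \<phi>) = h \<cdot>\<^sub>m \<xi> \<phi>"
  and xi_Sol: "x \<noteq> 0 \<Longrightarrow> xi_bar \<xi> x ` ad_twist_sections n P x = map_mat to_fract ` Sol c d x"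
  using triv unfolding is_trivialization_def com_def n_eq by blast+

lemma xi_regm: "\<phi> \<in> Sm \<Longrightarrow> x \<noteq> 0 \<Longrightarrow> regm n x (\<xi> \<phi>)"
  and xi_carrier: "\<phi> \<in> Sm \<Longrightarrow> \<xi> \<phi> \<in> carrier_mat n n"
  using bij_betwE[OF xi_bij] by (auto simp: regm_def smooth_functions_iff sl_def)

lemma xi_inj: "\<phi> \<in> Sm \<Longrightarrow> \<psi> \<in> Sm \<Longrightarrow> \<xi> \<phi> = \<xi> \<psi> \<Longrightarrow> \<phi> = \<psi>"
  using xi_bij by (auto simp: bij_betw_def inj_on_def)

lemma Sm_carrier: "\<phi> \<in> Sm \<Longrightarrow> \<phi> \<in> carrier_mat n n"
  using Sm_iff[of \<phi>] by (auto simp: ad_stalk_def end_stalk_def dest: spec[of _ 1])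

lemma Sm_add: "\<phi> \<in> Sm \<Longrightarrow> \<psi> \<in> Sm \<Longrightarrow> \<phi> + \<psi> \<in> Sm"
  and Sm_minus: "\<phi> \<in> Sm \<Longrightarrow> \<psi> \<in> Sm \<Longrightarrow> \<phi> - \<psi> \<in> Sm"
  and Sm_com: "\<phi> \<in> Sm \<Longrightarrow> \<psi> \<in> Sm \<Longrightarrow> com \<phi> \<psi> \<in> Sm"
  and Sm_smult: "h \<in> smooth_functions \<Longrightarrow> \<phi> \<in> Sm \<Longrightarrow> h \<cdot>\<^sub>m \<phi> \<in> Sm"
  unfolding Sm_iff smooth_functions_iff
  by (metis frame_exists[OF vb] frame.ad_add, metis frame_exists[OF vb] frame.ad_minus,
      metis frame_exists[OF vb] frame.ad_com, metis frame_exists[OF vb] frame.ad_smult)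

text \<open>The section over the smooth part that \<xi> makes constant. Such sections represent the
  elements of all fibres at once.\<close>

definition S :: "complex mat \<Rightarrow> ratfun mat" where "S e = inv_into Sm \<xi> (map_mat const e)"

lemma const_smooth: "const a \<in> smooth_functions"
  by (simp add: smooth_functions_iff regular_const)

lemma S_in: "e \<in> sl n \<Longrightarrow> S e \<in> Sm" and xi_S: "e \<in> sl n \<Longrightarrow> \<xi> (S e) = map_mat const e"
proof -
  assume e: "e \<in> sl n"
  have "(\<Sum>i<n. map_mat const e $$ (i, i)) = const (\<Sum>i<n. e $$ (i, i))"
    unfolding const_sum using sl_carrier[OF e] by (intro sum.cong) auto
  then have "map_mat const e \<in> sl n" using sl_sum[OF e] sl_carrier[OF e] by (intro slI) (auto simp: const_0)
  then have "map_mat const e \<in> \<xi> ` Sm"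
    using xi_bij sl_carrier[OF e] by (auto simp: bij_betw_def const_smooth)
  then show "S e \<in> Sm" "\<xi> (S e) = map_mat const e" unfolding S_def by (auto intro: inv_into_into f_inv_into_f)
qed

lemma S_add: "e \<in> sl n \<Longrightarrow> f \<in> sl n \<Longrightarrow> S (e + f) = S e + S f"
  by (rule xi_inj) (simp_all add: S_in Sm_add sl_add xi_add xi_S map_const_add[OF sl_carrier sl_carrier])

lemma S_smult: "e \<in> sl n \<Longrightarrow> S (a \<cdot>\<^sub>m e) = const a \<cdot>\<^sub>m S e"
  by (rule xi_inj) (simp_all add: S_in Sm_smult const_smooth sl_smult xi_smult xi_S map_const_smult)

lemma S_com: "e \<in> sl n \<Longrightarrow> f \<in> sl n \<Longrightarrow> S (com e f) = com (S e) (S f)"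
  by (rule xi_inj) (simp_all add: S_in Sm_com com_sl sl_carrier xi_com xi_S map_const_com[OF sl_carrier sl_carrier])

end

locale trivialization_at = trivialization c d n P \<xi> + frame n P x g g' for c d n P \<xi> x g g' +
  assumes x0: "x \<noteq> 0"
begin

lemma Sm_ad: "\<phi> \<in> Sm \<Longrightarrow> \<phi> \<in> ad"
  using x0 by (simp add: Sm_iff)

text \<open>For sections of constant matrices this shows that \<open>\<Psi>\<close> is injective. It is then surjective by
  dimension, so that every germ agrees at \<open>x\<close> with such a section and no approximation is needed.\<close>

lemma val_xi_zero:
  assumes s: "s \<in> Sm" and z: "ev s = 0\<^sub>m n n"
  shows "val x (\<xi> s) = 0\<^sub>m n n"
proof -
  let ?h = "inverse (zfun - const x) \<cdot>\<^sub>m s"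
  \<comment> \<open>A section that vanishes in the fibre at x is z - x times another section: away
    from x the factor is a unit, and at x its removal is \<open>ev_zero_factor\<close>. Linearity of
    \<xi> over the smooth functions then carries the factor over.\<close>
  have h: "?h \<in> Sm" unfolding Sm_iff
  proof (intro allI impI)
    fix y :: complex assume y: "y \<noteq> 0"
    show "?h \<in> ad_stalk n P (Smooth y)"
    proof (cases "y = x")
      case True
      then show ?thesis using ev_zero_factor[OF Sm_ad[OF s] z] by simp
    next
      case False
      obtain k k' where "frame n P y k k'" using frame_exists[OF vb y] .
      then show ?thesis using regular_inverse_zfun[OF False] s y frame.ad_smult by (auto simp: Sm_iff)
    qed
  qed
  have zs: "zfun - const x \<in> smooth_functions" by (simp add: smooth_functions_iff regular_zfun)
  have "\<xi> s = (zfun - const x) \<cdot>\<^sub>m \<xi> ?h"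
    using xi_smult[OF zs h] smult_inverse_cancel[OF Sm_carrier[OF s]] by simp
  then have "val x (\<xi> s) = 0 \<cdot>\<^sub>m val x (\<xi> ?h)"
    using val_smult[OF regular_zfun xi_regm[OF h x0], of x] by (simp add: value_zfun)
  also have "\<dots> = 0\<^sub>m n n" using xi_carrier[OF h] by (intro eq_matI) auto
  finally show ?thesis .
qed

text \<open>The change of coordinates on the fibre at x, from those of \<xi> to those of the
  frame.\<close>

definition \<Psi> :: "complex mat \<Rightarrow> complex mat" where "\<Psi> e = ev (S e)"

lemma Psi_lie:
  shows Psi_surj: "\<And>t. t \<in> sl n \<Longrightarrow> \<exists>e\<in>sl n. \<Psi> e = t"
    and Psi_tr: "\<And>e f. e \<in> sl n \<Longrightarrow> f \<in> sl n \<Longrightarrow> tr (\<Psi> e * \<Psi> f) = tr (e * f)"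
proof -
  have 1: "\<Psi> e \<in> sl n" if "e \<in> sl n" for e
    unfolding \<Psi>_def by (intro ev_sl Sm_ad S_in that)
  have 2: "\<Psi> (e + f) = \<Psi> e + \<Psi> f" if "e \<in> sl n" "f \<in> sl n" for e f
    unfolding \<Psi>_def S_add[OF that] by (intro ev_add Sm_ad S_in that)
  have 3: "\<Psi> (s \<cdot>\<^sub>m e) = s \<cdot>\<^sub>m \<Psi> e" if "e \<in> sl n" for s e
    unfolding \<Psi>_def S_smult[OF that] ev_smult[OF regular_const Sm_ad[OF S_in[OF that]]] value_const ..
  have 4: "\<Psi> (com e f) = com (\<Psi> e) (\<Psi> f)" if "e \<in> sl n" "f \<in> sl n" for e f
    unfolding \<Psi>_def S_com[OF that] by (intro ev_com Sm_ad S_in that)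
  have 5: "e = 0\<^sub>m n n" if "e \<in> sl n" "\<Psi> e = 0\<^sub>m n n" for e
    using val_xi_zero[OF S_in[OF that(1)]] that by (simp add: \<Psi>_def xi_S val_const)
  show "\<And>t. t \<in> sl n \<Longrightarrow> \<exists>e\<in>sl n. \<Psi> e = t" by (rule lie_mono_surj[OF n_pos 1 2 3 4 5])
  show "\<And>e f. e \<in> sl n \<Longrightarrow> f \<in> sl n \<Longrightarrow> tr (\<Psi> e * \<Psi> f) = tr (e * f)" by (rule lie_mono_tr[OF n_pos 1 2 3 4 5])
qed

abbreviation X where "X \<equiv> xi_fibre n P \<xi> x"

text \<open>Two sections with the same class at x differ by a section vanishing there, so by
  \<open>val_xi_zero\<close> they have the same value under \<xi>. Hence the description in
  \<open>xi_fibre\<close> is unambiguous.\<close>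

lemma X_eqI:
  assumes a: "a \<in> ad" and s: "s \<in> Sm" "ev s = ev a"
  shows "X a = val x (\<xi> s)"
  unfolding xi_fibre_def
proof (rule the_equality)
  show "\<exists>s'\<in>Sm. fibre_eq n P x s' a \<and> val x (\<xi> s) = val x (\<xi> s')"
    using s a Sm_ad by (auto simp: fibre_eq_iff)
  fix m assume "\<exists>s'\<in>Sm. fibre_eq n P x s' a \<and> m = val x (\<xi> s')"
  then obtain s' where s': "s' \<in> Sm" "fibre_eq n P x s' a" "m = val x (\<xi> s')" by blast
  have d: "s' - s \<in> Sm" by (rule Sm_minus[OF s'(1) s(1)])
  have "ev (s' - s) = ev s' - ev s" by (intro ev_minus Sm_ad s s')
  also have "\<dots> = 0\<^sub>m n n" using s'(2) s(2) sl_carrier[OF ev_sl[OF a]] by (simp add: fibre_eq_iff minus_r_inv_mat)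
  finally have z: "val x (\<xi> (s' - s)) = 0\<^sub>m n n" by (rule val_xi_zero[OF d])
  have "s' = (s' - s) + s" using Sm_carrier[OF s(1)] Sm_carrier[OF s'(1)] by (intro eq_matI) auto
  then have "\<xi> s' = \<xi> (s' - s) + \<xi> s" using xi_add[OF d s(1)] by simp
  then show "m = val x (\<xi> s)"
    unfolding s'(3) using val_add[OF xi_regm[OF d x0] xi_regm[OF s(1) x0]] z xi_carrier[OF s(1)] by simp
qed

lemma X_sec: "s \<in> Sm \<Longrightarrow> X s = val x (\<xi> s)"
  by (rule X_eqI[OF Sm_ad _ refl])

lemma X_S: "e \<in> sl n \<Longrightarrow> X (S e) = e"
  by (simp add: X_sec S_in xi_S val_const)

lemma X_eqI': "a \<in> ad \<Longrightarrow> e \<in> sl n \<Longrightarrow> ev (S e) = ev a \<Longrightarrow> X a = e"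
  using X_eqI[of a "S e"] S_in xi_S val_const by simp

lemma X_props:
  assumes a: "a \<in> ad"
  shows X_sl: "X a \<in> sl n" and ev_S_X: "ev (S (X a)) = ev a"
proof -
  obtain e where e: "e \<in> sl n" "ev (S e) = ev a" using Psi_surj[OF ev_sl[OF a]] by (auto simp: \<Psi>_def)
  then have "X a = e" by (intro X_eqI' a)
  then show "X a \<in> sl n" "ev (S (X a)) = ev a" using e by auto
qed

text \<open>The form is defined by the frame; invariance of the trace form under
  \<open>\<Psi>\<close> allows computing it in the coordinates of \<xi>.\<close>

lemma X_form: "a \<in> ad \<Longrightarrow> b \<in> ad \<Longrightarrow> fibre_form x a b = tr (X a * X b)"
  using Psi_tr[OF X_sl X_sl, of a b] by (simp add: fibre_form_ev \<Psi>_def ev_S_X)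

lemma fibre_eq_X: "fibre_eq n P x a b \<longleftrightarrow> a \<in> ad \<and> b \<in> ad \<and> X a = X b"
  unfolding fibre_eq_iff using ev_S_X X_eqI'[OF _ X_sl] by metis

lemma X_add: "a \<in> ad \<Longrightarrow> b \<in> ad \<Longrightarrow> X (a + b) = X a + X b"
  by (rule X_eqI') (simp_all add: ad_add sl_add X_sl S_add ev_add Sm_ad S_in ev_S_X)

lemma X_smult: "regular_at x h \<Longrightarrow> a \<in> ad \<Longrightarrow> X (h \<cdot>\<^sub>m a) = value_at x h \<cdot>\<^sub>m X a"
  by (rule X_eqI') (simp_all add: ad_smult sl_smult X_sl S_smult ev_smult Sm_ad S_in ev_S_X regular_const value_const)

lemma X_list:
  assumes "snd ` set ts \<subseteq> ad"
  shows "mat n n (\<lambda>p. \<Sum>(a, b)\<leftarrow>ts. const (f a) * b $$ p) \<in> ad \<and>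
    X (mat n n (\<lambda>p. \<Sum>(a, b)\<leftarrow>ts. const (f a) * b $$ p)) = mat n n (\<lambda>p. \<Sum>(a, b)\<leftarrow>ts. f a * X b $$ p)"
  using assms
proof (induction ts)
  case Nil
  have z: "mat n n (\<lambda>p. \<Sum>(a, b)\<leftarrow>[]. const (f a) * b $$ p) = S (0\<^sub>m n n)"
  proof -
    have "S (0\<^sub>m n n) = S (0 \<cdot>\<^sub>m 0\<^sub>m n n)" by (rule arg_cong[of _ _ S]) (intro eq_matI, auto)
    also have "\<dots> = const 0 \<cdot>\<^sub>m S (0\<^sub>m n n)" by (rule S_smult[OF sl_zero])
    also have "\<dots> = 0\<^sub>m n n" using Sm_carrier[OF S_in[OF sl_zero]] by (intro eq_matI) (auto simp: const_0)
    finally show ?thesis by (intro eq_matI) auto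
  qed
  show ?case unfolding z using Sm_ad[OF S_in[OF sl_zero]] X_S[OF sl_zero] by (auto intro!: eq_matI)
next
  case (Cons t ts)
  obtain a b where t: "t = (a, b)" by (cases t)
  have b: "b \<in> ad" using Cons.prems by (simp add: t)
  let ?M = "mat n n (\<lambda>p. \<Sum>(a, b)\<leftarrow>ts. const (f a) * b $$ p)"
  have IH: "?M \<in> ad" "X ?M = mat n n (\<lambda>p. \<Sum>(a, b)\<leftarrow>ts. f a * X b $$ p)" using Cons by auto
  have e: "mat n n (\<lambda>p. \<Sum>(a, b)\<leftarrow>t # ts. const (f a) * b $$ p) = const (f a) \<cdot>\<^sub>m b + ?M"
    using ad_carrier[OF b] by (intro eq_matI) (auto simp: t)
  have cb: "const (f a) \<cdot>\<^sub>m b \<in> ad" by (rule ad_smult[OF regular_const b])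
  have "X (const (f a) \<cdot>\<^sub>m b + ?M) = f a \<cdot>\<^sub>m X b + X ?M"
    unfolding X_add[OF cb IH(1)] X_smult[OF regular_const b] value_const ..
  also have "\<dots> = mat n n (\<lambda>p. \<Sum>(a, b)\<leftarrow>t # ts. f a * X b $$ p)"
    unfolding IH(2) using sl_carrier[OF X_sl[OF b]] by (intro eq_matI) (auto simp: t)
  finally show ?case unfolding e using ad_add[OF cb IH(1)] by simp
qed

end

context trivialization begin

lemma point_exists:
  assumes "x \<noteq> 0"
  obtains g g' where "trivialization_at c d n P \<xi> x g g'"
proof -
  obtain g g' where "frame n P x g g'" using frame_exists[OF vb assms] .
  then have "trivialization_at c d n P \<xi> x g g'"
    using trivialization_axioms assms by (intro trivialization_at.intro trivialization_at_axioms.intro)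
  then show ?thesis by (rule that)
qed

text \<open>The product s of z - x with \<phi> is a section over the smooth part with \<xi> s = F.
  The residue is s/z and \<phi> itself is s/(z - x); these factors are regular at x and at y, with
  values 1/x and 1/(y - x).\<close>

lemma xi_fibre_twist:
  assumes x: "x \<noteq> 0" and y: "y \<noteq> 0" and xy: "x \<noteq> y"
    and \<phi>: "\<phi> \<in> ad_twist_sections n P x" and F: "F \<in> Sol c d x" "xi_bar \<xi> x \<phi> = map_mat to_fract F"
  shows "residue_rep x \<phi> \<in> ad_stalk n P (Smooth x)" 
    and "xi_fibre n P \<xi> x (residue_rep x \<phi>) = (1 / x) \<cdot>\<^sub>m mat_at x F"
    and "\<phi> \<in> ad_stalk n P (Smooth y)" and "xi_fibre n P \<xi> y \<phi> = (1 / (y - x)) \<cdot>\<^sub>m mat_at y F"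
proof -
  obtain g g' where px: "trivialization_at c d n P \<xi> x g g'" using point_exists[OF x] .
  obtain k k' where py: "trivialization_at c d n P \<xi> y k k'" using point_exists[OF y] .
  interpret px: trivialization_at c d n P \<xi> x g g' by (rule px)
  interpret py: trivialization_at c d n P \<xi> y k k' by (rule py)
  let ?s = "(zfun - const x) \<cdot>\<^sub>m \<phi>"
  have other: "\<phi> \<in> ad_stalk n P (Smooth w)" if "w \<noteq> 0" "w \<noteq> x" for w
    using \<phi> that by (auto simp: ad_twist_sections_def E_curve_def smooth_part_def)
  have s: "?s \<in> Sm" unfolding Sm_iff
  proof (intro allI impI)
    fix w :: complex assume w: "w \<noteq> 0"
    show "?s \<in> ad_stalk n P (Smooth w)"
    proof (cases "w = x")
      case True
      then show ?thesis using \<phi> by (simp add: ad_twist_sections_def)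
    next
      case False
      obtain h h' where "frame n P w h h'" using frame_exists[OF vb w] .
      then show ?thesis using frame.ad_smult[OF _ regular_zfun other[OF w False]] by blast
    qed
  qed
  have xs: "\<xi> ?s = map_mat to_fract F" using F(2) by (simp add: xi_bar_def)
  have val: "val w (map_mat to_fract F) = mat_at w F" for w
    by (intro eq_matI) (auto simp: mat_at_def value_to_fract)
  have \<phi>c: "\<phi> \<in> carrier_mat n n" using py.ad_carrier[OF other[OF y]] xy by simp
  have z0: "zfun - const 0 = zfun" by (simp add: const_0)
  have iz: "inverse zfun \<in> smooth_functions"
    using regular_inverse_zfun[of _ 0] by (simp add: smooth_functions_iff z0)
  have r: "residue_rep x \<phi> = inverse zfun \<cdot>\<^sub>m ?s"
    unfolding residue_rep_def by (intro eq_matI) (auto simp: divide_inverse mult_ac)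
  have rS: "inverse zfun \<cdot>\<^sub>m ?s \<in> Sm" by (rule Sm_smult[OF iz s])
  then show "residue_rep x \<phi> \<in> ad_stalk n P (Smooth x)" unfolding r by (rule px.Sm_ad)
  have "regular_at x (inverse zfun)" "value_at x (inverse zfun) = 1 / x"
    using regular_inverse_zfun[of x 0] value_inverse_zfun[of x 0] x by (simp_all add: z0)
  then show "xi_fibre n P \<xi> x (residue_rep x \<phi>) = (1 / x) \<cdot>\<^sub>m mat_at x F"
    unfolding r using px.X_smult[of "inverse zfun" ?s] px.Sm_ad[OF s] px.X_sec[OF s] xs val by simp
  show \<phi>y: "\<phi> \<in> ad_stalk n P (Smooth y)" using other[OF y] xy by simp
  have e: "\<phi> = inverse (zfun - const x) \<cdot>\<^sub>m ?s"
    using \<phi>c zfun_minus_const_nz[of x] by (intro eq_matI) auto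
  have yx: "y \<noteq> x" using xy by simp
  have "xi_fibre n P \<xi> y \<phi> = xi_fibre n P \<xi> y (inverse (zfun - const x) \<cdot>\<^sub>m ?s)" using e by simp
  also have "\<dots> = (1 / (y - x)) \<cdot>\<^sub>m mat_at y F"
    unfolding py.X_smult[OF regular_inverse_zfun[OF yx] py.Sm_ad[OF s]] value_inverse_zfun[OF yx] py.X_sec[OF s] xs val ..
  finally show "xi_fibre n P \<xi> y \<phi> = (1 / (y - x)) \<cdot>\<^sub>m mat_at y F" .
qed

text \<open>Carries the defining property of \<rho> over to polynomial matrices: the pairing at x by
  \<open>X_form\<close>, the congruence at y by \<open>fibre_eq_X\<close>, and the range of the
  sections by \<open>xi_Sol\<close>.\<close>

lemma represents_rho_iff:
  assumes x: "x \<noteq> 0" and y: "y \<noteq> 0" and xy: "x \<noteq> y"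
    and ts: "set ts \<subseteq> ad_stalk n P (Smooth x) \<times> ad_stalk n P (Smooth y)"
  shows "represents_rho n P x y ts \<longleftrightarrow> (\<forall>F\<in>Sol c d x. mat n n (\<lambda>p. \<Sum>(a, b)\<leftarrow>ts.
      tr (xi_fibre n P \<xi> x a * ((1 / x) \<cdot>\<^sub>m mat_at x F)) * xi_fibre n P \<xi> y b $$ p) = (1 / (y - x)) \<cdot>\<^sub>m mat_at y F)"
proof -
  obtain g g' where px: "trivialization_at c d n P \<xi> x g g'" using point_exists[OF x] .
  obtain k k' where py: "trivialization_at c d n P \<xi> y k k'" using point_exists[OF y] .
  interpret px: trivialization_at c d n P \<xi> x g g' by (rule px)
  interpret py: trivialization_at c d n P \<xi> y k k' by (rule py)
  let ?E = "\<lambda>F. mat n n (\<lambda>p. \<Sum>(a, b)\<leftarrow>ts.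
      tr (xi_fibre n P \<xi> x a * ((1 / x) \<cdot>\<^sub>m mat_at x F)) * xi_fibre n P \<xi> y b $$ p) = (1 / (y - x)) \<cdot>\<^sub>m mat_at y F"
  let ?R = "\<lambda>\<phi>. fibre_eq n P y
          (mat n n (\<lambda>p. \<Sum>(a, b)\<leftarrow>ts. const (fibre_form x a (residue_rep x \<phi>)) * b $$ p)) \<phi>"
  have key: "?R \<phi> \<longleftrightarrow> ?E F" if \<phi>: "\<phi> \<in> ad_twist_sections n P x" and F: "F \<in> Sol c d x" "xi_bar \<xi> x \<phi> = map_mat to_fract F" for \<phi> F
  proof -
    note tw = xi_fibre_twist[OF x y xy \<phi> F]
    let ?M = "mat n n (\<lambda>p. \<Sum>(a, b)\<leftarrow>ts. const (fibre_form x a (residue_rep x \<phi>)) * b $$ p)"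
    have "snd ` set ts \<subseteq> ad_stalk n P (Smooth y)" using ts by auto
    note L = py.X_list[OF this, of "\<lambda>a. fibre_form x a (residue_rep x \<phi>)"]
    have "mat n n (\<lambda>p. \<Sum>(a, b)\<leftarrow>ts. fibre_form x a (residue_rep x \<phi>) * py.X b $$ p)
      = mat n n (\<lambda>p. \<Sum>(a, b)\<leftarrow>ts. tr (px.X a * ((1 / x) \<cdot>\<^sub>m mat_at x F)) * py.X b $$ p)"
    proof (intro eq_matI)
      fix i j assume "i < dim_row (mat n n (\<lambda>p. \<Sum>(a, b)\<leftarrow>ts. tr (px.X a * ((1 / x) \<cdot>\<^sub>m mat_at x F)) * py.X b $$ p))"
        "j < dim_col (mat n n (\<lambda>p. \<Sum>(a, b)\<leftarrow>ts. tr (px.X a * ((1 / x) \<cdot>\<^sub>m mat_at x F)) * py.X b $$ p))"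
      then have ij: "i < n" "j < n" by auto
      have "fibre_form x a (residue_rep x \<phi>) = tr (px.X a * ((1 / x) \<cdot>\<^sub>m mat_at x F))" if "(a, b) \<in> set ts" for a b
        using that ts px.X_form[OF _ tw(1), of a] tw(2) by auto
      then show "mat n n (\<lambda>p. \<Sum>(a, b)\<leftarrow>ts. fibre_form x a (residue_rep x \<phi>) * py.X b $$ p) $$ (i, j)
        = mat n n (\<lambda>p. \<Sum>(a, b)\<leftarrow>ts. tr (px.X a * ((1 / x) \<cdot>\<^sub>m mat_at x F)) * py.X b $$ p) $$ (i, j)"
        using ij by (auto intro!: arg_cong[of _ _ sum_list] map_cong)
    qed auto
    then show ?thesis using L tw(3,4) by (simp add: py.fibre_eq_X)
  qed
  have "(\<forall>\<phi>\<in>ad_twist_sections n P x. ?R \<phi>) \<longleftrightarrow> (\<forall>F\<in>Sol c d x. ?E F)"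
  proof
    assume R: "\<forall>\<phi>\<in>ad_twist_sections n P x. ?R \<phi>"
    show "\<forall>F\<in>Sol c d x. ?E F"
    proof
      fix F assume F: "F \<in> Sol c d x"
      then have "map_mat to_fract F \<in> xi_bar \<xi> x ` ad_twist_sections n P x" unfolding xi_Sol[OF x] by (rule imageI)
      then obtain \<phi> where "\<phi> \<in> ad_twist_sections n P x" "map_mat to_fract F = xi_bar \<xi> x \<phi>" by (rule imageE) blast
      then show "?E F" using key[of \<phi> F] F R by auto
    qed
  next
    assume E: "\<forall>F\<in>Sol c d x. ?E F"
    show "\<forall>\<phi>\<in>ad_twist_sections n P x. ?R \<phi>"
    proof
      fix \<phi> assume \<phi>: "\<phi> \<in> ad_twist_sections n P x"
      then have "xi_bar \<xi> x \<phi> \<in> map_mat to_fract ` Sol c d x" unfolding xi_Sol[OF x, symmetric] by (rule imageI)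
      then obtain F where "F \<in> Sol c d x" "xi_bar \<xi> x \<phi> = map_mat to_fract F" by (rule imageE) blast
      then show "?R \<phi>" using key[of \<phi> F] \<phi> E by auto
    qed
  qed
  then show ?thesis using ts by (simp add: represents_rho_def)
qed

end

locale trivialization_basis = trivialization c d n P \<xi> + shift_basis c d n B for c d n P \<xi> B
begin

lemma sl_tensor_list:
  assumes "\<And>a b. (a, b) \<in> set ts \<Longrightarrow> f a \<in> sl n"
  shows "sl_tensor n (\<Sum>(a, b)\<leftarrow>ts. f a \<otimes>\<^sub>t h b)"
  using assms
proof (induction ts)
  case Nil
  then show ?case using sl_tensor_zero by (simp only: list.map sum_list.Nil)
next
  case (Cons t ts)
  obtain a b where t: "t = (a, b)" by (cases t)
  have "sl_tensor n (f a \<otimes>\<^sub>t h b + (\<Sum>(a, b)\<leftarrow>ts. f a \<otimes>\<^sub>t h b))"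
    using Cons by (intro sl_tensor_add sl_tensor_tensor) (auto simp: t)
  then show ?case by (simp only: t list.map sum_list.Cons prod.case)
qed

lemma contr_list:
  assumes "\<And>a b. (a, b) \<in> set ts \<Longrightarrow> f a \<in> sl n \<and> h b \<in> sl n" and U: "U \<in> sl n"
  shows "contr n (\<Sum>(a, b)\<leftarrow>ts. f a \<otimes>\<^sub>t h b) U (k, l) = (if k < n \<and> l < n then \<Sum>(a, b)\<leftarrow>ts. tr (f a * U) * h b $$ (k, l) else 0)"
  using assms(1)
proof (induction ts)
  case Nil
  then show ?case using contr_zero by (simp only: list.map sum_list.Nil if_cancel)
next
  case (Cons t ts)
  obtain a b where t: "t = (a, b)" by (cases t)
  have "f a \<in> carrier_mat n n" "h b \<in> carrier_mat n n" using Cons.prems[of a b] by (auto simp: t sl_carrier)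
  moreover have "contr n (\<Sum>(a, b)\<leftarrow>ts. f a \<otimes>\<^sub>t h b) U (k, l) = (if k < n \<and> l < n then \<Sum>(a, b)\<leftarrow>ts. tr (f a * U) * h b $$ (k, l) else 0)"
    by (rule Cons.IH) (use Cons.prems in auto)
  ultimately
  have "contr n (f a \<otimes>\<^sub>t h b + (\<Sum>(a, b)\<leftarrow>ts. f a \<otimes>\<^sub>t h b)) U (k, l) 
    = (if k < n \<and> l < n then tr (f a * U) * h b $$ (k, l) + (\<Sum>(a, b)\<leftarrow>ts. tr (f a * U) * h b $$ (k, l)) else 0)"
    unfolding contr_add using contr_tensor[OF _ _ sl_carrier[OF U], of "f a" "h b" "(k, l)"] by simp
  then show ?case by (simp only: t list.map sum_list.Cons prod.case)
qed

text \<open>Algebra meets geometry here: as a linear map, the closed formula is evaluation at y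
  after the inverse of the residue at x.\<close>

lemma contr_rform_Sol:
  assumes F: "F \<in> Sol c d x" and x: "x \<noteq> 0" "x \<noteq> y" and kl: "k < n" "l < n"
  shows "contr n (rform x y) ((1 / x) \<cdot>\<^sub>m mat_at x F) (k, l) = ((1 / (y - x)) \<cdot>\<^sub>m mat_at y F) $$ (k, l)"
proof -
  have U: "(1 / x) \<cdot>\<^sub>m mat_at x F \<in> sl n" by (intro sl_smult mat_at_sl Sol_sl[OF F])
  have "((1 / (y - x)) \<cdot>\<^sub>m mat_at y F) $$ (k, l) = poly (F $$ (k, l)) y / (y - x)"
    using sl_carrier[OF Sol_sl[OF F]] kl by (simp add: mat_at_def)
  also note Sol_eval[OF F x kl]
  finally show ?thesis using contr_rform[OF U x(2), of k l] kl by simp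
qed

text \<open>Every traceless U is a residue, so the contractions of a representing list are
  prescribed, and all such lists give one tensor. A representing list must also be exhibited, as
  \<open>rho_xi\<close> is a definite description.\<close>

lemma rho_xi_eq:
  assumes x: "x \<noteq> 0" and y: "y \<noteq> 0" and xy: "x \<noteq> y"
  shows "rho_xi n P \<xi> x y = rform x y"
proof -
  obtain g g' where px: "trivialization_at c d n P \<xi> x g g'" using point_exists[OF x] .
  obtain k k' where py: "trivialization_at c d n P \<xi> y k k'" using point_exists[OF y] .
  interpret px: trivialization_at c d n P \<xi> x g g' by (rule px)
  interpret py: trivialization_at c d n P \<xi> y k k' by (rule py)
  have Sol_of: "\<exists>F\<in>Sol c d x. U = (1 / x) \<cdot>\<^sub>m mat_at x F" if U: "U \<in> sl n" for U
  proof -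
    obtain F where F: "F \<in> Sol c d x" "mat_at x F = x \<cdot>\<^sub>m U" using Sol_surj[OF U x] .
    have "(1 / x) \<cdot>\<^sub>m mat_at x F = U" unfolding F(2) using x sl_carrier[OF U] by (intro eq_matI) auto
    then show ?thesis using F by blast
  qed
  have uniq: "(\<Sum>(a, b)\<leftarrow>ts. px.X a \<otimes>\<^sub>t py.X b) = rform x y" if rep: "represents_rho n P x y ts" for ts
  proof (rule tensor_eqI[OF sl_tensor_list sl_tensor_rform])
    have ts: "set ts \<subseteq> px.ad \<times> py.ad" using rep by (simp add: represents_rho_def)
    then show "px.X a \<in> sl n" if "(a, b) \<in> set ts" for a b using that px.X_sl by auto
    fix U :: "complex mat" and q :: "nat \<times> nat" assume U: "U \<in> sl n"
    obtain F where F: "F \<in> Sol c d x" "U = (1 / x) \<cdot>\<^sub>m mat_at x F" using Sol_of[OF U] by blast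
    obtain i j where q: "q = (i, j)" by (cases q)
    have sl: "px.X a \<in> sl n \<and> py.X b \<in> sl n" if "(a, b) \<in> set ts" for a b
      using that ts px.X_sl py.X_sl by auto
    have M: "mat n n (\<lambda>p. \<Sum>(a, b)\<leftarrow>ts. tr (px.X a * U) * py.X b $$ p) = (1 / (y - x)) \<cdot>\<^sub>m mat_at y F"
      using represents_rho_iff[OF x y xy ts] rep F by simp
    have "(\<Sum>(a, b)\<leftarrow>ts. tr (px.X a * U) * py.X b $$ (i, j)) = ((1 / (y - x)) \<cdot>\<^sub>m mat_at y F) $$ (i, j)"
      if "i < n" "j < n" using arg_cong[OF M, of "\<lambda>A. A $$ (i, j)"] that by simp
    then show "contr n (\<Sum>(a, b)\<leftarrow>ts. px.X a \<otimes>\<^sub>t py.X b) U q = contr n (rform x y) U q"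
      using contr_list[of ts px.X py.X, OF sl U, of i j] contr_rform_Sol[OF F(1) x xy, of i j] contr_rform[OF U xy, of i j]
      unfolding q F(2)[symmetric] by (cases "i < n \<and> j < n") auto
  qed
  have "\<exists>ts. represents_rho n P x y ts"
  proof -
    obtain bs where bs: "set bs = B" "distinct bs" using finite_distinct_list[OF finite_B] by blast
    \<comment> \<open>The image of a dual vector under evaluation after inverse residue;
      tracelessness follows by writing it as F(y)/(y - x).\<close>
    define Kd where "Kd b = mat n n (\<lambda>p. contr n (rform x y) (dual_vector n B b) p)" for b
    have Kd_sl: "Kd b \<in> sl n" if b: "b \<in> B" for b
    proof -
      obtain F where F: "F \<in> Sol c d x" "dual_vector n B b = (1 / x) \<cdot>\<^sub>m mat_at x F" 
        using Sol_of[OF dual_sl[OF b]] by blast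
      have sl: "(1 / (y - x)) \<cdot>\<^sub>m mat_at y F \<in> sl n" by (intro sl_smult mat_at_sl Sol_sl[OF F(1)])
      have "Kd b = (1 / (y - x)) \<cdot>\<^sub>m mat_at y F"
        unfolding Kd_def F(2)
      proof (rule eq_matI)
        fix i j assume "i < dim_row ((1 / (y - x)) \<cdot>\<^sub>m mat_at y F)" "j < dim_col ((1 / (y - x)) \<cdot>\<^sub>m mat_at y F)"
        then have ij: "i < n" "j < n" using carrier_matD[OF sl_carrier[OF sl]] by simp_all
        then show "mat n n (contr n (rform x y) ((1 / x) \<cdot>\<^sub>m mat_at x F)) $$ (i, j) = ((1 / (y - x)) \<cdot>\<^sub>m mat_at y F) $$ (i, j)"
          using contr_rform_Sol[OF F(1) x xy ij] by simp
      qed (use carrier_matD[OF sl_carrier[OF sl]] in simp_all)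
      then show ?thesis using sl by simp
    qed
    \<comment> \<open>The expansion of the tensor along the basis, lifted from constant matrices to
      germs by \<open>S\<close>.\<close>
    define ts where "ts = map (\<lambda>b. (S b, S (Kd b))) bs"
    have ts: "set ts \<subseteq> px.ad \<times> py.ad"
      using px.Sm_ad[OF S_in[OF B_sl]] py.Sm_ad[OF S_in[OF Kd_sl]] by (auto simp: ts_def bs)
    have "represents_rho n P x y ts"
      unfolding represents_rho_iff[OF x y xy ts]
    proof (intro ballI eq_matI)
      fix F i j assume F: "F \<in> Sol c d x" and "i < dim_row ((1 / (y - x)) \<cdot>\<^sub>m mat_at y F)" "j < dim_col ((1 / (y - x)) \<cdot>\<^sub>m mat_at y F)"
      then have ij: "i < n" "j < n" using sl_carrier[OF Sol_sl[OF F]] by (auto simp: mat_at_def)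
      let ?U = "(1 / x) \<cdot>\<^sub>m mat_at x F"
      have U: "?U \<in> sl n" by (intro sl_smult mat_at_sl Sol_sl[OF F])
      have "(\<Sum>(a, b)\<leftarrow>ts. tr (px.X a * ?U) * py.X b $$ (i, j)) = (\<Sum>b\<in>B. tr (b * ?U) * Kd b $$ (i, j))"
        unfolding ts_def bs(1)[symmetric] sum_list_distinct_conv_sum_set[OF bs(2), symmetric] map_map o_def prod.case
        by (intro arg_cong[of _ _ sum_list] map_cong refl) (simp add: bs(1) px.X_S py.X_S B_sl Kd_sl)
      also have "\<dots> = contr n (rform x y) ?U (i, j)"
        using contr_expand[OF U, of "rform x y" "(i, j)"] ij by (simp add: Kd_def)
      also have "\<dots> = ((1 / (y - x)) \<cdot>\<^sub>m mat_at y F) $$ (i, j)" by (rule contr_rform_Sol[OF F x xy ij])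
      finally show "mat n n (\<lambda>p. \<Sum>(a, b)\<leftarrow>ts. tr (px.X a * ?U) * py.X b $$ p) $$ (i, j) = ((1 / (y - x)) \<cdot>\<^sub>m mat_at y F) $$ (i, j)"
        using ij by simp
    qed (use sl_carrier[OF Sol_sl] in \<open>auto simp: mat_at_def\<close>)
    then show ?thesis by blast
  qed
  then obtain ts where rep: "represents_rho n P x y ts" by blast
  show ?thesis
    unfolding rho_xi_def
  proof (rule the_equality)
    show "\<exists>ts. represents_rho n P x y ts \<and> rform x y = (\<Sum>(a, b)\<leftarrow>ts. px.X a \<otimes>\<^sub>t py.X b)"
      using rep uniq[OF rep, symmetric] by (intro exI[of _ ts] conjI)
    fix r assume "\<exists>ts. represents_rho n P x y ts \<and> r = (\<Sum>(a, b)\<leftarrow>ts. px.X a \<otimes>\<^sub>t py.X b)"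
    then obtain ts' where "represents_rho n P x y ts'" "r = (\<Sum>(a, b)\<leftarrow>ts'. px.X a \<otimes>\<^sub>t py.X b)" by blast
    then show "r = rform x y" by (simp only: uniq)
  qed
qed

end

section \<open>The Lagrangian order\<close>

context shift begin

definition blockA :: "complex mat \<Rightarrow> complex mat" where "blockA M = mat c c (\<lambda>(i, j). M $$ (i, j))"
definition blockB :: "complex mat \<Rightarrow> complex mat" where "blockB M = mat c d (\<lambda>(i, j). M $$ (i, j + c))"
definition blockC :: "complex mat \<Rightarrow> complex mat" where "blockC M = mat d c (\<lambda>(i, j). M $$ (i + c, j))"
definition blockD :: "complex mat \<Rightarrow> complex mat" where "blockD M = mat d d (\<lambda>(i, j). M $$ (i + c, j + c))"

lemmas block_defs = blockA_def blockB_def blockC_def blockD_def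

lemma block_carrier: "blockA M \<in> carrier_mat c c" "blockB M \<in> carrier_mat c d"
    "blockC M \<in> carrier_mat d c" "blockD M \<in> carrier_mat d d"
  by (simp_all add: block_defs)

lemma four_block: "M \<in> carrier_mat n n \<Longrightarrow> four_block_mat (blockA M) (blockB M) (blockC M) (blockD M) = M"
  by (rule eq_matI) (auto simp: block_defs cd_eq sub_less)

lemma four_block_index:
  assumes "A \<in> carrier_mat c c" "B \<in> carrier_mat c d" "C \<in> carrier_mat d c" "D \<in> carrier_mat d d" "i < n" "j < n"
  shows "four_block_mat A B C D $$ (i, j) = (if i < c then if j < c then A $$ (i, j) else B $$ (i, j - c)
    else if j < c then C $$ (i - c, j) else D $$ (i - c, j - c))"
  using assms by (auto simp: cd_eq)

lemma b_par_iff: "H \<in> b_par c d \<longleftrightarrow> H \<in> sl n \<and> (\<forall>q\<in>UR. H $$ q = 0)"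
proof
  assume H: "H \<in> b_par c d"
  then obtain A C D where H_eq: "H = four_block_mat A (0\<^sub>m c d) C D"
    and car: "A \<in> carrier_mat c c" "C \<in> carrier_mat d c" "D \<in> carrier_mat d d" by (auto simp: b_par_def)
  have "H $$ q = 0" if qU: "q \<in> UR" for q
  proof -
    obtain i j where q: "q = (i, j)" "i < c" "c \<le> j" "j < n" using qU by (auto simp: UR_def)
    have "i < n" using q c_less by simp
    then show ?thesis unfolding H_eq q(1)
      using four_block_index[OF car(1) _ car(2,3), of "0\<^sub>m c d" i j] q sub_less[of j] by simp
  qed
  then show "H \<in> sl n \<and> (\<forall>q\<in>UR. H $$ q = 0)" using H by (auto simp: b_par_def n_eq)
next
  assume H: "H \<in> sl n \<and> (\<forall>q\<in>UR. H $$ q = 0)"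
  have "blockB H = 0\<^sub>m c d"
  proof (rule eq_matI)
    fix i j assume "i < dim_row (0\<^sub>m c d :: complex mat)" "j < dim_col (0\<^sub>m c d :: complex mat)"
    then have ij: "i < c" "j < d" by auto
    then have "j + c < n" using n_eq by simp
    then have "(i, j + c) \<in> UR" using ij by (simp add: UR_def)
    then show "blockB H $$ (i, j) = 0\<^sub>m c d $$ (i, j)" using H ij by (simp add: blockB_def)
  qed (simp_all add: blockB_def)
  then have "H = four_block_mat (blockA H) (0\<^sub>m c d) (blockC H) (blockD H)"
    using four_block[of H] H by (simp add: sl_carrier)
  then show "H \<in> b_par c d" using H block_carrier[of H] unfolding b_par_def n_eq[symmetric] by blast
qed

lemma n_par_iff: "N \<in> n_par c d \<longleftrightarrow> N \<in> carrier_mat n n \<and> (\<forall>q\<in>{..<n} \<times> {..<n}. q \<notin> LL \<longrightarrow> N $$ q = 0)"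
proof
  assume "N \<in> n_par c d"
  then obtain C where N: "N = four_block_mat (0\<^sub>m c c) (0\<^sub>m c d) C (0\<^sub>m d d)" and C: "C \<in> carrier_mat d c"
    by (auto simp: n_par_def)
  have "N $$ (i, j) = 0" if "i < n" "j < n" "(i, j) \<notin> LL" for i j
    using four_block_index[OF _ _ C, of "0\<^sub>m c c" "0\<^sub>m c d" "0\<^sub>m d d" i j] that sub_less[of j] sub_less[of i]
    unfolding N by (auto simp: LL_def)
  then show "N \<in> carrier_mat n n \<and> (\<forall>q\<in>{..<n} \<times> {..<n}. q \<notin> LL \<longrightarrow> N $$ q = 0)"
    unfolding N using C by (auto simp: cd_eq)
next
  assume N: "N \<in> carrier_mat n n \<and> (\<forall>q\<in>{..<n} \<times> {..<n}. q \<notin> LL \<longrightarrow> N $$ q = 0)"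
  have z: "N $$ (i, j) = 0" if "i < n" "j < n" "i < c \<or> c \<le> j" for i j
    using N that by (auto simp: LL_def)
  have "blockA N = 0\<^sub>m c c"
  proof (rule eq_matI)
    fix i j assume "i < dim_row (0\<^sub>m c c :: complex mat)" "j < dim_col (0\<^sub>m c c :: complex mat)"
    then show "blockA N $$ (i, j) = 0\<^sub>m c c $$ (i, j)" using z[of i j] c_less by (simp add: blockA_def)
  qed (simp_all add: blockA_def)
  moreover have "blockB N = 0\<^sub>m c d"
  proof (rule eq_matI)
    fix i j assume "i < dim_row (0\<^sub>m c d :: complex mat)" "j < dim_col (0\<^sub>m c d :: complex mat)"
    then show "blockB N $$ (i, j) = 0\<^sub>m c d $$ (i, j)" using z[of i "j + c"] n_eq by (simp add: blockB_def)
  qed (simp_all add: blockB_def)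
  moreover have "blockD N = 0\<^sub>m d d"
  proof (rule eq_matI)
    fix i j assume "i < dim_row (0\<^sub>m d d :: complex mat)" "j < dim_col (0\<^sub>m d d :: complex mat)"
    then show "blockD N $$ (i, j) = 0\<^sub>m d d $$ (i, j)" using z[of "i + c" "j + c"] n_eq by (simp add: blockD_def)
  qed (simp_all add: blockD_def)
  ultimately have "N = four_block_mat (0\<^sub>m c c) (0\<^sub>m c d) (blockC N) (0\<^sub>m d d)"
    using four_block[of N] N by simp
  then show "N \<in> n_par c d" using block_carrier[of N] unfolding n_par_def by blast
qed

text \<open>Entrywise coordinates on the order, with \<open>M\<close> the parameter in the Lie
  algebra. As \<open>fls_X\<close> is the inverse of z, the upper right entries of \<open>M\<close>
  appear in degree -1 in z and the lower left ones in degree 1.\<close>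

definition W_elem :: "complex fps mat \<Rightarrow> complex mat \<Rightarrow> complex mat \<Rightarrow> complex mat \<Rightarrow> double" where
  "W_elem G H N M = (mat n n (\<lambda>q. fls_X\<^sup>2 * fps_to_fls (G $$ q) + fls_X * fls_const (H $$ q) + fls_const (N $$ q)
      + (if q \<in> UR then fls_X else if q \<in> LL then fls_X_inv else 1) * fls_const (M $$ q)),
    mat n n (\<lambda>q. M $$ tau n c q))"

lemma W_elem_eq:
  assumes G: "G \<in> carrier_mat n n" and H: "H \<in> carrier_mat n n" and N: "N \<in> carrier_mat n n"
    and car: "A \<in> carrier_mat c c" "B \<in> carrier_mat c d" "C \<in> carrier_mat d c" "D \<in> carrier_mat d d"
  shows "(fls_X\<^sup>2 \<cdot>\<^sub>m map_mat fps_to_fls G + fls_X \<cdot>\<^sub>m map_mat fls_const H + map_mat fls_const N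
         + four_block_mat (map_mat fls_const A) (fls_X \<cdot>\<^sub>m map_mat fls_const B)
             (fls_X_inv \<cdot>\<^sub>m map_mat fls_const C) (map_mat fls_const D),
       sharp c (four_block_mat A B C D)) = W_elem G H N (four_block_mat A B C D)"
    (is "(?F, sharp c ?M) = _")
proof -
  have Mc: "?M \<in> carrier_mat n n" using car by (auto simp: cd_eq)
  have "?F = fst (W_elem G H N ?M)"
  proof (rule eq_matI)
    fix i j assume "i < dim_row (fst (W_elem G H N ?M))" "j < dim_col (fst (W_elem G H N ?M))"
    then have ij: "i < n" "j < n" by (simp_all add: W_elem_def)
    show "?F $$ (i, j) = fst (W_elem G H N ?M) $$ (i, j)"
      using ij G H N car sub_less[of i] sub_less[of j] by (auto simp: W_elem_def UR_def LL_def cd_eq)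
  qed (use G H N car in \<open>auto simp: W_elem_def cd_eq\<close>)
  moreover have "sharp c ?M = snd (W_elem G H N ?M)"
    by (rule eq_matI) (use sharp_carrier[OF Mc] in \<open>auto simp: W_elem_def sharp_index[OF Mc]\<close>)
  ultimately show ?thesis by (metis prod.collapse)
qed

lemma W_order_iff:
  "w \<in> W_order c d \<longleftrightarrow> (\<exists>G H N M. G \<in> sl n \<and> H \<in> b_par c d \<and> N \<in> n_par c d \<and> M \<in> sl n \<and> w = W_elem G H N M)"
proof
  assume "w \<in> W_order c d"
  then obtain G H N A B C D where w: "w = (fls_X\<^sup>2 \<cdot>\<^sub>m map_mat fps_to_fls G + fls_X \<cdot>\<^sub>m map_mat fls_const H + map_mat fls_const N
         + four_block_mat (map_mat fls_const A) (fls_X \<cdot>\<^sub>m map_mat fls_const B)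
             (fls_X_inv \<cdot>\<^sub>m map_mat fls_const C) (map_mat fls_const D),
       sharp c (four_block_mat A B C D))" and mem: "G \<in> sl n" "H \<in> b_par c d" "N \<in> n_par c d"
       "A \<in> carrier_mat c c" "B \<in> carrier_mat c d" "C \<in> carrier_mat d c" "D \<in> carrier_mat d d"
       "four_block_mat A B C D \<in> sl n"
    unfolding W_order_def n_eq[symmetric] by blast
  have "w = W_elem G H N (four_block_mat A B C D)"
    unfolding w using mem by (intro W_elem_eq) (auto simp: b_par_iff n_par_iff sl_carrier)
  then show "\<exists>G H N M. G \<in> sl n \<and> H \<in> b_par c d \<and> N \<in> n_par c d \<and> M \<in> sl n \<and> w = W_elem G H N M"
    using mem by blast
next
  assume "\<exists>G H N M. G \<in> sl n \<and> H \<in> b_par c d \<and> N \<in> n_par c d \<and> M \<in> sl n \<and> w = W_elem G H N M"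
  then obtain G H N M where mem: "G \<in> sl n" "H \<in> b_par c d" "N \<in> n_par c d" "M \<in> sl n" and w: "w = W_elem G H N M" by blast
  have Hc: "H \<in> carrier_mat n n" and Nc: "N \<in> carrier_mat n n"
    using mem by (auto simp: b_par_iff n_par_iff sl_carrier)
  note M = four_block[OF sl_carrier[OF mem(4)]]
  have "W_elem G H N (four_block_mat (blockA M) (blockB M) (blockC M) (blockD M)) = w" by (simp only: M w)
  note w_eq = trans[OF W_elem_eq[OF sl_carrier[OF mem(1)] Hc Nc block_carrier[of M]] this, symmetric]
  have "four_block_mat (blockA M) (blockB M) (blockC M) (blockD M) \<in> sl n" using M mem(4) by simp
  with w_eq show "w \<in> W_order c d"
    unfolding W_order_def n_eq[symmetric] using mem(1-3) block_carrier[of M] by blast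
qed

lemma W_elem_nth:
  assumes "i < n" "j < n"
  shows "fls_nth (fst (W_elem G H N M) $$ (i, j)) m =
    (if m \<ge> 2 then fps_nth (G $$ (i, j)) (nat (m - 2)) else 0) + (if m = 1 then H $$ (i, j) else 0) + (if m = 0 then N $$ (i, j) else 0)
     + (if m = (if (i, j) \<in> UR then 1 else if (i, j) \<in> LL then -1 else 0) then M $$ (i, j) else 0)"
proof -
  have "fls_nth (fls_X\<^sup>2 * fps_to_fls f) m = (if m \<ge> 2 then fps_nth f (nat (m - 2)) else 0)" for f :: "complex fps"
    by (simp add: fls_X_power_conv_shift_1 fls_shifted_times_simps)
  then show ?thesis using assms by (simp add: W_elem_def)
qed

end

definition coef :: "complex fls mat \<Rightarrow> int \<Rightarrow> complex mat" where
  "coef F m = map_mat (\<lambda>f. fls_nth f m) F"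

lemma coef_carrier: "F \<in> carrier_mat n n \<Longrightarrow> coef F m \<in> carrier_mat n n"
  by (simp add: coef_def)

text \<open>Multiplying by z^k moves the coefficient of z^-k into the place that the form reads. The
  second component of the embedding is the value at z = 0, nonzero only for k = 0.\<close>

lemma form_j_emb:
  assumes b: "b \<in> carrier_mat n n" and F: "F \<in> carrier_mat n n" and f: "f \<in> carrier_mat n n"
  shows "form (j_emb (map_mat (\<lambda>a. monom a k) b)) (F, f) = tr (b * coef F (int k)) - (if k = 0 then tr (b * f) else 0)"
proof -
  let ?v = "j_emb (map_mat (\<lambda>a. monom a k) b)"
  have fst: "fst ?v = map_mat (\<lambda>a. fls_const a * fls_X_inv ^ k) b"
    unfolding j_emb_def using b by (intro eq_matI) (auto simp: map_poly_monom poly_monom)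
  have snd: "snd ?v = (if k = 0 then b else 0\<^sub>m n n)"
    unfolding j_emb_def using b by (intro eq_matI) (auto simp: poly_monom)
  have "fst ?v \<in> carrier_mat n n" using b by (simp add: fst)
  then have "fls_nth (tr (fst ?v * F)) 0 = (\<Sum>i<n. \<Sum>j<n. fls_nth (fst ?v $$ (i, j) * F $$ (j, i)) 0)"
    using F by (simp add: tr_mult[of _ n] fls_nth_sum)
  also have "\<dots> = (\<Sum>i<n. \<Sum>j<n. b $$ (i, j) * coef F (int k) $$ (j, i))"
    using b F by (intro sum.cong refl) 
      (simp add: fst coef_def mult.assoc fls_X_inv_power_conv_shift_1 fls_shifted_times_simps)
  also have "\<dots> = tr (b * coef F (int k))" by (rule tr_mult[OF b coef_carrier[OF F], symmetric])
  finally have 1: "fls_nth (tr (fst ?v * F)) 0 = tr (b * coef F (int k))" .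
  have "tr (0\<^sub>m n n * f) = 0" using f by (simp add: tr_def left_mult_zero_mat[of _ n n])
  then show ?thesis unfolding form_def using 1 by (simp add: snd)
qed

lemma eval_fls_Laurent_poly:
  assumes y: "y \<noteq> 0" and f: "\<And>m. fls_nth f m = (if m \<ge> 1 then if m = int k then a else 0 else if m = 0 then u else if m = -1 then v else 0)"
  shows "eval_fls f (1 / y) = (if k \<ge> 1 then a / y ^ k else 0) + u + y * v"
proof (rule eval_fls_eq)
  show "-1 \<le> fls_subdegree f"
  proof (cases "f = 0")
    case False
    then show ?thesis by (rule fls_subdegree_geI) (simp add: f)
  qed simp
  show "0 \<le> fls_subdegree f \<or> 1 / y \<noteq> 0" using y by simp
  \<comment> \<open>Summation starts at exponent -1, so index m belongs to exponent m - 1 and the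
    power y^-k to m = k + 1. For k = 0 that place is the constant term, which u alone accounts
    for.\<close>
  have e: "fls_nth f (int m + - 1) * (1 / y) powi (int m + - 1) =
     (if m = Suc k then if k \<ge> 1 then a / y ^ k else 0 else 0) + (if m = 1 then u else 0) + (if m = 0 then y * v else 0)" for m
  proof -
    consider "m = 0" | "m = 1" | l where "m = Suc l" "l \<ge> 1" by (cases m) (auto, metis One_nat_def Suc_leI not_gr0)
    then show ?thesis
    proof cases
      case 1
      then show ?thesis using y by (simp add: f power_int_minus)
    next
      case 2
      then show ?thesis by (simp add: f)
    next
      case 3
      then show ?thesis by (simp add: f power_inverse divide_inverse)
    qed
  qed
  show "(\<lambda>m. fls_nth f (int m + - 1) * (1 / y) powi (int m + - 1)) sums ((if k \<ge> 1 then a / y ^ k else 0) + u + y * v)"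
    unfolding e by (intro sums_add sums_single[of _ "\<lambda>_. _"])
qed

context shift_basis begin

section \<open>The element of the order dual to a basis vector times a power of z\<close>

context
  fixes k :: nat and b :: "complex mat"
  assumes bB: "b \<in> B"
begin

abbreviation "bstar \<equiv> dual_vector n B b"
text \<open>Right-hand sides of the system for the dual element: \<open>Gk\<close> for the pairings
  with constant matrices, \<open>bk\<close> for those with multiples of z. For k > 1 both
  vanish.\<close>

definition Gk :: "nat \<times> nat \<Rightarrow> complex" where "Gk q = (if k = 0 then bstar $$ q else 0)"
definition bk :: "nat \<times> nat \<Rightarrow> complex" where "bk q = (if k = 1 then bstar $$ q else 0)"
definition Ak :: "nat \<times> nat \<Rightarrow> complex" where
  "Ak q = (if q \<in> UR then bk q else if q \<in> LL then X1 Gk q else X0 Gk bk q)"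

definition paired :: "double \<Rightarrow> bool" where
  "paired w \<longleftrightarrow> (\<forall>k'. \<forall>b'\<in>B. form (j_emb (map_mat (\<lambda>a. monom a k') b')) w = (if k' = k \<and> b' = b then 1 else 0))"

text \<open>The predicted Laurent coefficients, indexed by the exponent of the inverse of z: the
  dual vector at z^-k when k is positive, and the correction X0 + z X1.\<close>

definition w_nth :: "nat \<times> nat \<Rightarrow> int \<Rightarrow> complex" where
  "w_nth q m = (if m \<ge> 1 then if m = int k then bstar $$ q else 0 else if m = 0 then X0 Gk bk q else if m = -1 then X1 Gk q else 0)"

lemma Gk_sum: "(\<Sum>i<n. Gk (i, i)) = 0"
  using sl_sum[OF dual_sl[OF bB]] unfolding Gk_def by (cases "k = 0") simp_all

lemma Ak_system: "system Gk bk Ak"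
  using system_exists[OF Gk_sum, of bk] unfolding Ak_def .

text \<open>By nondegeneracy the pairings with positive powers of z fix the coefficients in negative
  degrees. The pairing with constants fixes only the coefficient of z^0 minus the second component,
  which is the shift of \<open>M\<close>. Together with the shape of the order this is the system
  for \<open>M\<close>.\<close>

lemma nth_w:
  assumes mem: "G \<in> sl n" "H \<in> b_par c d" "N \<in> n_par c d" "M \<in> sl n" 
    and p: "paired (W_elem G H N M)" and ij: "i < n" "j < n"
  shows "fls_nth (fst (W_elem G H N M) $$ (i, j)) m = w_nth (i, j) m" and "M $$ (i, j) = Ak (i, j)"
proof -
  let ?w = "W_elem G H N M"
  define F where "F = fst ?w"
  define f where "f = snd ?w"
  have Fc: "F \<in> carrier_mat n n" and fc: "f \<in> carrier_mat n n" by (simp_all add: F_def f_def W_elem_def)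
  have H: "H \<in> sl n" "\<And>q. q \<in> UR \<Longrightarrow> H $$ q = 0" and N: "\<And>q. q \<in> {..<n} \<times> {..<n} \<Longrightarrow> q \<notin> LL \<Longrightarrow> N $$ q = 0"
    using mem by (auto simp: b_par_iff n_par_iff)
  have nth: "coef F m $$ (i, j) = (if m \<ge> 2 then fps_nth (G $$ (i, j)) (nat (m - 2)) else 0) + (if m = 1 then H $$ (i, j) else 0) + (if m = 0 then N $$ (i, j) else 0)
     + (if m = (if (i, j) \<in> UR then 1 else if (i, j) \<in> LL then -1 else 0) then M $$ (i, j) else 0)" if "i < n" "j < n" for i j m
    using W_elem_nth[OF that] Fc that by (simp add: coef_def F_def)
  have diag: "(i, i) \<notin> UR" "(i, i) \<notin> LL" for i by (auto simp: UR_def LL_def)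
  have pos_sl: "coef F m \<in> sl n" if "m \<ge> 1" for m
  proof (rule slI[OF coef_carrier[OF Fc]])
    have "(\<Sum>i<n. fps_nth (G $$ (i, i)) l) = 0" for l
      using sl_sum[OF mem(1)] by (simp add: fps_sum_nth[symmetric])
    then show "(\<Sum>i<n. coef F m $$ (i, i)) = 0"
      using that sl_sum[OF H(1)] by (cases "m = 1") (simp_all add: nth diag)
  qed
  have f_index: "f $$ (i, j) = M $$ tau n c (i, j)" if "i < n" "j < n" for i j
    using that by (simp add: f_def W_elem_def)
  have zero_sl: "coef F 0 - f \<in> sl n"
  proof (rule slI)
    show "(\<Sum>i<n. (coef F 0 - f) $$ (i, i)) = 0"
      using Fc fc sl_sum[OF mem(4)] sum_tau_diag[of "\<lambda>q. M $$ q"] N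
      by (simp add: sum_subtractf nth f_index diag coef_def[symmetric] del: coef_def)
  qed (use fc in \<open>simp add: minus_carrier_mat\<close>)
  have pair: "tr (b' * coef F (int k')) - (if k' = 0 then tr (b' * f) else 0) = (if k' = k \<and> b' = b then 1 else 0)"
    if b': "b' \<in> B" for k' b'
    using p b' form_j_emb[OF sl_carrier[OF B_sl[OF b']] Fc fc, of k']
    unfolding paired_def F_def f_def prod.collapse by auto
  have coef_pos: "coef F (int k') = (if k' = k then bstar else 0\<^sub>m n n)" if k': "k' \<ge> 1" for k'
  proof -
    note s = pos_sl[of "int k'"]
    have s: "coef F (int k') \<in> sl n" using k' by (intro pos_sl) simp
    have t: "tr (coef F (int k') * b') = (if k' = k \<and> b' = b then 1 else 0)" if "b' \<in> B" for b'
      using pair[OF that, of k'] k' tr_comm[OF sl_carrier[OF s] sl_carrier[OF B_sl[OF that]]] by simp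
    show ?thesis
    proof (cases "k' = k")
      case True
      then have "bstar = coef F (int k')" using t by (intro dual_eqI[OF bB s]) simp
      then show ?thesis using True by simp
    next
      case False
      then show ?thesis using nondegenerate_B[OF s] t by simp
    qed
  qed
  have coef_zero: "coef F 0 - f = (if k = 0 then bstar else 0\<^sub>m n n)"
  proof -
    have t: "tr ((coef F 0 - f) * b') = (if k = 0 \<and> b' = b then 1 else 0)" if b': "b' \<in> B" for b'
    proof -
      note bc = sl_carrier[OF B_sl[OF b']]
      have "tr ((coef F 0 - f) * b') = tr (b' * (coef F 0 - f))"
        by (rule tr_comm[OF sl_carrier[OF zero_sl] bc])
      also have "b' * (coef F 0 - f) = b' * coef F 0 - b' * f"
        by (rule mult_minus_distrib_mat[OF bc coef_carrier[OF Fc] fc])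
      also have "tr \<dots> = tr (b' * coef F 0) - tr (b' * f)"
        by (rule tr_minus[OF mult_carrier_mat[OF bc coef_carrier[OF Fc]] mult_carrier_mat[OF bc fc]])
      finally show ?thesis using pair[OF b', of 0] by auto
    qed
    show ?thesis
    proof (cases "k = 0")
      case True
      then have "bstar = coef F 0 - f" using t by (intro dual_eqI[OF bB zero_sl]) simp
      then show ?thesis using True by simp
    next
      case False
      then show ?thesis using nondegenerate_B[OF zero_sl] t by simp
    qed
  qed
  have Z: "coef F 0 $$ (i, j) - M $$ tau n c (i, j) = Gk (i, j)" if "i < n" "j < n" for i j
  proof -
    have "(coef F 0 - f) $$ (i, j) = coef F 0 $$ (i, j) - M $$ tau n c (i, j)"
      using Fc fc that by (simp add: f_index coef_carrier)
    then show ?thesis using that unfolding coef_zero Gk_def by (cases "k = 0") simp_all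
  qed
  \<comment> \<open>In the upper right block \<open>H\<close> vanishes, so the coefficient of the
    inverse of z shows \<open>M\<close> alone.\<close>
  have M_UR: "M $$ q = bk q" if qU: "q \<in> UR" for q
  proof -
    obtain i j where q: "q = (i, j)" "i < n" "j < n" using pos_roots_in[OF UR_pos[OF qU]] by auto
    have "coef F 1 $$ q = M $$ q" unfolding q(1) nth[OF q(2,3)] using qU H(2) by (simp add: q(1))
    then show ?thesis using coef_pos[of 1] q by (simp add: bk_def split: if_splits)
  qed
  have nUL: "q \<notin> LL" if "q \<in> UR" for q using that by (auto simp: UR_def LL_def)
  have sys: "system Gk bk (\<lambda>q. M $$ q)"
    unfolding system_def
  proof (intro conjI ballI impI sl_sum[OF mem(4)] M_UR)
    fix q assume q: "q \<in> {..<n} \<times> {..<n}" "q \<notin> UR" "q \<notin> LL"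
    obtain i j where ij: "q = (i, j)" "i < n" "j < n" using q by auto
    show "M $$ q - M $$ tau n c q = Gk q"
      using Z[OF ij(2,3)] nth[OF ij(2,3), of 0] q N[OF q(1)] by (simp add: ij(1))
  next
    fix q assume q: "q \<in> UR"
    obtain i j where ij: "q = (i, j)" "i < n" "j < n" using pos_roots_in[OF UR_pos[OF q]] by auto
    have "- M $$ tau n c q = Gk q"
      using Z[OF ij(2,3)] nth[OF ij(2,3), of 0] q nUL[OF q] N[of q] ij by simp
    then show "M $$ tau n c q = - Gk q" by (rule minus_equation_iff[THEN iffD1, symmetric])
  qed
  let ?q = "(i, j)"
  have q: "?q \<in> {..<n} \<times> {..<n}" using ij by simp
  note uniq = system_unique[OF sys Gk_sum q]
  show M_Ak: "M $$ ?q = Ak ?q" using M_UR uniq by (auto simp: Ak_def)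
  have "coef F m $$ ?q = w_nth ?q m"
  proof -
    consider "m \<ge> 1" | "m = 0" | "m < 0" by linarith
    then show ?thesis
    proof cases
      case 1
      then show ?thesis using coef_pos[of "nat m"] ij by (auto simp: w_nth_def)
    next
      case 2
      have "coef F 0 $$ ?q = X0 Gk bk ?q"
      proof (cases "?q \<in> UR")
        case True
        then show ?thesis using nth[OF ij, of 0] nUL[OF True] N[OF q] by (simp add: X0_UR)
      next
        case nUR: False
        show ?thesis
        proof (cases "?q \<in> LL")
          case True
          have "coef F 0 $$ ?q = Gk ?q + M $$ tau n c ?q" using Z[OF ij] by (simp add: diff_eq_eq)
          then show ?thesis using uniq(3)[OF True] by simp
        next
          case False
          then show ?thesis using nth[OF ij, of 0] nUR N[OF q] uniq(1) by simp
        qed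
      qed
      then show ?thesis using 2 by (simp add: w_nth_def)
    next
      case 3
      then show ?thesis using nth[OF ij, of m] nUL[of ?q] uniq(2) X1_notLL[of ?q Gk] by (auto simp: w_nth_def)
    qed
  qed
  then show "fls_nth (fst ?w $$ (i, j)) m = w_nth (i, j) m"
    using Fc ij by (simp add: coef_def F_def)
qed

lemma paired_unique:
  assumes "w \<in> W_order c d" "paired w" "w' \<in> W_order c d" "paired w'"
  shows "w = w'"
proof -
  obtain G H N M where w: "G \<in> sl n" "H \<in> b_par c d" "N \<in> n_par c d" "M \<in> sl n" "w = W_elem G H N M"
    using assms(1) by (auto simp: W_order_iff)
  obtain G' H' N' M' where w': "G' \<in> sl n" "H' \<in> b_par c d" "N' \<in> n_par c d" "M' \<in> sl n" "w' = W_elem G' H' N' M'"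
    using assms(3) by (auto simp: W_order_iff)
  have p: "paired (W_elem G H N M)" and p': "paired (W_elem G' H' N' M')" using assms w w' by auto
  note e = nth_w[OF w(1-4) p] and e' = nth_w[OF w'(1-4) p']
  have "fst w = fst w'"
  proof (rule eq_matI)
    fix i j assume "i < dim_row (fst w')" "j < dim_col (fst w')"
    then have ij: "i < n" "j < n" by (simp_all add: w'(5) W_elem_def)
    show "fst w $$ (i, j) = fst w' $$ (i, j)" unfolding w(5) w'(5)
      by (rule fls_eqI) (simp only: e(1)[OF ij] e'(1)[OF ij])
  qed (simp_all add: w(5) w'(5) W_elem_def)
  moreover have "snd w = snd w'"
  proof (rule eq_matI)
    fix i j assume "i < dim_row (snd w')" "j < dim_col (snd w')"
    then have ij: "i < n" "j < n" by (simp_all add: w'(5) W_elem_def)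
    obtain i' j' where t: "tau n c (i, j) = (i', j')" "i' < n" "j' < n" using tau_in[of "(i, j)"] by auto
    show "snd w $$ (i, j) = snd w' $$ (i, j)"
      using ij e(2)[OF t(2,3)] e'(2)[OF t(2,3)] by (simp add: w(5) w'(5) W_elem_def t(1))
  qed (simp_all add: w(5) w'(5) W_elem_def)
  ultimately show ?thesis by (rule prod_eqI)
qed

text \<open>The coefficients found in \<open>nth_w\<close> are distributed over the parameters:
  \<open>M\<close> solves the system, \<open>N\<close> supplies the constant terms in the lower left
  block, \<open>H\<close> the degree -1 part outside the upper right block, and \<open>G\<close> the
  dual vector for k at least 2, with exponent k - 2 because the order multiplies \<open>G\<close> by
  z^-2.\<close>

lemma paired_exists: "\<exists>w\<in>W_order c d. paired w"
proof -
  define G where "G = mat n n (\<lambda>q. if k \<ge> 2 then fps_const (bstar $$ q) * fps_X ^ (k - 2) else 0)"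
  define H where "H = mat n n (\<lambda>q. if k = 1 \<and> q \<notin> UR then bstar $$ q else 0)"
  define N where "N = mat n n (\<lambda>q. if q \<in> LL then X0 Gk bk q else 0)"
  define M where "M = mat n n Ak"
  note ac = sl_carrier[OF dual_sl[OF bB]] and as = sl_sum[OF dual_sl[OF bB]]
  have diag: "(i, i) \<notin> UR" "(i, i) \<notin> LL" for i by (auto simp: UR_def LL_def)
  have nUL: "q \<notin> LL" if "q \<in> UR" for q using that by (auto simp: UR_def LL_def)
  have G_sl: "G \<in> sl n"
  proof (rule slI)
    show "(\<Sum>i<n. G $$ (i, i)) = 0"
    proof (cases "k \<ge> 2")
      case True
      have "(\<Sum>i<n. fps_const (bstar $$ (i, i))) = fps_const (\<Sum>i<n. bstar $$ (i, i))"
        by (rule fps_ext) (simp add: fps_sum_nth)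
      then show ?thesis using True as by (simp add: G_def sum_distrib_right[symmetric])
    qed (simp add: G_def)
  qed (simp add: G_def)
  have H_b: "H \<in> b_par c d"
    unfolding b_par_iff
  proof (intro conjI ballI slI)
    show "(\<Sum>i<n. H $$ (i, i)) = 0" using as by (cases "k = 1") (simp_all add: H_def diag)
    show "H $$ q = 0" if "q \<in> UR" for q using that pos_roots_in[OF UR_pos[OF that]] by (cases q) (simp add: H_def)
  qed (simp add: H_def)
  have N_n: "N \<in> n_par c d" unfolding n_par_iff by (auto simp: N_def)
  have M_sl: "M \<in> sl n" using system_sum[OF Ak_system] by (intro slI) (simp_all add: M_def)
  let ?w = "W_elem G H N M"
  define F where "F = fst ?w"
  define f where "f = snd ?w"
  have Fc: "F \<in> carrier_mat n n" and fc: "f \<in> carrier_mat n n" by (simp_all add: F_def f_def W_elem_def)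
  have nth: "coef F m $$ (i, j) = (if m \<ge> 2 then fps_nth (G $$ (i, j)) (nat (m - 2)) else 0) + (if m = 1 then H $$ (i, j) else 0) + (if m = 0 then N $$ (i, j) else 0)
     + (if m = (if (i, j) \<in> UR then 1 else if (i, j) \<in> LL then -1 else 0) then M $$ (i, j) else 0)" if "i < n" "j < n" for i j m
    using W_elem_nth[OF that] Fc that by (simp add: coef_def F_def)
  have f_index: "f $$ (i, j) = Ak (tau n c (i, j))" if "i < n" "j < n" for i j
    using that tau_in[of "(i, j)"] by (cases "tau n c (i, j)") (auto simp: f_def W_elem_def M_def)
  have coef_pos: "coef F (int k') = (if k' = k then bstar else 0\<^sub>m n n)" if k': "k' \<ge> 1" for k'
  proof (rule eq_matI)
    fix i j assume "i < dim_row (if k' = k then bstar else 0\<^sub>m n n)" "j < dim_col (if k' = k then bstar else 0\<^sub>m n n)"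
    then have ij: "i < n" "j < n" using bB by (auto split: if_splits)
    have "k' = 1 \<or> k' \<ge> 2" using k' by auto
    then show "coef F (int k') $$ (i, j) = (if k' = k then bstar else 0\<^sub>m n n) $$ (i, j)"
    proof
      assume "k' = 1"
      then show ?thesis using ij nth[OF ij, of 1] nUL[of "(i, j)"] by (auto simp: G_def H_def M_def Ak_def bk_def)
    next
      assume k2: "k' \<ge> 2"
      then have "nat (int k' - 2) = k' - 2" by simp
      then show ?thesis using ij k2 nth[OF ij, of "int k'"] by (auto simp: G_def)
    qed
  qed (use Fc bB in \<open>auto simp: coef_def\<close>)
  have coef_zero: "coef F 0 - f = (if k = 0 then bstar else 0\<^sub>m n n)"
  proof (rule eq_matI)
    fix i j assume "i < dim_row (if k = 0 then bstar else 0\<^sub>m n n)" "j < dim_col (if k = 0 then bstar else 0\<^sub>m n n)"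
    then have ij: "i < n" "j < n" using bB by (auto split: if_splits)
    let ?q = "(i, j)"
    have q: "?q \<in> {..<n} \<times> {..<n}" using ij by simp
    have "coef F 0 $$ ?q = Gk ?q + Ak (tau n c ?q)"
    proof -
      consider "?q \<in> UR" | "?q \<in> LL" "?q \<notin> UR" | "?q \<notin> UR" "?q \<notin> LL" by blast
      then show ?thesis
      proof cases
        case 1
        then show ?thesis using nth[OF ij, of 0] nUL[OF 1] ij system_UR[OF Ak_system 1] by (simp add: N_def)
      next
        case 2
        then show ?thesis using nth[OF ij, of 0] ij system_unique(3)[OF Ak_system Gk_sum q 2(1)] by (simp add: N_def)
      next
        case 3
        then show ?thesis using nth[OF ij, of 0] ij system_diag[OF Ak_system q 3] by (simp add: N_def M_def)
      qed
    qed
    moreover have "(coef F 0 - f) $$ ?q = coef F 0 $$ ?q - f $$ ?q" using ij Fc fc by simp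
    ultimately show "(coef F 0 - f) $$ ?q = (if k = 0 then bstar else 0\<^sub>m n n) $$ ?q"
      using ij by (simp add: f_index Gk_def)
  qed (use fc bB in auto)
  have "form (j_emb (map_mat (\<lambda>a. monom a k') b')) ?w = (if k' = k \<and> b' = b then 1 else 0)" if b': "b' \<in> B" for k' b'
  proof -
    note bc = sl_carrier[OF B_sl[OF b']]
    have ab: "tr (b' * bstar) = (if b' = b then 1 else 0)"
      using dual_pairing[OF bB b'] tr_comm[OF bc ac] by simp
    have z: "tr (b' * 0\<^sub>m n n) = 0" using bc by (simp add: tr_def)
    have "form (j_emb (map_mat (\<lambda>a. monom a k') b')) ?w = tr (b' * coef F (int k')) - (if k' = 0 then tr (b' * f) else 0)"
      using form_j_emb[OF bc Fc fc, of k'] by (simp add: F_def f_def)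
    also have "\<dots> = (if k' = k then tr (b' * bstar) else 0)"
    proof (cases "k' = 0")
      case True
      have "tr (b' * coef F 0) - tr (b' * f) = tr (b' * (coef F 0 - f))"
        unfolding mult_minus_distrib_mat[OF bc coef_carrier[OF Fc] fc]
        by (rule tr_minus[OF mult_carrier_mat[OF bc coef_carrier[OF Fc]] mult_carrier_mat[OF bc fc], symmetric])
      then show ?thesis using True z by (auto simp: coef_zero)
    next
      case False
      then show ?thesis using coef_pos[of k'] z by auto
    qed
    finally show ?thesis using ab by auto
  qed
  then have "paired ?w" unfolding paired_def by blast
  moreover have "?w \<in> W_order c d" unfolding W_order_iff using G_sl H_b N_n M_sl by blast
  ultimately show ?thesis by blast
qed

lemma w_dual_nth:
  assumes "i < n" "j < n"
  shows "fls_nth (fst (w_dual c d B k b) $$ (i, j)) m = w_nth (i, j) m"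
    and "fst (w_dual c d B k b) \<in> carrier_mat n n"
proof -
  obtain w where w: "w \<in> W_order c d" "paired w" using paired_exists by blast
  have "w_dual c d B k b = w"
    unfolding w_dual_def paired_def[symmetric] using w paired_unique by (intro the_equality) blast+
  then have "w_dual c d B k b \<in> W_order c d" "paired (w_dual c d B k b)" using w by auto
  then obtain G H N M where W: "G \<in> sl n" "H \<in> b_par c d" "N \<in> n_par c d" "M \<in> sl n" "w_dual c d B k b = W_elem G H N M"
    and p: "paired (W_elem G H N M)" by (auto simp: W_order_iff)
  show "fls_nth (fst (w_dual c d B k b) $$ (i, j)) m = w_nth (i, j) m"
    unfolding W(5) by (rule nth_w(1)[OF W(1-4) p assms])
  show "fst (w_dual c d B k b) \<in> carrier_mat n n" by (simp add: W(5) W_elem_def)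
qed

end
end

section \<open>The solution attached to the order\<close>

lemma has_sum_if_eq: "((\<lambda>k::nat. if k = m then s else 0) has_sum s) UNIV" for s :: complex
proof (rule norm_summable_imp_has_sum)
  show "summable (\<lambda>k. norm (if k = m then s else 0))"
    by (rule summable_finite[of "{m}"]) auto
  show "(\<lambda>k. if k = m then s else 0) sums s" by (rule sums_single)
qed

lemma has_sum_geometric: "norm t < 1 \<Longrightarrow> ((\<lambda>k. t ^ k) has_sum 1 / (1 - t)) UNIV" for t :: complex
  by (rule norm_summable_imp_has_sum) (auto simp: norm_power intro: geometric_sums)

lemma has_sum_times_finite:
  fixes f :: "'a \<times> 'b \<Rightarrow> complex"
  assumes "finite B" "\<And>b. b \<in> B \<Longrightarrow> ((\<lambda>k. f (k, b)) has_sum s b) UNIV"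
  shows "(f has_sum (\<Sum>b\<in>B. s b)) (UNIV \<times> B)"
  using assms
proof (induction B rule: finite_induct)
  case (insert b B)
  have i: "inj (\<lambda>k :: 'a. (k, b))" by (auto simp: inj_on_def)
  have "(f has_sum s b) (range (\<lambda>k. (k, b)))"
    unfolding has_sum_reindex[OF i] o_def by (rule insert.prems) simp
  moreover have "(f has_sum (\<Sum>b\<in>B. s b)) (UNIV \<times> B)" using insert by blast
  ultimately have "(f has_sum s b + (\<Sum>b\<in>B. s b)) (range (\<lambda>k. (k, b)) \<union> UNIV \<times> B)"
    by (rule has_sum_Un_disjoint) (use insert.hyps in auto)
  also have "range (\<lambda>k. (k, b)) \<union> UNIV \<times> B = UNIV \<times> insert b B" by auto
  finally show ?case using insert.hyps by (simp only: sum.insert not_False_eq_True)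
qed simp

context shift_basis begin

lemma X0_zero: "X0 (\<lambda>_. 0) (\<lambda>_. 0) q = 0" and X1_zero: "X1 (\<lambda>_. 0) q = 0"
  by (simp_all add: X0_def X1_def chainT_def chainS_def diagY_def dsum_def)

lemma w_dual_eval:
  assumes b: "b \<in> B" and y: "y \<noteq> 0" and q: "i < n" "j < n"
  shows "eval_fls (fst (w_dual c d B k b) $$ (i, j)) (1 / y) =
    (if k \<ge> 1 then dual_vector n B b $$ (i, j) / y ^ k else 0) + X0 (Gk k b) (bk k b) (i, j) + y * X1 (Gk k b) (i, j)"
  by (rule eval_fls_Laurent_poly[OF y]) (simp only: w_dual_nth(1)[OF b q] w_nth_def[OF b])

text \<open>The dual vector enters the dual element only for positive k. To have a full geometric
  series it is added at k = 0 and subtracted again in the correction.\<close>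

lemma series_term:
  assumes b: "b \<in> B" and y: "y \<noteq> 0" and q: "i < n" "j < n"
  defines "A \<equiv> \<lambda>q. dual_vector n B b $$ q"
  shows "x ^ k * eval_fls (fst (w_dual c d B k b) $$ (i, j)) (1 / y) = (x / y) ^ k * A (i, j)
    + (if k = 0 then X0 A (\<lambda>_. 0) (i, j) + y * X1 A (i, j) - A (i, j) else 0)
    + (if k = 1 then x * X0 (\<lambda>_. 0) A (i, j) else 0)"
proof -
  have G: "Gk k b = (if k = 0 then A else (\<lambda>_. 0))" and B: "bk k b = (if k = 1 then A else (\<lambda>_. 0))"
    by (auto simp: Gk_def[OF b] bk_def[OF b] A_def)
  consider "k = 0" | "k = 1" | "k \<ge> 2" by linarith
  then show ?thesis
    unfolding w_dual_eval[OF b y q] G B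
    by cases (simp_all add: X0_zero X1_zero A_def power_divide algebra_simps)
qed

lemma rform_has_sum:
  assumes x: "0 < norm x" and xy: "norm x < norm y"
  shows "((\<lambda>(k, b). x ^ k * (b \<otimes>\<^sub>t map_mat (\<lambda>f. eval_fls f (1 / y)) (fst (w_dual c d B k b))) p q)
     has_sum rform x y p q) (UNIV \<times> B)"
proof -
  have y: "y \<noteq> 0" and ne: "x \<noteq> y" and yx: "y - x \<noteq> 0" using x xy by auto
  obtain i j where p: "p = (i, j)" by (cases p)
  obtain l m where q: "q = (l, m)" by (cases q)
  let ?D = "dual_vector n B"
  have dims: "dim_row b = n" "dim_col b = n" "dim_row (fst (w_dual c d B k b)) = n" "dim_col (fst (w_dual c d B k b)) = n" 
    if "b \<in> B" for k b
    using w_dual_nth(2)[OF that n_pos n_pos, of k] sl_carrier[OF B_sl[OF that]] by auto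
  have R: "rform x y p q = (if i < n \<and> j < n then \<Sum>b\<in>B. b $$ (i, j) * contr n (rform x y) (?D b) q else 0)"
    unfolding p by (rule tensor_expand[OF sl_tensor_rform])
  show ?thesis
  proof (cases "i < n \<and> j < n \<and> l < n \<and> m < n")
    case False
    then have "rform x y p q = 0"
      using contr_rform[OF dual_sl ne] unfolding R unfolding q by (auto intro!: sum.neutral)
    moreover have "(case kb of (k, b) \<Rightarrow> x ^ k * (b \<otimes>\<^sub>t map_mat (\<lambda>f. eval_fls f (1 / y)) (fst (w_dual c d B k b))) p q) = 0"
      if "kb \<in> UNIV \<times> B" for kb
      using False that dims by (auto simp: p q tensor_def)
    ultimately show ?thesis by (simp only: has_sum_0)
  next
    case True
    then have lm: "l < n" "m < n" and ij: "i < n" "j < n" by auto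
    have "((\<lambda>k. x ^ k * (b \<otimes>\<^sub>t map_mat (\<lambda>f. eval_fls f (1 / y)) (fst (w_dual c d B k b))) p q)
       has_sum b $$ (i, j) * contr n (rform x y) (?D b) q) UNIV" if b: "b \<in> B" for b
    proof -
      let ?A = "\<lambda>q. ?D b $$ q"
      let ?c0 = "X0 ?A (\<lambda>_. 0) q + y * X1 ?A q - ?A q" and ?c1 = "x * X0 (\<lambda>_. 0) ?A q"
      have "norm (x / y) < 1" using y xy by (simp add: norm_divide)
      from has_sum_cmult_right[OF has_sum_geometric[OF this], of "?A q"]
      have "((\<lambda>k. (x / y) ^ k * ?A q) has_sum 1 / (1 - x / y) * ?A q) UNIV" by (simp add: mult.commute)
      from has_sum_cmult_right[OF has_sum_add[OF has_sum_add[OF this has_sum_if_eq[of 0 ?c0]] has_sum_if_eq[of 1 ?c1]], of "b $$ (i, j)"]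
      have 1: "((\<lambda>k. b $$ (i, j) * (x ^ k * eval_fls (fst (w_dual c d B k b) $$ (l, m)) (1 / y)))
          has_sum b $$ (i, j) * (1 / (1 - x / y) * ?A q + ?c0 + ?c1)) UNIV"
        unfolding series_term[OF b y lm] q .
      \<comment> \<open>The summand 1 cancels the dual vector subtracted at k = 0, leaving the
        factor x/(y - x) of \<open>contr_rform\<close>.\<close>
      have "1 / (1 - x / y) = x / (y - x) + 1" using y yx by (simp add: field_simps)
      then have "1 / (1 - x / y) * ?A q + ?c0 + ?c1 = contr n (rform x y) (?D b) q"
        using lm X0_split[of ?A x ?A q] unfolding q contr_rform[OF dual_sl[OF b] ne] by (simp add: algebra_simps)
      moreover have "b $$ (i, j) * (x ^ k * eval_fls (fst (w_dual c d B k b) $$ (l, m)) (1 / y)) =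
        x ^ k * (b \<otimes>\<^sub>t map_mat (\<lambda>f. eval_fls f (1 / y)) (fst (w_dual c d B k b))) p q" for k
        using dims[OF b] ij lm by (simp add: p q tensor_def)
      ultimately show ?thesis using 1 by (simp only:)
    qed
    then have "((\<lambda>(k, b). x ^ k * (b \<otimes>\<^sub>t map_mat (\<lambda>f. eval_fls f (1 / y)) (fst (w_dual c d B k b))) p q)
       has_sum (\<Sum>b\<in>B. b $$ (i, j) * contr n (rform x y) (?D b) q)) (UNIV \<times> B)"
      by (intro has_sum_times_finite finite_B) simp
    then show ?thesis unfolding R using ij by simp
  qed
qed

end

theorem theorem6p3:
  fixes c d n :: nat and P :: vbundle and \<xi> :: "ratfun mat \<Rightarrow> ratfun mat"
    and B :: "complex mat set"
  assumes "0 < c" and "0 < d" and "coprime c d" and "n = c + d"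
    and "vector_bundle n P" and "bundle_degree n P = int d" and "simple_bundle n P"
    and "is_trivialization c d P \<xi>"
    and "sl_basis n B"
  shows "(\<forall>x y. x \<noteq> 0 \<and> y \<noteq> 0 \<and> x \<noteq> y \<longrightarrow>
      rho_xi n P \<xi> x y =
        (1 / 2) \<cdot>\<^sub>t (((y + x) / (y - x)) \<cdot>\<^sub>t casimir n B
          + (\<Sum>\<alpha>\<in>pos_roots n. e_mat n \<alpha> \<and>\<^sub>t e_mat n (neg_root \<alpha>)))
        + (\<Sum>\<alpha>\<in>pos_roots n.
            (\<Sum>k = 1..p_fun n c \<alpha> - 1. e_mat n ((tau n c ^^ k) \<alpha>) \<and>\<^sub>t e_mat n (neg_root \<alpha>))
            + x \<cdot>\<^sub>t (e_mat n ((tau n c ^^ p_fun n c \<alpha>) \<alpha>) \<otimes>\<^sub>t e_mat n (neg_root \<alpha>))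
            - y \<cdot>\<^sub>t (e_mat n (neg_root \<alpha>) \<otimes>\<^sub>t e_mat n ((tau n c ^^ p_fun n c \<alpha>) \<alpha>)))
        + (\<Sum>i = 1..n - 1. q_dual n c i \<otimes>\<^sub>t f_mat n c i))
    \<and> solution_of_order c d B (rho_xi n P \<xi>)"
proof -
  interpret trivialization_basis c d n P \<xi> B
    using assms by unfold_locales auto
  have rho: "rho_xi n P \<xi> x y = rform x y" if "x \<noteq> 0 \<and> y \<noteq> 0 \<and> x \<noteq> y" for x y
    using that by (intro rho_xi_eq) auto
  have "solution_of_order c d B (rho_xi n P \<xi>)"
    unfolding solution_of_order_def
  proof (intro allI impI)
    fix x y :: complex and p q assume xy: "0 < norm x \<and> norm x < norm y"
    then have "rho_xi n P \<xi> x y = rform x y" by (intro rho) auto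
    then show "((\<lambda>(k, b). x ^ k * (b \<otimes>\<^sub>t map_mat (\<lambda>f. eval_fls f (1 / y)) (fst (w_dual c d B k b))) p q)
      has_sum rho_xi n P \<xi> x y p q) (UNIV \<times> B)"
      using rform_has_sum[of x y p q] xy by simp
  qed
  then show ?thesis by (intro conjI allI impI) (rule rho[unfolded rform_def])
qed

end
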